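(* Let $\Bbbk$ be a finite field of order $p^n$, $p$ prime. Let $G$ and $H$ be groups in $\mathfrak{G}_{p,n}$. The following are equivalent: (1) $G$ and $H$ are isomorphic; and (2) for every $\Bbbk$-coalgebra $C$, $G$ acts faithfully on $C$ if and only if $H$ acts faithfully on $C$.
   Context: A group is co-Hopfian if it contains no proper subgroup isomorphic to itself; equivalently, every injective endomorphism is an automorphism. For a prime $p$ and $n\ge 1$, a group $G$ is in the class $\mathfrak{G}_{p,n}$ if (1) $G$ is co-Hopfian; and (2) $G$ does not have finite non-trivial normal subgroups whose exponent divides $p^n(p^n-1)$. Coalgebras are coassociative and counital. A group $G$ acts faithfully on a coalgebra $C$ if there is an injective group homomorphism $G\hookrightarrow\operatorname{Aut}(C)$ into the group of coalgebra automorphisms of $C$. *)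

theory Defs
  imports "HOL-Computational_Algebra.Primes" "HOL-Algebra.Module" "HOL-Algebra.AbelCoset" "HOL-Algebra.Bij"
begin

section \<open>Tensor products of modules\<close>

text \<open>
  The tensor product of \<open>M\<close> and \<open>N\<close> is the free module on \<open>carrier M \<times> carrier N\<close> modulo the
  bilinearity relations.  A \<open>module\<close> record also has ring fields \<open>mult\<close> and \<open>one\<close>, which the locale
  \<open>module\<close> ignores; they are left \<open>undefined\<close> below.
\<close>

definition module_hom ::
    "('r, 'a) ring_scheme \<Rightarrow> ('r, 'm, 'b) module_scheme \<Rightarrow> ('r, 'n, 'c) module_scheme \<Rightarrow> ('m \<Rightarrow> 'n) set"
  where "module_hom R M N =
    {f \<in> carrier M \<rightarrow> carrier N.
       (\<forall>x\<in>carrier M. \<forall>y\<in>carrier M. f (x \<oplus>\<^bsub>M\<^esub> y) = f x \<oplus>\<^bsub>N\<^esub> f y) \<and>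
       (\<forall>a\<in>carrier R. \<forall>x\<in>carrier M. f (a \<odot>\<^bsub>M\<^esub> x) = a \<odot>\<^bsub>N\<^esub> f x)}"

definition self_module :: "('r, 'a) ring_scheme \<Rightarrow> ('r, 'r) module"
  where "self_module R =
    \<lparr>carrier = carrier R, mult = mult R, one = one R,
     zero = zero R, add = add R, smult = mult R\<rparr>"

definition free_module :: "('r, 'a) ring_scheme \<Rightarrow> 's set \<Rightarrow> ('r, 's \<Rightarrow> 'r) module"
  where "free_module R S =
    \<lparr>carrier = {f. (\<forall>s\<in>S. f s \<in> carrier R) \<and> (\<forall>s. s \<notin> S \<longrightarrow> f s = \<zero>\<^bsub>R\<^esub>) \<and> finite {s. f s \<noteq> \<zero>\<^bsub>R\<^esub>}},
     mult = undefined, one = undefined,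
     zero = (\<lambda>s. \<zero>\<^bsub>R\<^esub>), add = (\<lambda>f g s. f s \<oplus>\<^bsub>R\<^esub> g s), smult = (\<lambda>a f s. a \<otimes>\<^bsub>R\<^esub> f s)\<rparr>"

definition free_gen :: "('r, 'a) ring_scheme \<Rightarrow> 's \<Rightarrow> 's \<Rightarrow> 'r"
  where "free_gen R s = (\<lambda>t. if t = s then \<one>\<^bsub>R\<^esub> else \<zero>\<^bsub>R\<^esub>)"

definition quotient_module ::
    "('r, 'm, 'b) module_scheme \<Rightarrow> 'm set \<Rightarrow> ('r, 'm set) module"
  where "quotient_module M W =
    \<lparr>carrier = a_rcosets\<^bsub>M\<^esub> W, mult = undefined, one = undefined,
     zero = W, add = set_add M, smult = (\<lambda>a A. \<Union>x\<in>A. W +>\<^bsub>M\<^esub> (a \<odot>\<^bsub>M\<^esub> x))\<rparr>"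

definition bilinear_relators ::
    "('r, 'a) ring_scheme \<Rightarrow> ('r, 'm, 'b) module_scheme \<Rightarrow> ('r, 'n, 'c) module_scheme \<Rightarrow> ('m \<times> 'n \<Rightarrow> 'r) set"
  where "bilinear_relators R M N =
    (let F = free_module R (carrier M \<times> carrier N); e = (\<lambda>x y. free_gen R (x, y)) in
      {e (x \<oplus>\<^bsub>M\<^esub> x') y \<ominus>\<^bsub>F\<^esub> (e x y \<oplus>\<^bsub>F\<^esub> e x' y) | x x' y.
         x \<in> carrier M \<and> x' \<in> carrier M \<and> y \<in> carrier N} \<union>
      {e x (y \<oplus>\<^bsub>N\<^esub> y') \<ominus>\<^bsub>F\<^esub> (e x y \<oplus>\<^bsub>F\<^esub> e x y') | x y y'.
         x \<in> carrier M \<and> y \<in> carrier N \<and> y' \<in> carrier N} \<union>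
      {e (a \<odot>\<^bsub>M\<^esub> x) y \<ominus>\<^bsub>F\<^esub> (a \<odot>\<^bsub>F\<^esub> e x y) | a x y.
         a \<in> carrier R \<and> x \<in> carrier M \<and> y \<in> carrier N} \<union>
      {e x (a \<odot>\<^bsub>N\<^esub> y) \<ominus>\<^bsub>F\<^esub> (a \<odot>\<^bsub>F\<^esub> e x y) | a x y.
         a \<in> carrier R \<and> x \<in> carrier M \<and> y \<in> carrier N})"

definition bilinear_submodule ::
    "('r, 'a) ring_scheme \<Rightarrow> ('r, 'm, 'b) module_scheme \<Rightarrow> ('r, 'n, 'c) module_scheme \<Rightarrow> ('m \<times> 'n \<Rightarrow> 'r) set"
  where "bilinear_submodule R M N =
    \<Inter>{W. submodule W R (free_module R (carrier M \<times> carrier N)) \<and> bilinear_relators R M N \<subseteq> W}"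

definition tensor_product ::
    "('r, 'a) ring_scheme \<Rightarrow> ('r, 'm, 'b) module_scheme \<Rightarrow> ('r, 'n, 'c) module_scheme
      \<Rightarrow> ('r, ('m \<times> 'n \<Rightarrow> 'r) set) module"
  where "tensor_product R M N =
    quotient_module (free_module R (carrier M \<times> carrier N)) (bilinear_submodule R M N)"

definition pure_tensor ::
    "('r, 'a) ring_scheme \<Rightarrow> ('r, 'm, 'b) module_scheme \<Rightarrow> ('r, 'n, 'c) module_scheme
      \<Rightarrow> 'm \<Rightarrow> 'n \<Rightarrow> ('m \<times> 'n \<Rightarrow> 'r) set"
  where "pure_tensor R M N x y =
    bilinear_submodule R M N +>\<^bsub>free_module R (carrier M \<times> carrier N)\<^esub> free_gen R (x, y)"

definition free_lift :: "('r, 'a) ring_scheme \<Rightarrow> ('r, 'p, 'd) module_scheme \<Rightarrow> ('s \<Rightarrow> 'p) \<Rightarrow> ('s \<Rightarrow> 'r) \<Rightarrow> 'p"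
  where "free_lift R P b f = (\<Oplus>\<^bsub>P\<^esub>s\<in>{s. f s \<noteq> \<zero>\<^bsub>R\<^esub>}. f s \<odot>\<^bsub>P\<^esub> b s)"

text \<open>
  The linear map on the tensor product induced by a map \<open>b\<close> that is bilinear on the carriers.
  For such \<open>b\<close> the linear extension \<open>free_lift\<close> vanishes on \<open>bilinear_submodule\<close>, hence it is
  constant on every coset and the set under \<open>the_elem\<close> is a singleton.
\<close>

definition tensor_lift ::
    "('r, 'a) ring_scheme \<Rightarrow> ('r, 'p, 'd) module_scheme \<Rightarrow> ('m \<Rightarrow> 'n \<Rightarrow> 'p) \<Rightarrow> ('m \<times> 'n \<Rightarrow> 'r) set \<Rightarrow> 'p"
  where "tensor_lift R P b A = the_elem (free_lift R P (case_prod b) ` A)"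

definition tensor_map ::
    "('r, 'a) ring_scheme \<Rightarrow> ('r, 'm, 'b) module_scheme \<Rightarrow> ('r, 'n, 'c) module_scheme
      \<Rightarrow> ('m0 \<Rightarrow> 'm) \<Rightarrow> ('n0 \<Rightarrow> 'n) \<Rightarrow> ('m0 \<times> 'n0 \<Rightarrow> 'r) set \<Rightarrow> ('m \<times> 'n \<Rightarrow> 'r) set"
  where "tensor_map R M N f g =
    tensor_lift R (tensor_product R M N) (\<lambda>x y. pure_tensor R M N (f x) (g y))"

text \<open>The canonical map \<open>(L \<otimes> M) \<otimes> N \<rightarrow> L \<otimes> (M \<otimes> N)\<close>, \<open>(x \<otimes> y) \<otimes> z \<mapsto> x \<otimes> (y \<otimes> z)\<close>.\<close>

definition tensor_assoc ::
    "('r, 'a) ring_scheme \<Rightarrow> ('r, 'l, 'b) module_scheme \<Rightarrow> ('r, 'm, 'c) module_scheme \<Rightarrow> ('r, 'n, 'd) module_scheme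
      \<Rightarrow> (('l \<times> 'm \<Rightarrow> 'r) set \<times> 'n \<Rightarrow> 'r) set \<Rightarrow> ('l \<times> ('m \<times> 'n \<Rightarrow> 'r) set \<Rightarrow> 'r) set"
  where "tensor_assoc R L M N =
    (let T = tensor_product R L (tensor_product R M N) in
      tensor_lift R T (\<lambda>t z. tensor_lift R T
        (\<lambda>x y. pure_tensor R L (tensor_product R M N) x (pure_tensor R M N y z)) t))"


section \<open>Coalgebras\<close>

record ('k, 'c) coalgebra = "('k, 'c) module" +
  comult :: "'c \<Rightarrow> ('c \<times> 'c \<Rightarrow> 'k) set"
  counit :: "'c \<Rightarrow> 'k"

text \<open>
  In the counit laws \<open>K \<otimes> C\<close> and \<open>C \<otimes> K\<close> are identified with \<open>C\<close> by \<open>\<one> \<otimes> x \<leftrightarrow> x\<close> and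
  \<open>x \<otimes> \<one> \<leftrightarrow> x\<close>.
\<close>

locale coalgebra = K?: field K + module K C
  for K :: "('k, 'a) ring_scheme" (structure) and C :: "('k, 'c, 'e) coalgebra_scheme" (structure) +
  assumes comult_hom: "comult C \<in> module_hom K C (tensor_product K C C)"
    and counit_hom: "counit C \<in> module_hom K C (self_module K)"
    and coassoc: "x \<in> carrier C \<Longrightarrow>
      tensor_assoc K C C C (tensor_map K (tensor_product K C C) C (comult C) (\<lambda>y. y) (comult C x)) =
      tensor_map K C (tensor_product K C C) (\<lambda>y. y) (comult C) (comult C x)"
    and counit_left: "x \<in> carrier C \<Longrightarrow>
      tensor_map K (self_module K) C (counit C) (\<lambda>y. y) (comult C x) =
      pure_tensor K (self_module K) C \<one>\<^bsub>K\<^esub> x"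
    and counit_right: "x \<in> carrier C \<Longrightarrow>
      tensor_map K C (self_module K) (\<lambda>y. y) (counit C) (comult C x) =
      pure_tensor K C (self_module K) x \<one>\<^bsub>K\<^esub>"

definition coalgebra_hom ::
    "('k, 'a) ring_scheme \<Rightarrow> ('k, 'c, 'b) coalgebra_scheme \<Rightarrow> ('k, 'd, 'e) coalgebra_scheme \<Rightarrow> ('c \<Rightarrow> 'd) set"
  where "coalgebra_hom K C D =
    {f \<in> module_hom K C D. \<forall>x\<in>carrier C.
       comult D (f x) = tensor_map K D D f f (comult C x) \<and> counit D (f x) = counit C x}"

definition coalgebra_auto ::
    "('k, 'a) ring_scheme \<Rightarrow> ('k, 'c, 'b) coalgebra_scheme \<Rightarrow> ('c \<Rightarrow> 'c) set"
  where "coalgebra_auto K C = coalgebra_hom K C C \<inter> Bij (carrier C)"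

definition coalgebra_AutoGroup ::
    "('k, 'a) ring_scheme \<Rightarrow> ('k, 'c, 'b) coalgebra_scheme \<Rightarrow> ('c \<Rightarrow> 'c) monoid"
  where "coalgebra_AutoGroup K C = BijGroup (carrier C)\<lparr>carrier := coalgebra_auto K C\<rparr>"

definition acts_faithfully ::
    "('k, 'a) ring_scheme \<Rightarrow> ('g, 'f) monoid_scheme \<Rightarrow> ('k, 'c, 'b) coalgebra_scheme \<Rightarrow> bool"
  where "acts_faithfully K G C \<longleftrightarrow> (\<exists>\<phi>. \<phi> \<in> mon G (coalgebra_AutoGroup K C))"


section \<open>Co-Hopfian groups and the class \<open>group_class\<close>\<close>

definition co_Hopfian :: "('g, 'a) monoid_scheme \<Rightarrow> bool"
  where "co_Hopfian G \<longleftrightarrow> (\<forall>H. subgroup H G \<and> G\<lparr>carrier := H\<rparr> \<cong> G \<longrightarrow> H = carrier G)"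

text \<open>Only used for finite groups, where a positive \<open>m\<close> as below exists.\<close>

definition group_exponent :: "('g, 'a) monoid_scheme \<Rightarrow> nat"
  where "group_exponent G = (LEAST m. 0 < m \<and> (\<forall>x\<in>carrier G. x [^]\<^bsub>G\<^esub> m = \<one>\<^bsub>G\<^esub>))"

definition group_class :: "nat \<Rightarrow> nat \<Rightarrow> ('g, 'a) monoid_scheme \<Rightarrow> bool"
  where "group_class p n G \<longleftrightarrow>
    group G \<and> co_Hopfian G \<and>
    \<not> (\<exists>N. N \<lhd> G \<and> finite N \<and> N \<noteq> {\<one>\<^bsub>G\<^esub>} \<and>
          group_exponent (G\<lparr>carrier := N\<rparr>) dvd p ^ n * (p ^ n - 1))"

text \<open>
  HOL cannot quantify over all types inside a formula, so "every coalgebra" is read as every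
  coalgebra whose elements lie in a universe type.  The type contains an arbitrary type \<open>'u\<close>, so
  no coalgebra is excluded, and it contains the types of the groups and the natural numbers, so it
  is never too small: over a finite field, vector spaces with a basis indexed by a countable set or
  by one of the groups always occur in it up to isomorphism.
\<close>

type_synonym ('g, 'h, 'u) universe = "'g + 'h + nat + 'u"

end

theory Submission
  imports Complex_Main "HOL-Library.Function_Algebras" "HOL-Library.Groups_Big_Fun" "HOL-Library.Countable" Defs
begin

text \<open>
  For every group \<open>G\<close> there is a coalgebra \<open>C\<close> with \<open>Aut(C) \<cong> G\<close>. If \<open>G\<close> and \<open>H\<close> act faithfully on the
  same coalgebras, then \<open>H\<close> therefore embeds into \<open>G\<close> and \<open>G\<close> into \<open>H\<close>, and as \<open>G\<close> is co-Hopfian both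
  embeddings are isomorphisms.

  The coalgebra \<open>C\<close> has as basis a monoid \<open>S\<close>, with \<open>\<Delta>(m)\<close> the sum of all \<open>u \<otimes> w\<close> with \<open>u + w = m\<close>.
  Here \<open>S\<close> consists of rational functions on the nodes of a digraph with labels \<open>lab\<close>; it is generated by the
  unit vectors \<open>e\<^sub>s\<close> and the vectors \<open>e\<^sub>s / lab t + e\<^sub>t\<close> for the arcs from \<open>s\<close> to \<open>t\<close>. The matrix of an
  automorphism of \<open>C\<close> is a multiplicative family \<open>\<Phi>\<close>, indexed by \<open>S\<close>, of elements of the dual algebra.
  Over a field with \<open>q\<close> elements the \<open>q\<^sup>j\<close>-th power of a series \<open>\<Sum> a\<^sub>m x\<^sup>m\<close> is \<open>\<Sum> a\<^sub>m x\<^bsup>q^j m\<^esup>\<close>. Apply \<open>\<Phi>\<close> to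
  \<open>q\<^sup>j (e\<^sub>s / q\<^sup>j + e\<^sub>t) = e\<^sub>s + q\<^sup>j e\<^sub>t\<close> for arcs with label \<open>q\<^sup>j\<close>: comparing supports and letting \<open>j\<close> grow
  shows that \<open>\<Phi>(e\<^sub>s)\<close> is a combination of monomials at vertices, and that \<open>\<Phi>\<close> respects arcs and labels. The digraph
  is built from \<open>G\<close> so that only the translations by \<open>G\<close> remain, up to scalars; arcs with labels
  \<open>q\<^sup>d - 1\<close> force these scalars to be \<open>1\<close>.
\<close>

text \<open>Two obstacles shape the construction. First, the image of a basis element is an
  arbitrary finite combination, and coefficients can only be compared at an exponent to which a
  single product contributes. The degree (sum of coordinates) provides such exponents: labels are at
  least 2, so generators have degrees in \<open>[1, 3/2]\<close> and all other nonzero elements have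
  degree at least 2. Hence an exponent that turns out to be divisible by \<open>q^j\<close>, with a
  nonzero quotient of degree below 2, is \<open>q^j\<close> times a generator. Second, each
  character \<open>chi\<close> of the monoid with nonzero scalar values gives the diagonal
  automorphism \<open>m -> chi(m) m\<close>. As \<open>x^q = x\<close> for scalars, an arc
  \<open>a\<close> from \<open>s\<close> to \<open>t\<close> of label \<open>q^j\<close> only says
  \<open>chi(a) = chi(s) chi(t)\<close> and forces nothing. Label \<open>q^d - 1\<close> gives
  \<open>chi(a)^(q^d - 1) = chi(s) chi(t)^(q^d - 1)\<close>, and as \<open>q - 1\<close> divides
  \<open>q^d - 1\<close> this is \<open>chi(s) = 1\<close>. The values at these arcs themselves are
  fixed by relations between arcs of different labels with the same source.\<close>

lemma module_homI:
  assumes "\<And>x. x \<in> carrier M \<Longrightarrow> f x \<in> carrier N"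
    and "\<And>x y. x \<in> carrier M \<Longrightarrow> y \<in> carrier M \<Longrightarrow> f (x \<oplus>\<^bsub>M\<^esub> y) = f x \<oplus>\<^bsub>N\<^esub> f y"
    and "\<And>a x. a \<in> carrier R \<Longrightarrow> x \<in> carrier M \<Longrightarrow> f (a \<odot>\<^bsub>M\<^esub> x) = a \<odot>\<^bsub>N\<^esub> f x"
  shows "f \<in> module_hom R M N"
  using assms by (auto simp: module_hom_def)

lemma module_homD:
  assumes "f \<in> module_hom R M N"
  shows "\<And>x. x \<in> carrier M \<Longrightarrow> f x \<in> carrier N"
    and "\<And>x y. x \<in> carrier M \<Longrightarrow> y \<in> carrier M \<Longrightarrow> f (x \<oplus>\<^bsub>M\<^esub> y) = f x \<oplus>\<^bsub>N\<^esub> f y"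
    and "\<And>a x. a \<in> carrier R \<Longrightarrow> x \<in> carrier M \<Longrightarrow> f (a \<odot>\<^bsub>M\<^esub> x) = a \<odot>\<^bsub>N\<^esub> f x"
  using assms by (auto simp: module_hom_def)

lemma module_hom_comp:
  assumes "f \<in> module_hom R L M" "g \<in> module_hom R M N"
  shows "(\<lambda>x. g (f x)) \<in> module_hom R L N"
  using assms by (auto simp: module_hom_def Pi_iff)

lemma module_hom_id: "(\<lambda>x. x) \<in> module_hom R M M"
  by (auto simp: module_hom_def)

lemma module_hom_zero:
  assumes "module R M" "module R N" "f \<in> module_hom R M N"
  shows "f \<zero>\<^bsub>M\<^esub> = \<zero>\<^bsub>N\<^esub>"
proof -
  interpret M: module R M by fact
  interpret N: module R N by fact
  have "f (\<zero>\<^bsub>R\<^esub> \<odot>\<^bsub>M\<^esub> \<zero>\<^bsub>M\<^esub>) = \<zero>\<^bsub>R\<^esub> \<odot>\<^bsub>N\<^esub> f \<zero>\<^bsub>M\<^esub>"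
    by (rule module_homD(3)[OF assms(3)]) auto
  thus ?thesis using module_homD(1)[OF assms(3)] by simp
qed

lemma module_hom_finsum:
  assumes "module R M" "module R N" "f \<in> module_hom R M N"
    and "finite A" "\<And>a. a \<in> A \<Longrightarrow> g a \<in> carrier M"
  shows "f (\<Oplus>\<^bsub>M\<^esub>a\<in>A. g a) = (\<Oplus>\<^bsub>N\<^esub>a\<in>A. f (g a))"
proof -
  interpret M: module R M by fact
  interpret N: module R N by fact
  show ?thesis using assms(4,5)
  proof (induction A rule: finite_induct)
    case empty
    then show ?case using module_hom_zero[OF assms(1-3)] by simp
  next
    case (insert x F)
    have g: "g \<in> F \<rightarrow> carrier M" "g x \<in> carrier M" using insert by auto
    have fg: "(\<lambda>a. f (g a)) \<in> F \<rightarrow> carrier N" "f (g x) \<in> carrier N"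
      using g module_homD(1)[OF assms(3)] by auto
    show ?case
      using g fg insert by (simp add: module_homD(2)[OF assms(3)])
  qed
qed

lemma self_module_module:
  assumes "cring R" shows "module R (self_module R)"
proof -
  interpret cring R by fact
  show ?thesis
    by (intro moduleI abelian_groupI)
      (auto simp: self_module_def assms l_distr r_distr m_assoc a_assoc intro: a_comm
        intro!: bexI[of _ "\<ominus>\<^bsub>R\<^esub> _"] l_neg)
qed

lemma self_module_sel [simp]:
  "carrier (self_module R) = carrier R" "zero (self_module R) = zero R"
  "add (self_module R) = add R" "smult (self_module R) = mult R"
  by (auto simp: self_module_def)

lemma finsum_self_module [simp]: "finsum (self_module R) = finsum R"
  by (auto simp: finsum_def finprod_def fun_eq_iff)

text \<open>The module laws are inherited by images, so they need not be checked by hand on cosets,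
  nor on the copy of a free module inside another type; these are the two places of use.\<close>

lemma module_surj_image:
  assumes "module R M" and surj: "\<pi> ` carrier M = carrier Q"
    and zero: "\<pi> \<zero>\<^bsub>M\<^esub> = \<zero>\<^bsub>Q\<^esub>"
    and add: "\<And>x y. x \<in> carrier M \<Longrightarrow> y \<in> carrier M \<Longrightarrow> \<pi> (x \<oplus>\<^bsub>M\<^esub> y) = \<pi> x \<oplus>\<^bsub>Q\<^esub> \<pi> y"
    and smult: "\<And>a x. a \<in> carrier R \<Longrightarrow> x \<in> carrier M \<Longrightarrow> \<pi> (a \<odot>\<^bsub>M\<^esub> x) = a \<odot>\<^bsub>Q\<^esub> \<pi> x"
  shows "module R Q"
proof -
  interpret M: module R M by fact
  have ex: "\<exists>u\<in>carrier M. x = \<pi> u" if "x \<in> carrier Q" for x using that surj by auto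
  have cl: "\<pi> u \<in> carrier Q" if "u \<in> carrier M" for u using that surj by auto
  have inv: "\<exists>y\<in>carrier Q. y \<oplus>\<^bsub>Q\<^esub> x = \<zero>\<^bsub>Q\<^esub>" if x: "x \<in> carrier Q" for x
  proof -
    obtain u where u: "u \<in> carrier M" "x = \<pi> u" using ex[OF x] by blast
    have "\<pi> (\<ominus>\<^bsub>M\<^esub> u) \<oplus>\<^bsub>Q\<^esub> \<pi> u = \<pi> (\<ominus>\<^bsub>M\<^esub> u \<oplus>\<^bsub>M\<^esub> u)" using u by (simp add: add)
    also have "\<dots> = \<zero>\<^bsub>Q\<^esub>" using u by (simp add: M.M.l_neg zero)
    finally show ?thesis using u cl by blast
  qed
  have c: "cring R" by (rule M.R.is_cring)
  show ?thesis
  proof (intro moduleI abelian_groupI c)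
    show "\<And>x y. x \<in> carrier Q \<Longrightarrow> y \<in> carrier Q \<Longrightarrow> x \<oplus>\<^bsub>Q\<^esub> y \<in> carrier Q"
      by (metis ex add cl M.M.a_closed)
    show "\<zero>\<^bsub>Q\<^esub> \<in> carrier Q" using cl[OF M.M.zero_closed] zero by simp
    show "\<And>x y z. \<lbrakk>x \<in> carrier Q; y \<in> carrier Q; z \<in> carrier Q\<rbrakk>
        \<Longrightarrow> x \<oplus>\<^bsub>Q\<^esub> y \<oplus>\<^bsub>Q\<^esub> z = x \<oplus>\<^bsub>Q\<^esub> (y \<oplus>\<^bsub>Q\<^esub> z)"
      by (drule ex)+ (auto simp: add[symmetric] M.M.a_assoc)
    show "\<And>x y. \<lbrakk>x \<in> carrier Q; y \<in> carrier Q\<rbrakk> \<Longrightarrow> x \<oplus>\<^bsub>Q\<^esub> y = y \<oplus>\<^bsub>Q\<^esub> x"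
      by (drule ex)+ (auto simp: add[symmetric] M.M.a_comm)
    show "\<And>x. x \<in> carrier Q \<Longrightarrow> \<zero>\<^bsub>Q\<^esub> \<oplus>\<^bsub>Q\<^esub> x = x"
      by (drule ex) (auto simp: add[symmetric] zero[symmetric])
    show "\<And>x. x \<in> carrier Q \<Longrightarrow> \<exists>y\<in>carrier Q. y \<oplus>\<^bsub>Q\<^esub> x = \<zero>\<^bsub>Q\<^esub>" by (rule inv)
    show "\<And>a x. \<lbrakk>a \<in> carrier R; x \<in> carrier Q\<rbrakk> \<Longrightarrow> a \<odot>\<^bsub>Q\<^esub> x \<in> carrier Q"
      by (metis ex smult cl M.smult_closed)
    show "\<And>a b x. \<lbrakk>a \<in> carrier R; b \<in> carrier R; x \<in> carrier Q\<rbrakk>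
        \<Longrightarrow> (a \<oplus>\<^bsub>R\<^esub> b) \<odot>\<^bsub>Q\<^esub> x = a \<odot>\<^bsub>Q\<^esub> x \<oplus>\<^bsub>Q\<^esub> b \<odot>\<^bsub>Q\<^esub> x"
      by (drule ex) (auto simp: add[symmetric] smult[symmetric] M.smult_l_distr)
    show "\<And>a x y. \<lbrakk>a \<in> carrier R; x \<in> carrier Q; y \<in> carrier Q\<rbrakk>
        \<Longrightarrow> a \<odot>\<^bsub>Q\<^esub> (x \<oplus>\<^bsub>Q\<^esub> y) = a \<odot>\<^bsub>Q\<^esub> x \<oplus>\<^bsub>Q\<^esub> a \<odot>\<^bsub>Q\<^esub> y"
      by (drule ex)+ (auto simp: add[symmetric] smult[symmetric] M.smult_r_distr)
    show "\<And>a b x. \<lbrakk>a \<in> carrier R; b \<in> carrier R; x \<in> carrier Q\<rbrakk>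
        \<Longrightarrow> a \<otimes>\<^bsub>R\<^esub> b \<odot>\<^bsub>Q\<^esub> x = a \<odot>\<^bsub>Q\<^esub> (b \<odot>\<^bsub>Q\<^esub> x)"
      by (drule ex) (auto simp: smult[symmetric] M.smult_assoc1)
    show "\<And>x. x \<in> carrier Q \<Longrightarrow> \<one>\<^bsub>R\<^esub> \<odot>\<^bsub>Q\<^esub> x = x"
      by (drule ex) (auto simp: smult[symmetric])
  qed
qed


subsection \<open>Free modules\<close>

lemma free_module_sel:
  "carrier (free_module R S) =
    {f. (\<forall>s\<in>S. f s \<in> carrier R) \<and> (\<forall>s. s \<notin> S \<longrightarrow> f s = \<zero>\<^bsub>R\<^esub>) \<and> finite {s. f s \<noteq> \<zero>\<^bsub>R\<^esub>}}"
  "zero (free_module R S) = (\<lambda>s. \<zero>\<^bsub>R\<^esub>)"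
  "add (free_module R S) = (\<lambda>f g s. f s \<oplus>\<^bsub>R\<^esub> g s)"
  "smult (free_module R S) = (\<lambda>a f s. a \<otimes>\<^bsub>R\<^esub> f s)"
  by (auto simp: free_module_def)

context cring
begin

lemma free_module_closed:
  "f \<in> carrier (free_module R S) \<Longrightarrow> f s \<in> carrier R"
  by (cases "s \<in> S") (auto simp: free_module_sel)

lemma free_module_supp:
  assumes "f \<in> carrier (free_module R S)"
  shows "finite {s. f s \<noteq> \<zero>}" "{s. f s \<noteq> \<zero>} \<subseteq> S"
  using assms by (auto simp: free_module_sel)

lemma free_module_add_closed:
  assumes "f \<in> carrier (free_module R S)" "g \<in> carrier (free_module R S)"
  shows "(\<lambda>s. f s \<oplus> g s) \<in> carrier (free_module R S)"
proof -
  have "{s. f s \<oplus> g s \<noteq> \<zero>} \<subseteq> {s. f s \<noteq> \<zero>} \<union> {s. g s \<noteq> \<zero>}" by auto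
  hence "finite {s. f s \<oplus> g s \<noteq> \<zero>}"
    using assms by (auto simp: free_module_sel intro: finite_subset)
  thus ?thesis using assms by (auto simp: free_module_sel)
qed

lemma free_module_smult_closed:
  assumes "a \<in> carrier R" "f \<in> carrier (free_module R S)"
  shows "(\<lambda>s. a \<otimes> f s) \<in> carrier (free_module R S)"
proof -
  have "{s. a \<otimes> f s \<noteq> \<zero>} \<subseteq> {s. f s \<noteq> \<zero>}" using assms by auto
  hence "finite {s. a \<otimes> f s \<noteq> \<zero>}"
    using assms by (auto simp: free_module_sel intro: finite_subset)
  thus ?thesis using assms by (auto simp: free_module_sel)
qed

lemma free_module_module: "module R (free_module R S)"
proof (intro moduleI abelian_groupI is_cring)
  fix f assume f: "f \<in> carrier (free_module R S)"
  have "\<ominus> \<one> \<otimes> f s \<oplus> f s = \<zero>" for s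
    using free_module_closed[OF f] by (simp add: l_minus l_neg)
  thus "\<exists>y\<in>carrier (free_module R S). y \<oplus>\<^bsub>free_module R S\<^esub> f = \<zero>\<^bsub>free_module R S\<^esub>"
    using free_module_smult_closed[OF _ f, of "\<ominus> \<one>"]
    by (intro bexI[of _ "\<lambda>s. \<ominus> \<one> \<otimes> f s"]) (auto simp: free_module_sel(2-4))
qed (auto simp: free_module_sel(2-4) free_module_closed fun_eq_iff a_assoc l_distr r_distr m_assoc
      intro: a_comm intro!: free_module_add_closed free_module_smult_closed,
     auto simp: free_module_sel)

lemma free_gen_closed: "s \<in> S \<Longrightarrow> free_gen R s \<in> carrier (free_module R S)"
proof -
  have "finite {t. free_gen R s t \<noteq> \<zero>}"
    by (rule finite_subset[of _ "{s}"]) (auto simp: free_gen_def)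
  thus "s \<in> S \<Longrightarrow> ?thesis" by (auto simp: free_module_sel) (auto simp: free_gen_def)
qed

lemma free_module_induct [consumes 1, case_names zero add]:
  assumes "f \<in> carrier (free_module R S)"
    and zero: "P (\<lambda>s. \<zero>)"
    and step: "\<And>a s f. a \<in> carrier R \<Longrightarrow> s \<in> S \<Longrightarrow> f \<in> carrier (free_module R S) \<Longrightarrow> P f \<Longrightarrow>
      P (f \<oplus>\<^bsub>free_module R S\<^esub> a \<odot>\<^bsub>free_module R S\<^esub> free_gen R s)"
  shows "P f"
  using assms(1)
proof (induction "card {s. f s \<noteq> \<zero>}" arbitrary: f)
  case 0
  hence "{s. f s \<noteq> \<zero>} = {}" using free_module_supp(1) by (metis card_0_eq)
  hence "f = (\<lambda>s. \<zero>)" by auto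
  thus ?case using zero by simp
next
  case (Suc n)
  have fin: "finite {s. f s \<noteq> \<zero>}" using Suc free_module_supp(1) by blast
  obtain s where s: "f s \<noteq> \<zero>" using Suc(2) by (metis (mono_tags) card.empty empty_Collect_eq nat.distinct(1))
  have sS: "s \<in> S" using s free_module_supp(2)[OF Suc(3)] by auto
  define g where "g = f(s := \<zero>)"
  have supp: "{t. g t \<noteq> \<zero>} = {s. f s \<noteq> \<zero>} - {s}" by (auto simp: g_def)
  have gc: "g \<in> carrier (free_module R S)"
    using Suc(3) fin supp unfolding free_module_sel(1) by (auto simp: g_def)
  have "card {t. g t \<noteq> \<zero>} = n" unfolding supp using Suc(2) s fin by simp
  hence "P g" using Suc(1) gc by auto
  moreover have "f = g \<oplus>\<^bsub>free_module R S\<^esub> f s \<odot>\<^bsub>free_module R S\<^esub> free_gen R s"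
    using free_module_closed[OF Suc(3)]
    by (auto simp: free_module_sel(2-4) g_def free_gen_def fun_eq_iff)
  ultimately show ?case
    using step[OF free_module_closed[OF Suc(3)] sS gc] by metis
qed

text \<open>The defining sum runs over the support, which changes with the function; a common finite
  index set makes the sums for different functions comparable.\<close>

lemma free_lift_superset:
  assumes "module R P" "\<And>s. s \<in> S \<Longrightarrow> b s \<in> carrier P" "f \<in> carrier (free_module R S)"
    and "finite A" "{s. f s \<noteq> \<zero>} \<subseteq> A" "A \<subseteq> S"
  shows "free_lift R P b f = (\<Oplus>\<^bsub>P\<^esub>s\<in>A. f s \<odot>\<^bsub>P\<^esub> b s)"
proof -
  interpret P: module R P by fact
  have "b s \<in> carrier P" if "s \<in> A" for s using that assms by auto
  thus ?thesis unfolding free_lift_def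
    using assms free_module_closed[OF assms(3)]
    by (intro P.add.finprod_mono_neutral_cong_left) (auto)
qed

lemma free_lift_hom:
  assumes "module R P" "\<And>s. s \<in> S \<Longrightarrow> b s \<in> carrier P"
  shows "free_lift R P b \<in> module_hom R (free_module R S) P"
proof -
  interpret P: module R P by fact
  interpret F: module R "free_module R S" by (rule free_module_module)
  show ?thesis
  proof (intro module_homI)
    fix f assume f: "f \<in> carrier (free_module R S)"
    show "free_lift R P b f \<in> carrier P" unfolding free_lift_def
      using f assms free_module_closed[OF f] free_module_supp[OF f]
      by (intro P.finsum_closed) auto
  next
    fix f g assume f: "f \<in> carrier (free_module R S)" and g: "g \<in> carrier (free_module R S)"
    define A where "A = {s. f s \<noteq> \<zero>} \<union> {s. g s \<noteq> \<zero>}"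
    have A: "finite A" "A \<subseteq> S" using free_module_supp[OF f] free_module_supp[OF g] by (auto simp: A_def)
    have fg: "f \<oplus>\<^bsub>free_module R S\<^esub> g \<in> carrier (free_module R S)" using f g by simp
    have b: "s \<in> A \<Longrightarrow> b s \<in> carrier P" for s using A assms by auto
    have "{s. (f \<oplus>\<^bsub>free_module R S\<^esub> g) s \<noteq> \<zero>} \<subseteq> A"
      by (auto simp: A_def free_module_sel(2-4))
    hence "free_lift R P b (f \<oplus>\<^bsub>free_module R S\<^esub> g) = (\<Oplus>\<^bsub>P\<^esub>s\<in>A. (f s \<oplus> g s) \<odot>\<^bsub>P\<^esub> b s)"
      using free_lift_superset[where P=P and b=b, OF assms fg A(1) _ A(2)] by (simp add: free_module_sel(3))
    also have "\<dots> = (\<Oplus>\<^bsub>P\<^esub>s\<in>A. f s \<odot>\<^bsub>P\<^esub> b s \<oplus>\<^bsub>P\<^esub> g s \<odot>\<^bsub>P\<^esub> b s)"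
      using b free_module_closed[OF f] free_module_closed[OF g]
      by (intro P.finsum_cong') (auto simp: P.smult_l_distr)
    also have "\<dots> = (\<Oplus>\<^bsub>P\<^esub>s\<in>A. f s \<odot>\<^bsub>P\<^esub> b s) \<oplus>\<^bsub>P\<^esub> (\<Oplus>\<^bsub>P\<^esub>s\<in>A. g s \<odot>\<^bsub>P\<^esub> b s)"
      using b free_module_closed[OF f] free_module_closed[OF g]
      by (intro P.finsum_addf) auto
    also have "\<dots> = free_lift R P b f \<oplus>\<^bsub>P\<^esub> free_lift R P b g"
      using free_lift_superset[where P=P and b=b, OF assms f A(1) _ A(2)]
        free_lift_superset[where P=P and b=b, OF assms g A(1) _ A(2)]
      by (simp add: A_def)
    finally show "free_lift R P b (f \<oplus>\<^bsub>free_module R S\<^esub> g) = free_lift R P b f \<oplus>\<^bsub>P\<^esub> free_lift R P b g" .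
  next
    fix a f assume a: "a \<in> carrier R" and f: "f \<in> carrier (free_module R S)"
    define A where "A = {s. f s \<noteq> \<zero>}"
    have A: "finite A" "A \<subseteq> S" using free_module_supp[OF f] by (auto simp: A_def)
    have af: "a \<odot>\<^bsub>free_module R S\<^esub> f \<in> carrier (free_module R S)" using a f by simp
    have b: "s \<in> A \<Longrightarrow> b s \<in> carrier P" for s using A assms by auto
    have "{s. (a \<odot>\<^bsub>free_module R S\<^esub> f) s \<noteq> \<zero>} \<subseteq> A"
      using a by (auto simp: A_def free_module_sel(2-4))
    hence "free_lift R P b (a \<odot>\<^bsub>free_module R S\<^esub> f) = (\<Oplus>\<^bsub>P\<^esub>s\<in>A. (a \<otimes> f s) \<odot>\<^bsub>P\<^esub> b s)"
      using free_lift_superset[where P=P and b=b, OF assms af A(1) _ A(2)] by (simp add: free_module_sel(4))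
    also have "\<dots> = (\<Oplus>\<^bsub>P\<^esub>s\<in>A. a \<odot>\<^bsub>P\<^esub> (f s \<odot>\<^bsub>P\<^esub> b s))"
      using b a free_module_closed[OF f]
      by (intro P.finsum_cong') (auto simp: P.smult_assoc1)
    also have "\<dots> = a \<odot>\<^bsub>P\<^esub> (\<Oplus>\<^bsub>P\<^esub>s\<in>A. f s \<odot>\<^bsub>P\<^esub> b s)"
      using b a free_module_closed[OF f] A
      by (intro P.finsum_smult_ldistr[symmetric]) auto
    also have "\<dots> = a \<odot>\<^bsub>P\<^esub> free_lift R P b f"
      using free_lift_superset[where P=P and b=b, OF assms f A(1) _ A(2)] by (simp add: A_def)
    finally show "free_lift R P b (a \<odot>\<^bsub>free_module R S\<^esub> f) = a \<odot>\<^bsub>P\<^esub> free_lift R P b f" .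
  qed
qed

lemma free_lift_gen:
  assumes "module R P" "b s \<in> carrier P"
  shows "free_lift R P b (free_gen R s) = b s"
proof -
  interpret P: module R P by fact
  have "free_lift R P b (free_gen R s) = (\<Oplus>\<^bsub>P\<^esub>t\<in>{s}. free_gen R s t \<odot>\<^bsub>P\<^esub> b t)"
    using assms(2) by (intro free_lift_superset[where S="{s}"] assms free_gen_closed)
      (auto simp: free_gen_def)
  thus ?thesis using assms(2) by (simp add: free_gen_def)
qed

lemma free_module_hom_eqI:
  assumes "module R P" "h \<in> module_hom R (free_module R S) P" "h' \<in> module_hom R (free_module R S) P"
    and "\<And>s. s \<in> S \<Longrightarrow> h (free_gen R s) = h' (free_gen R s)"
    and "f \<in> carrier (free_module R S)"
  shows "h f = h' f"
proof -
  interpret P: module R P by fact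
  interpret F: module R "free_module R S" by (rule free_module_module)
  show ?thesis using assms(5)
  proof (induction rule: free_module_induct)
    case zero
    then show ?case
      using module_hom_zero[OF F.module_axioms assms(1,2)] module_hom_zero[OF F.module_axioms assms(1,3)]
      by (simp add: free_module_sel)
  next
    case (add a s f)
    have e: "free_gen R s \<in> carrier (free_module R S)" using add by (simp add: free_gen_closed)
    have "a \<odot>\<^bsub>free_module R S\<^esub> free_gen R s \<in> carrier (free_module R S)"
      using add e by (intro F.smult_closed)
    then show ?case
      using add e assms(4)[OF add(2)] module_homD(2,3)[OF assms(2)] module_homD(2,3)[OF assms(3)]
      by simp
  qed
qed

end

lemma module_hom_add:
  assumes "module R N" "f \<in> module_hom R M N" "g \<in> module_hom R M N"
  shows "(\<lambda>x. f x \<oplus>\<^bsub>N\<^esub> g x) \<in> module_hom R M N"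
proof -
  interpret N: module R N by fact
  note f = module_homD[OF assms(2)] and g = module_homD[OF assms(3)]
  show ?thesis
    by (intro module_homI; simp only: f g N.M.a_closed N.smult_closed N.smult_r_distr N.M.a_ac)
qed

lemma module_hom_smult:
  assumes "module R N" "f \<in> module_hom R M N" "c \<in> carrier R"
  shows "(\<lambda>x. c \<odot>\<^bsub>N\<^esub> f x) \<in> module_hom R M N"
proof -
  interpret N: module R N by fact
  note f = module_homD[OF assms(2)]
  show ?thesis
  proof (intro module_homI)
    fix a x assume a: "a \<in> carrier R" and x: "x \<in> carrier M"
    have "c \<odot>\<^bsub>N\<^esub> f (a \<odot>\<^bsub>M\<^esub> x) = (c \<otimes>\<^bsub>R\<^esub> a) \<odot>\<^bsub>N\<^esub> f x"
      using a x assms(3) f(1)[OF x] by (simp add: f(3) N.smult_assoc1)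
    also have "\<dots> = a \<odot>\<^bsub>N\<^esub> (c \<odot>\<^bsub>N\<^esub> f x)"
      using a x assms(3) f(1)[OF x] by (simp add: N.R.m_comm N.smult_assoc1)
    finally show "c \<odot>\<^bsub>N\<^esub> f (a \<odot>\<^bsub>M\<^esub> x) = a \<odot>\<^bsub>N\<^esub> (c \<odot>\<^bsub>N\<^esub> f x)" .
  qed (simp_all add: f assms(3) N.smult_r_distr)
qed

subsection \<open>Quotient modules\<close>

lemma (in module) submodule_abelian_subgroup:
  "submodule W R M \<Longrightarrow> abelian_subgroup W M"
  by (intro abelian_subgroupI3 additive_subgroupI M.abelian_group_axioms)
    (rule submodule.axioms(1))

lemma (in module) quotient_coset_eqI:
  assumes "submodule W R M" "x \<in> carrier M" "y \<in> carrier M" "x \<ominus>\<^bsub>M\<^esub> y \<in> W"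
  shows "W +>\<^bsub>M\<^esub> x = W +>\<^bsub>M\<^esub> y"
proof -
  interpret W: abelian_subgroup W M by (rule submodule_abelian_subgroup) fact
  have "x = (x \<ominus>\<^bsub>M\<^esub> y) \<oplus>\<^bsub>M\<^esub> y"
    using assms by (simp add: a_minus_def M.a_assoc M.l_neg)
  hence "x \<in> W +>\<^bsub>M\<^esub> y" using assms(4) unfolding a_r_coset_def' by auto
  thus ?thesis
    using W.a_repr_independence'[of x y] assms by simp
qed

lemma (in module) quotient_smult:
  assumes "submodule W R M" "a \<in> carrier R" "x \<in> carrier M"
  shows "(\<Union>z\<in>W +>\<^bsub>M\<^esub> x. W +>\<^bsub>M\<^esub> (a \<odot>\<^bsub>M\<^esub> z)) = W +>\<^bsub>M\<^esub> (a \<odot>\<^bsub>M\<^esub> x)"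
proof -
  interpret W: abelian_subgroup W M by (rule submodule_abelian_subgroup) fact
  have "W +>\<^bsub>M\<^esub> (a \<odot>\<^bsub>M\<^esub> z) = W +>\<^bsub>M\<^esub> (a \<odot>\<^bsub>M\<^esub> x)" if z: "z \<in> W +>\<^bsub>M\<^esub> x" for z
  proof -
    obtain w where w: "w \<in> W" "z = w \<oplus>\<^bsub>M\<^esub> x" using z unfolding a_r_coset_def' by auto
    have wc: "w \<in> carrier M" using w(1) by simp
    have c: "a \<odot>\<^bsub>M\<^esub> z \<in> carrier M" "a \<odot>\<^bsub>M\<^esub> x \<in> carrier M" "a \<odot>\<^bsub>M\<^esub> w \<in> carrier M"
      using wc w(2) assms(2,3) by simp_all
    have "a \<odot>\<^bsub>M\<^esub> z = a \<odot>\<^bsub>M\<^esub> w \<oplus>\<^bsub>M\<^esub> a \<odot>\<^bsub>M\<^esub> x"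
      using wc assms(2,3) by (simp add: w(2) smult_r_distr)
    hence "(a \<odot>\<^bsub>M\<^esub> z) \<ominus>\<^bsub>M\<^esub> (a \<odot>\<^bsub>M\<^esub> x) = a \<odot>\<^bsub>M\<^esub> w"
      using c by (simp add: a_minus_def M.a_assoc M.r_neg)
    moreover have "a \<odot>\<^bsub>M\<^esub> w \<in> W" by (rule submodule.smult_closed[OF assms(1,2) w(1)])
    ultimately have "(a \<odot>\<^bsub>M\<^esub> z) \<ominus>\<^bsub>M\<^esub> (a \<odot>\<^bsub>M\<^esub> x) \<in> W" by simp
    thus ?thesis by (rule quotient_coset_eqI[OF assms(1) c(1,2)])
  qed
  moreover have "x \<in> W +>\<^bsub>M\<^esub> x" using W.a_rcos_self[OF assms(3)] .
  ultimately show ?thesis by blast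
qed

lemma (in module) quotient_ops:
  assumes "submodule W R M"
  shows "x \<in> carrier M \<Longrightarrow> W +>\<^bsub>M\<^esub> x \<in> carrier (quotient_module M W)"
    and "x \<in> carrier M \<Longrightarrow> y \<in> carrier M \<Longrightarrow>
      (W +>\<^bsub>M\<^esub> x) \<oplus>\<^bsub>quotient_module M W\<^esub> (W +>\<^bsub>M\<^esub> y) = W +>\<^bsub>M\<^esub> (x \<oplus>\<^bsub>M\<^esub> y)"
    and "a \<in> carrier R \<Longrightarrow> x \<in> carrier M \<Longrightarrow>
      a \<odot>\<^bsub>quotient_module M W\<^esub> (W +>\<^bsub>M\<^esub> x) = W +>\<^bsub>M\<^esub> (a \<odot>\<^bsub>M\<^esub> x)"
    and "\<zero>\<^bsub>quotient_module M W\<^esub> = W +>\<^bsub>M\<^esub> \<zero>\<^bsub>M\<^esub>"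
    and "(\<lambda>x. W +>\<^bsub>M\<^esub> x) ` carrier M = carrier (quotient_module M W)"
proof -
  interpret W: abelian_subgroup W M by (rule submodule_abelian_subgroup) fact
  show "x \<in> carrier M \<Longrightarrow> W +>\<^bsub>M\<^esub> x \<in> carrier (quotient_module M W)"
    by (auto simp: quotient_module_def A_RCOSETS_def')
  show "x \<in> carrier M \<Longrightarrow> y \<in> carrier M \<Longrightarrow>
      (W +>\<^bsub>M\<^esub> x) \<oplus>\<^bsub>quotient_module M W\<^esub> (W +>\<^bsub>M\<^esub> y) = W +>\<^bsub>M\<^esub> (x \<oplus>\<^bsub>M\<^esub> y)"
    by (simp add: quotient_module_def W.a_rcos_sum)
  show "a \<in> carrier R \<Longrightarrow> x \<in> carrier M \<Longrightarrow>
      a \<odot>\<^bsub>quotient_module M W\<^esub> (W +>\<^bsub>M\<^esub> x) = W +>\<^bsub>M\<^esub> (a \<odot>\<^bsub>M\<^esub> x)"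
    using quotient_smult[OF assms] by (simp add: quotient_module_def)
  show "\<zero>\<^bsub>quotient_module M W\<^esub> = W +>\<^bsub>M\<^esub> \<zero>\<^bsub>M\<^esub>"
    using W.a_subset by (simp add: quotient_module_def)
  show "(\<lambda>x. W +>\<^bsub>M\<^esub> x) ` carrier M = carrier (quotient_module M W)"
    by (auto simp: quotient_module_def A_RCOSETS_def')
qed

lemma (in module) quotient_module_module:
  assumes "submodule W R M"
  shows "module R (quotient_module M W)"
  by (rule module_surj_image[OF module_axioms quotient_ops(5)[OF assms]])
    (simp_all only: quotient_ops(2-4)[OF assms])

subsection \<open>Tensor products\<close>

text \<open>Linearity in each variable is phrased through \<open>module_hom\<close>, so that
  closedness and composition of linear maps apply to either variable.\<close>

definition bilinear ::
    "('r, 'a) ring_scheme \<Rightarrow> ('r, 'm, 'b) module_scheme \<Rightarrow> ('r, 'n, 'c) module_scheme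
      \<Rightarrow> ('r, 'p, 'd) module_scheme \<Rightarrow> ('m \<Rightarrow> 'n \<Rightarrow> 'p) \<Rightarrow> bool"
  where "bilinear R M N P b \<longleftrightarrow>
    (\<forall>x\<in>carrier M. b x \<in> module_hom R N P) \<and> (\<forall>y\<in>carrier N. (\<lambda>x. b x y) \<in> module_hom R M P)"

lemma bilinearI:
  assumes "\<And>x. x \<in> carrier M \<Longrightarrow> b x \<in> module_hom R N P"
    and "\<And>y. y \<in> carrier N \<Longrightarrow> (\<lambda>x. b x y) \<in> module_hom R M P"
  shows "bilinear R M N P b"
  using assms by (auto simp: bilinear_def)

lemma bilinearD:
  assumes "bilinear R M N P b" 
  shows "x \<in> carrier M \<Longrightarrow> b x \<in> module_hom R N P"
    and "y \<in> carrier N \<Longrightarrow> (\<lambda>x. b x y) \<in> module_hom R M P"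
  using assms by (auto simp: bilinear_def)

locale module_pair = M: module R M + N: module R N
  for R :: "('r, 'a) ring_scheme" (structure)
    and M :: "('r, 'm, 'b) module_scheme" and N :: "('r, 'n, 'c) module_scheme"
begin

abbreviation "FMN \<equiv> free_module R (carrier M \<times> carrier N)"
abbreviation "WMN \<equiv> bilinear_submodule R M N"
abbreviation "TMN \<equiv> tensor_product R M N"
abbreviation "gen x y \<equiv> free_gen R (x, y)"

sublocale F: module R FMN
  by (rule M.R.free_module_module)

lemma gen_closed [simp]: "x \<in> carrier M \<Longrightarrow> y \<in> carrier N \<Longrightarrow> gen x y \<in> carrier FMN"
  by (rule M.R.free_gen_closed) auto

lemma bilinear_relators_closed: "bilinear_relators R M N \<subseteq> carrier FMN"
  unfolding bilinear_relators_def Let_def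
  by (intro Un_least subsetI; elim CollectE exE conjE; simp)

lemma bilinear_submodule_submodule: "submodule WMN R FMN"
proof (intro F.submoduleI)
  \<comment> \<open>The intersection is over a nonempty family, since the whole free module is a
    submodule containing the relators.\<close>
  show "WMN \<subseteq> carrier FMN"
    using F.carrier_is_submodule bilinear_relators_closed unfolding bilinear_submodule_def by blast
  have "\<zero>\<^bsub>FMN\<^esub> \<in> W" if "submodule W R FMN" for W
    using subgroup.one_closed[OF submodule.axioms(1)[OF that]] by simp
  thus "\<zero>\<^bsub>FMN\<^esub> \<in> WMN" unfolding bilinear_submodule_def by blast
  show "\<ominus>\<^bsub>FMN\<^esub> f \<in> WMN" if "f \<in> WMN" for f
    using that F.submoduleE(3) unfolding bilinear_submodule_def by blast
  show "f \<oplus>\<^bsub>FMN\<^esub> g \<in> WMN" if "f \<in> WMN" "g \<in> WMN" for f g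
    using that F.submoduleE(5) unfolding bilinear_submodule_def by blast
  show "a \<odot>\<^bsub>FMN\<^esub> f \<in> WMN" if "a \<in> carrier R" "f \<in> WMN" for a f
    using that F.submoduleE(4) unfolding bilinear_submodule_def by blast
qed

lemma bilinear_relators_subset: "bilinear_relators R M N \<subseteq> WMN"
  unfolding bilinear_submodule_def by auto

lemma bilinear_submodule_least:
  "submodule W R FMN \<Longrightarrow> bilinear_relators R M N \<subseteq> W \<Longrightarrow> WMN \<subseteq> W"
  unfolding bilinear_submodule_def by auto

lemmas T_ops = F.quotient_ops[OF bilinear_submodule_submodule, folded tensor_product_def]

sublocale T: module R TMN
  unfolding tensor_product_def
  by (rule F.quotient_module_module) (rule bilinear_submodule_submodule)

lemma pure_tensor_closed [simp]:
  "x \<in> carrier M \<Longrightarrow> y \<in> carrier N \<Longrightarrow> pure_tensor R M N x y \<in> carrier TMN"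
  unfolding pure_tensor_def by (rule T_ops) simp

lemma pure_tensor_bilinear: "bilinear R M N TMN (pure_tensor R M N)"
proof (intro bilinearI module_homI)
  note [simp] = pure_tensor_def T_ops
  have eqI: "WMN +>\<^bsub>FMN\<^esub> f = WMN +>\<^bsub>FMN\<^esub> g"
    if "f \<ominus>\<^bsub>FMN\<^esub> g \<in> bilinear_relators R M N" "f \<in> carrier FMN" "g \<in> carrier FMN" for f g
    using that bilinear_relators_subset
    by (intro F.quotient_coset_eqI[OF bilinear_submodule_submodule]) blast+
  fix x x' y y' a
  assume x: "x \<in> carrier M" and y: "y \<in> carrier N"
  show "pure_tensor R M N x y \<in> carrier TMN" using x y by simp
  show "pure_tensor R M N x y \<in> carrier TMN" using x y by simp
  show "pure_tensor R M N (x \<oplus>\<^bsub>M\<^esub> x') y = pure_tensor R M N x y \<oplus>\<^bsub>TMN\<^esub> pure_tensor R M N x' y"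
    if x': "x' \<in> carrier M"
  proof -
    have "gen (x \<oplus>\<^bsub>M\<^esub> x') y \<ominus>\<^bsub>FMN\<^esub> (gen x y \<oplus>\<^bsub>FMN\<^esub> gen x' y) \<in> bilinear_relators R M N"
      using x x' y unfolding bilinear_relators_def Let_def by blast
    thus ?thesis using x x' y eqI by simp
  qed
  show "pure_tensor R M N x (y \<oplus>\<^bsub>N\<^esub> y') = pure_tensor R M N x y \<oplus>\<^bsub>TMN\<^esub> pure_tensor R M N x y'"
    if y': "y' \<in> carrier N"
  proof -
    have "gen x (y \<oplus>\<^bsub>N\<^esub> y') \<ominus>\<^bsub>FMN\<^esub> (gen x y \<oplus>\<^bsub>FMN\<^esub> gen x y') \<in> bilinear_relators R M N"
      using x y y' unfolding bilinear_relators_def Let_def by blast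
    thus ?thesis using x y y' eqI by simp
  qed
  assume a: "a \<in> carrier R"
  show "pure_tensor R M N (a \<odot>\<^bsub>M\<^esub> x) y = a \<odot>\<^bsub>TMN\<^esub> pure_tensor R M N x y"
  proof -
    have "gen (a \<odot>\<^bsub>M\<^esub> x) y \<ominus>\<^bsub>FMN\<^esub> (a \<odot>\<^bsub>FMN\<^esub> gen x y) \<in> bilinear_relators R M N"
      using x y a unfolding bilinear_relators_def Let_def by blast
    thus ?thesis using x y a eqI by simp
  qed
  show "pure_tensor R M N x (a \<odot>\<^bsub>N\<^esub> y) = a \<odot>\<^bsub>TMN\<^esub> pure_tensor R M N x y"
  proof -
    have "gen x (a \<odot>\<^bsub>N\<^esub> y) \<ominus>\<^bsub>FMN\<^esub> (a \<odot>\<^bsub>FMN\<^esub> gen x y) \<in> bilinear_relators R M N"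
      using x y a unfolding bilinear_relators_def Let_def by blast
    thus ?thesis using x y a eqI by simp
  qed
qed

lemma coset_hom: "(\<lambda>f. WMN +>\<^bsub>FMN\<^esub> f) \<in> module_hom R FMN TMN"
  by (intro module_homI) (simp_all add: T_ops)

text \<open>Linear maps out of the tensor product pull back along the coset map to the free module,
  where they are determined by the generators; the cosets of these are the pure tensors.\<close>

lemma tensor_hom_eqI:
  assumes "module R P" "h \<in> module_hom R TMN P" "h' \<in> module_hom R TMN P"
    and "\<And>x y. x \<in> carrier M \<Longrightarrow> y \<in> carrier N \<Longrightarrow> h (pure_tensor R M N x y) = h' (pure_tensor R M N x y)"
    and "t \<in> carrier TMN"
  shows "h t = h' t"
proof -
  obtain f where f: "f \<in> carrier FMN" "t = WMN +>\<^bsub>FMN\<^esub> f" using assms(5) unfolding T_ops(5)[symmetric] by blast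
  have "h (WMN +>\<^bsub>FMN\<^esub> f) = h' (WMN +>\<^bsub>FMN\<^esub> f)"
  proof (rule M.R.free_module_hom_eqI[OF assms(1) module_hom_comp[OF coset_hom assms(2)]
          module_hom_comp[OF coset_hom assms(3)] _ f(1)])
    fix s assume "s \<in> carrier M \<times> carrier N"
    thus "h (WMN +>\<^bsub>FMN\<^esub> free_gen R s) = h' (WMN +>\<^bsub>FMN\<^esub> free_gen R s)"
      using assms(4)[of "fst s" "snd s"] unfolding pure_tensor_def by auto
  qed
  thus ?thesis using f by simp
qed

context
  fixes P :: "('r, 'p, 'd) module_scheme" and b
  assumes P: "module R P" and b: "bilinear R M N P b"
begin

interpretation P: module R P by (rule P)

lemma bilinear_closed: "x \<in> carrier M \<Longrightarrow> y \<in> carrier N \<Longrightarrow> b x y \<in> carrier P"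
  by (rule module_homD(1)[OF bilinearD(1)[OF b]])

lemma free_lift_bilinear_hom: "free_lift R P (case_prod b) \<in> module_hom R FMN P"
  by (rule M.R.free_lift_hom[OF P]) (auto intro: bilinear_closed)

lemma free_lift_bilinear_gen:
  "x \<in> carrier M \<Longrightarrow> y \<in> carrier N \<Longrightarrow> free_lift R P (case_prod b) (gen x y) = b x y"
  using M.R.free_lift_gen[OF P, of "case_prod b" "(x, y)"] bilinear_closed by simp

lemma hom_minus:
  assumes "h \<in> module_hom R FMN P" "f \<in> carrier FMN" "g \<in> carrier FMN"
  shows "h (f \<ominus>\<^bsub>FMN\<^esub> g) = h f \<ominus>\<^bsub>P\<^esub> h g"
proof -
  have "h (f \<ominus>\<^bsub>FMN\<^esub> g) \<oplus>\<^bsub>P\<^esub> h g = h ((f \<ominus>\<^bsub>FMN\<^esub> g) \<oplus>\<^bsub>FMN\<^esub> g)"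
    using assms by (simp add: module_homD(2)[OF assms(1)])
  also have "(f \<ominus>\<^bsub>FMN\<^esub> g) \<oplus>\<^bsub>FMN\<^esub> g = f"
    using assms by (simp add: a_minus_def F.M.a_assoc F.M.l_neg)
  finally have *: "h (f \<ominus>\<^bsub>FMN\<^esub> g) \<oplus>\<^bsub>P\<^esub> h g = h f" .
  have c: "h (f \<ominus>\<^bsub>FMN\<^esub> g) \<in> carrier P" "h f \<in> carrier P" "h g \<in> carrier P"
    using assms module_homD(1)[OF assms(1)] by auto
  show ?thesis unfolding *[symmetric] using c by (simp add: a_minus_def P.M.a_assoc P.M.r_neg)
qed

text \<open>The kernel of the linear extension of \<open>b\<close> is a submodule, and by
  bilinearity of \<open>b\<close> it contains the relators; hence it contains the submodule they
  generate.\<close>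

lemma free_lift_vanishes:
  assumes "w \<in> WMN"
  shows "free_lift R P (case_prod b) w = \<zero>\<^bsub>P\<^esub>"
proof -
  let ?h = "free_lift R P (case_prod b)"
  note h = free_lift_bilinear_hom
  let ?K = "{f \<in> carrier FMN. ?h f = \<zero>\<^bsub>P\<^esub>}"
  have self: "u \<ominus>\<^bsub>P\<^esub> u = \<zero>\<^bsub>P\<^esub>" if "u \<in> carrier P" for u
    using that by (simp add: a_minus_def P.M.r_neg)
  have z: "?h \<zero>\<^bsub>FMN\<^esub> = \<zero>\<^bsub>P\<^esub>" by (rule module_hom_zero[OF F.module_axioms P h])
  have "submodule ?K R FMN"
  proof (intro F.submoduleI)
    fix f assume "f \<in> ?K"
    moreover have "\<ominus>\<^bsub>FMN\<^esub> f = \<zero>\<^bsub>FMN\<^esub> \<ominus>\<^bsub>FMN\<^esub> f" if "f \<in> carrier FMN"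
      using that by (simp add: a_minus_def)
    ultimately show "\<ominus>\<^bsub>FMN\<^esub> f \<in> ?K"
      using hom_minus[OF h, of "\<zero>\<^bsub>FMN\<^esub>" f] z by (auto simp: a_minus_def)
  qed (auto simp: z module_homD[OF h])
  moreover have "bilinear_relators R M N \<subseteq> ?K"
  proof
    fix f assume f: "f \<in> bilinear_relators R M N"
    have "?h f = \<zero>\<^bsub>P\<^esub>"
      using f unfolding bilinear_relators_def Let_def
      by (auto simp: hom_minus[OF h] module_homD(2,3)[OF h] free_lift_bilinear_gen bilinear_closed
          module_homD(2,3)[OF bilinearD(1)[OF b]] module_homD(2,3)[OF bilinearD(2)[OF b]] self)
    thus "f \<in> ?K" using f bilinear_relators_closed by auto
  qed
  ultimately have "WMN \<subseteq> ?K" by (rule bilinear_submodule_least)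
  thus ?thesis using assms by auto
qed

lemma tensor_lift_coset:
  assumes f: "f \<in> carrier FMN"
  shows "tensor_lift R P b (WMN +>\<^bsub>FMN\<^esub> f) = free_lift R P (case_prod b) f"
proof -
  let ?h = "free_lift R P (case_prod b)"
  note h = free_lift_bilinear_hom
  interpret W: abelian_subgroup WMN FMN
    by (rule F.submodule_abelian_subgroup[OF bilinear_submodule_submodule])
  have hc: "?h f \<in> carrier P" by (rule module_homD(1)[OF h f])
  have "?h z = ?h f" if z: "z \<in> WMN +>\<^bsub>FMN\<^esub> f" for z
  proof -
    obtain w where w: "w \<in> WMN" "z = w \<oplus>\<^bsub>FMN\<^esub> f" using z unfolding a_r_coset_def' by blast
    have "w \<in> carrier FMN" using w(1) by simp
    thus ?thesis using w f hc by (simp add: module_homD(2)[OF h] free_lift_vanishes)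
  qed
  hence "?h ` (WMN +>\<^bsub>FMN\<^esub> f) \<subseteq> {?h f}" by blast
  moreover have "?h f \<in> ?h ` (WMN +>\<^bsub>FMN\<^esub> f)" by (rule imageI[OF W.a_rcos_self[OF f]])
  ultimately have "?h ` (WMN +>\<^bsub>FMN\<^esub> f) = {?h f}" by blast
  thus ?thesis unfolding tensor_lift_def by simp
qed

lemma tensor_lift_pure:
  "x \<in> carrier M \<Longrightarrow> y \<in> carrier N \<Longrightarrow> tensor_lift R P b (pure_tensor R M N x y) = b x y"
  unfolding pure_tensor_def by (simp add: tensor_lift_coset free_lift_bilinear_gen)

lemma tensor_lift_hom: "tensor_lift R P b \<in> module_hom R TMN P"
proof (intro module_homI)
  note h = free_lift_bilinear_hom
  have ex: "\<exists>f. f \<in> carrier FMN \<and> t = WMN +>\<^bsub>FMN\<^esub> f" if "t \<in> carrier TMN" for t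
    using that unfolding T_ops(5)[symmetric] by blast
  fix t assume t: "t \<in> carrier TMN"
  then obtain f where f: "f \<in> carrier FMN" "t = WMN +>\<^bsub>FMN\<^esub> f" using ex by auto
  show "tensor_lift R P b t \<in> carrier P"
    using f module_homD(1)[OF h] by (simp add: tensor_lift_coset)
  show "tensor_lift R P b (a \<odot>\<^bsub>TMN\<^esub> t) = a \<odot>\<^bsub>P\<^esub> tensor_lift R P b t" if "a \<in> carrier R" for a
    using that f module_homD(3)[OF h] by (simp add: tensor_lift_coset T_ops)
  fix u assume u: "u \<in> carrier TMN"
  then obtain g where g: "g \<in> carrier FMN" "u = WMN +>\<^bsub>FMN\<^esub> g" using ex by auto
  show "tensor_lift R P b (t \<oplus>\<^bsub>TMN\<^esub> u) = tensor_lift R P b t \<oplus>\<^bsub>P\<^esub> tensor_lift R P b u"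
    using f g module_homD(2)[OF h] by (simp add: tensor_lift_coset T_ops)
qed

end

end

lemma tensor_map_hom_pure:
  assumes M: "module R M" and N: "module R N" and M': "module R M'" and N': "module R N'"
    and f: "f \<in> module_hom R M M'" and g: "g \<in> module_hom R N N'"
  shows "tensor_map R M' N' f g \<in> module_hom R (tensor_product R M N) (tensor_product R M' N')"
    and "x \<in> carrier M \<Longrightarrow> y \<in> carrier N \<Longrightarrow>
      tensor_map R M' N' f g (pure_tensor R M N x y) = pure_tensor R M' N' (f x) (g y)"
proof -
  interpret A: module_pair R M N using M N by (simp add: module_pair_def)
  interpret B: module_pair R M' N' using M' N' by (simp add: module_pair_def)
  have "bilinear R M N (tensor_product R M' N') (\<lambda>x y. pure_tensor R M' N' (f x) (g y))"
  proof (intro bilinearI)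
    show "(\<lambda>y. pure_tensor R M' N' (f x) (g y)) \<in> module_hom R N (tensor_product R M' N')"
      if "x \<in> carrier M" for x
      by (rule module_hom_comp[OF g bilinearD(1)[OF B.pure_tensor_bilinear module_homD(1)[OF f that]]])
    show "(\<lambda>x. pure_tensor R M' N' (f x) (g y)) \<in> module_hom R M (tensor_product R M' N')"
      if "y \<in> carrier N" for y
      by (rule module_hom_comp[OF f bilinearD(2)[OF B.pure_tensor_bilinear module_homD(1)[OF g that]]])
  qed
  note * = B.T.module_axioms this
  show "tensor_map R M' N' f g \<in> module_hom R (tensor_product R M N) (tensor_product R M' N')"
    unfolding tensor_map_def by (rule A.tensor_lift_hom[OF *])
  show "x \<in> carrier M \<Longrightarrow> y \<in> carrier N \<Longrightarrow>
      tensor_map R M' N' f g (pure_tensor R M N x y) = pure_tensor R M' N' (f x) (g y)"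
    unfolding tensor_map_def by (rule A.tensor_lift_pure[OF *])
qed

lemma tensor_assoc_hom_pure:
  assumes L: "module R L" and M: "module R M" and N: "module R N"
  shows "tensor_assoc R L M N \<in> module_hom R (tensor_product R (tensor_product R L M) N)
      (tensor_product R L (tensor_product R M N))"
    and "x \<in> carrier L \<Longrightarrow> y \<in> carrier M \<Longrightarrow> z \<in> carrier N \<Longrightarrow>
      tensor_assoc R L M N (pure_tensor R (tensor_product R L M) N (pure_tensor R L M x y) z) =
      pure_tensor R L (tensor_product R M N) x (pure_tensor R M N y z)"
proof -
  interpret LM: module_pair R L M using L M by (simp add: module_pair_def)
  interpret MN: module_pair R M N using N M by (simp add: module_pair_def)
  interpret LMN: module_pair R L "tensor_product R M N"
    using L MN.T.module_axioms by (simp add: module_pair_def)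
  interpret LMN': module_pair R "tensor_product R L M" N
    using N LM.T.module_axioms by (simp add: module_pair_def)
  define T where "T = tensor_product R L (tensor_product R M N)"
  have T: "module R T" unfolding T_def by (rule LMN.T.module_axioms)
  define b where "b = (\<lambda>z x y. pure_tensor R L (tensor_product R M N) x (pure_tensor R M N y z))"
  have b: "bilinear R L M T (b z)" if z: "z \<in> carrier N" for z
    unfolding b_def T_def
  proof (intro bilinearI)
    show "(\<lambda>y. pure_tensor R L (tensor_product R M N) x (pure_tensor R M N y z))
        \<in> module_hom R M (tensor_product R L (tensor_product R M N))" if "x \<in> carrier L" for x
      by (rule module_hom_comp[OF bilinearD(2)[OF MN.pure_tensor_bilinear z]
            bilinearD(1)[OF LMN.pure_tensor_bilinear that]])
    show "(\<lambda>x. pure_tensor R L (tensor_product R M N) x (pure_tensor R M N y z))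
        \<in> module_hom R L (tensor_product R L (tensor_product R M N))" if "y \<in> carrier M" for y
      by (rule bilinearD(2)[OF LMN.pure_tensor_bilinear MN.pure_tensor_closed[OF that z]])
  qed
  define c where "c = (\<lambda>t z. tensor_lift R T (b z) t)"
  have c1: "(\<lambda>t. c t z) \<in> module_hom R (tensor_product R L M) T" if z: "z \<in> carrier N" for z
    unfolding c_def by (rule LM.tensor_lift_hom[OF T b[OF z]])
  have c1p: "c (pure_tensor R L M x y) z = b z x y"
    if "z \<in> carrier N" "x \<in> carrier L" "y \<in> carrier M" for x y z
    unfolding c_def by (rule LM.tensor_lift_pure[OF T b[OF that(1)] that(2,3)])
  interpret TT: module R T by (rule T)
  have bz: "(\<lambda>z. b z x y) \<in> module_hom R N T" if "x \<in> carrier L" "y \<in> carrier M" for x y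
  proof -
    have "(\<lambda>z. pure_tensor R L (tensor_product R M N) x (pure_tensor R M N y z)) \<in> module_hom R N T"
      unfolding T_def
      using bilinearD(1)[OF MN.pure_tensor_bilinear that(2)]
        bilinearD(1)[OF LMN.pure_tensor_bilinear that(1)]
      by (rule module_hom_comp)
    thus ?thesis by (simp only: b_def)
  qed
  \<comment> \<open>A tensor \<open>t\<close> has no canonical form, so linearity in the second
    variable is read as an equality of two maps that are linear in \<open>t\<close>, and these are
    compared on pure tensors.\<close>
  have c2: "c t \<in> module_hom R N T" if t: "t \<in> carrier (tensor_product R L M)" for t
  proof (intro module_homI)
    fix z z' assume z: "z \<in> carrier N" and z': "z' \<in> carrier N"
    show "c t z \<in> carrier T" by (rule module_homD(1)[OF c1[OF z] t])
    have h: "(\<lambda>t. c t z \<oplus>\<^bsub>T\<^esub> c t z') \<in> module_hom R (tensor_product R L M) T"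
      by (rule module_hom_add[OF T c1[OF z] c1[OF z']])
    show "c t (z \<oplus>\<^bsub>N\<^esub> z') = c t z \<oplus>\<^bsub>T\<^esub> c t z'"
    proof (rule LM.tensor_hom_eqI[OF T c1 h _ t])
      show "z \<oplus>\<^bsub>N\<^esub> z' \<in> carrier N" using z z' by (rule MN.N.M.a_closed)
      fix x y assume xy: "x \<in> carrier L" "y \<in> carrier M"
      show "c (pure_tensor R L M x y) (z \<oplus>\<^bsub>N\<^esub> z') =
          c (pure_tensor R L M x y) z \<oplus>\<^bsub>T\<^esub> c (pure_tensor R L M x y) z'"
        using xy z z' MN.N.M.a_closed[OF z z'] by (simp only: c1p module_homD(2)[OF bz[OF xy] z z'])
    qed
  next
    fix a z assume a: "a \<in> carrier R" and z: "z \<in> carrier N"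
    have h: "(\<lambda>t. a \<odot>\<^bsub>T\<^esub> c t z) \<in> module_hom R (tensor_product R L M) T"
      by (rule module_hom_smult[OF T c1[OF z] a])
    show "c t (a \<odot>\<^bsub>N\<^esub> z) = a \<odot>\<^bsub>T\<^esub> c t z"
    proof (rule LM.tensor_hom_eqI[OF T c1 h _ t])
      show "a \<odot>\<^bsub>N\<^esub> z \<in> carrier N" using a z by (rule MN.N.smult_closed)
      fix x y assume xy: "x \<in> carrier L" "y \<in> carrier M"
      show "c (pure_tensor R L M x y) (a \<odot>\<^bsub>N\<^esub> z) = a \<odot>\<^bsub>T\<^esub> c (pure_tensor R L M x y) z"
        using xy z MN.N.smult_closed[OF a z] by (simp only: c1p module_homD(3)[OF bz[OF xy] a z])
    qed
  qed
  have c: "bilinear R (tensor_product R L M) N T c"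
    by (rule bilinearI[OF c2 c1])
  have eq: "tensor_assoc R L M N = tensor_lift R T c"
    by (simp add: tensor_assoc_def Let_def c_def b_def T_def)
  show "tensor_assoc R L M N \<in> module_hom R (tensor_product R (tensor_product R L M) N)
      (tensor_product R L (tensor_product R M N))"
    unfolding eq T_def[symmetric] by (rule LMN'.tensor_lift_hom[OF T c])
  show "x \<in> carrier L \<Longrightarrow> y \<in> carrier M \<Longrightarrow> z \<in> carrier N \<Longrightarrow>
      tensor_assoc R L M N (pure_tensor R (tensor_product R L M) N (pure_tensor R L M x y) z) =
      pure_tensor R L (tensor_product R M N) x (pure_tensor R M N y z)"
    using LMN'.tensor_lift_pure[OF T c LM.pure_tensor_closed] unfolding eq by (simp add: c1p b_def)
qed

lemma (in abelian_monoid) finsum_Sigma: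
  assumes "finite A" "\<And>a. a \<in> A \<Longrightarrow> finite (B a)"
    and "\<And>a b. a \<in> A \<Longrightarrow> b \<in> B a \<Longrightarrow> f a b \<in> carrier G"
  shows "(\<Oplus>a\<in>A. \<Oplus>b\<in>B a. f a b) = (\<Oplus>z\<in>Sigma A B. f (fst z) (snd z))"
  using assms
proof (induction A rule: finite_induct)
  case empty
  then show ?case by simp
next
  case (insert x F)
  have eq: "Sigma (insert x F) B = Pair x ` B x \<union> Sigma F B" by auto
  have "(\<Oplus>z\<in>Sigma (insert x F) B. f (fst z) (snd z)) =
      (\<Oplus>z\<in>Pair x ` B x. f (fst z) (snd z)) \<oplus> (\<Oplus>z\<in>Sigma F B. f (fst z) (snd z))"
    unfolding eq using insert by (intro finsum_Un_disjoint) auto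
  also have "(\<Oplus>z\<in>Pair x ` B x. f (fst z) (snd z)) = (\<Oplus>b\<in>B x. f x b)"
    using insert by (subst finsum_reindex) (auto intro: inj_onI)
  also have "(\<Oplus>z\<in>Sigma F B. f (fst z) (snd z)) = (\<Oplus>a\<in>F. \<Oplus>b\<in>B a. f a b)"
    using insert by (intro insert.IH[symmetric]) auto
  also have "(\<Oplus>b\<in>B x. f x b) \<oplus> (\<Oplus>a\<in>F. \<Oplus>b\<in>B a. f a b) = (\<Oplus>a\<in>insert x F. \<Oplus>b\<in>B a. f a b)"
    using insert by (intro finsum_insert[symmetric]) (auto intro!: finsum_closed)
  finally show ?case ..
qed

lemma (in abelian_monoid) finsum_delta:
  assumes "finite A" "i \<in> A" "x \<in> carrier G"
    and "\<And>j. j \<in> A \<Longrightarrow> j \<noteq> i \<Longrightarrow> f j = \<zero>" "f i = x"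
  shows "(\<Oplus>j\<in>A. f j) = x"
proof -
  have "(\<Oplus>j\<in>A. f j) = (\<Oplus>j\<in>A. if i = j then x else \<zero>)"
    using assms by (intro finsum_cong') auto
  also have "\<dots> = x" using finsum_singleton[of i A "\<lambda>_. x"] assms by auto
  finally show ?thesis .
qed

subsection \<open>The coalgebra of a monoid\<close>

text \<open>The finiteness makes the sum over all splittings of \<open>m\<close> a finite one. It
  serves both the comultiplication and the product of formal series with unrestricted
  support.\<close>

locale finite_decomposition =
  fixes S :: "'m::comm_monoid_add set"
  assumes zero_mem [simp]: "0 \<in> S"
    and add_mem [simp]: "u \<in> S \<Longrightarrow> w \<in> S \<Longrightarrow> u + w \<in> S"
    and finite_decomp: "finite {(u, w). u \<in> S \<and> w \<in> S \<and> u + w = m}"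
begin

definition decomp :: "'m \<Rightarrow> ('m \<times> 'm) set"
  where "decomp m = {(u, w). u \<in> S \<and> w \<in> S \<and> u + w = m}"

lemma finite_decomp' [simp]: "finite (decomp m)"
  using finite_decomp by (simp add: decomp_def)

lemma decomp_mem:
  assumes "z \<in> decomp m"
  shows "fst z \<in> S" "snd z \<in> S" "fst z + snd z = m"
  using assms by (auto simp: decomp_def)

lemma decomp_outside: "m \<notin> S \<Longrightarrow> decomp m = {}"
  by (auto simp: decomp_def)

lemma finsum_decomp_swap:
  assumes "abelian_monoid G" "\<And>u w. u \<in> S \<Longrightarrow> w \<in> S \<Longrightarrow> f u w \<in> carrier G"
  shows "(\<Oplus>\<^bsub>G\<^esub>z\<in>decomp m. f (fst z) (snd z)) = (\<Oplus>\<^bsub>G\<^esub>z\<in>decomp m. f (snd z) (fst z))"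
proof -
  interpret abelian_monoid G by fact
  have im: "decomp m = prod.swap ` decomp m"
    by (force simp: decomp_def add.commute image_iff)
  have "(\<Oplus>\<^bsub>G\<^esub>z\<in>prod.swap ` decomp m. f (fst z) (snd z)) = (\<Oplus>\<^bsub>G\<^esub>z\<in>decomp m. f (snd z) (fst z))"
    using assms(2) by (subst finsum_reindex) (auto simp: decomp_def)
  thus ?thesis using im by simp
qed

text \<open>Both double sums run over the triples \<open>(u, v, w)\<close> with
  \<open>u + v + w = m\<close>, which \<open>?h\<close> regroups. This one identity yields
  coassociativity and the associativity of convolution.\<close>

lemma finsum_decomp_assoc:
  assumes "abelian_monoid G"
    and f: "\<And>u v w. u \<in> S \<Longrightarrow> v \<in> S \<Longrightarrow> w \<in> S \<Longrightarrow> f u v w \<in> carrier G"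
  shows "(\<Oplus>\<^bsub>G\<^esub>z\<in>decomp m. \<Oplus>\<^bsub>G\<^esub>y\<in>decomp (fst z). f (fst y) (snd y) (snd z)) =
    (\<Oplus>\<^bsub>G\<^esub>z\<in>decomp m. \<Oplus>\<^bsub>G\<^esub>y\<in>decomp (snd z). f (fst z) (fst y) (snd y))"
proof -
  interpret abelian_monoid G by fact
  let ?A = "Sigma (decomp m) (\<lambda>z. decomp (fst z))" and ?B = "Sigma (decomp m) (\<lambda>z. decomp (snd z))"
  let ?h = "\<lambda>((a, b), (c, d)). ((a + c, d), (a, c)) :: ('m \<times> 'm) \<times> 'm \<times> 'm"
  let ?g = "\<lambda>x. f (fst (snd x)) (snd (snd x)) (snd (fst x))"
  have inj: "inj_on ?h ?B" by (auto intro!: inj_onI simp: decomp_def)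
  have im: "?h ` ?B = ?A"
  proof
    show "?h ` ?B \<subseteq> ?A" by (auto simp: decomp_def add.assoc)
    show "?A \<subseteq> ?h ` ?B"
    proof
      fix x assume "x \<in> ?A"
      then obtain a b c d where x: "x = ((a, b), (c, d))" "a \<in> S" "b \<in> S" "a + b = m" "c \<in> S" "d \<in> S" "c + d = a"
        by (auto simp: decomp_def)
      hence "x = ?h ((c, d + b), (d, b))" "((c, d + b), (d, b)) \<in> ?B"
        by (auto simp: decomp_def add.assoc[symmetric])
      thus "x \<in> ?h ` ?B" by blast
    qed
  qed
  have "(\<Oplus>\<^bsub>G\<^esub>z\<in>decomp m. \<Oplus>\<^bsub>G\<^esub>y\<in>decomp (fst z). f (fst y) (snd y) (snd z)) = (\<Oplus>\<^bsub>G\<^esub>x\<in>?A. ?g x)"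
    by (rule finsum_Sigma[OF finite_decomp' finite_decomp']) (auto intro!: f simp: decomp_def)
  also have "\<dots> = (\<Oplus>\<^bsub>G\<^esub>x\<in>?h ` ?B. ?g x)" unfolding im ..
  also have "\<dots> = (\<Oplus>\<^bsub>G\<^esub>x\<in>?B. ?g (?h x))"
    unfolding im[symmetric] by (rule finsum_reindex[OF _ inj]) (auto simp: decomp_def intro!: f)
  also have "\<dots> = (\<Oplus>\<^bsub>G\<^esub>x\<in>?B. f (fst (fst x)) (fst (snd x)) (snd (snd x)))"
    by (rule finsum_cong') (auto simp: decomp_def intro!: f)
  also have "\<dots> = (\<Oplus>\<^bsub>G\<^esub>z\<in>decomp m. \<Oplus>\<^bsub>G\<^esub>y\<in>decomp (snd z). f (fst z) (fst y) (snd y))"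
    by (rule finsum_Sigma[symmetric, where f="\<lambda>z y. f (fst z) (fst y) (snd y)",
          OF finite_decomp' finite_decomp'])
      (auto intro!: f simp: decomp_def)
  finally show ?thesis .
qed

end

text \<open>Coalgebras are wanted with elements in a prescribed type, whereas the free module lives
  in a function type. The map \<open>\<iota>\<close> renames its elements; injectivity is asked on
  the carrier only, because the whole function type may be larger than the target.\<close>

locale monoid_coalgebra = K: field K + finite_decomposition S
  for K :: "'k ring" (structure) and S :: "'m::comm_monoid_add set" +
  fixes \<iota> :: "('m \<Rightarrow> 'k) \<Rightarrow> 'c"
  assumes inj: "inj_on \<iota> (carrier (free_module K S))"
begin

abbreviation "FS \<equiv> free_module K S"
definition "unc = inv_into (carrier FS) \<iota>"

text \<open>A first stage without coalgebra maps: the comultiplication takes values in a tensor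
  product, for which the module must exist before the record is completed. Only module fields enter
  that product, so it agrees with the one formed over \<open>C\<close>.\<close>

definition C0 :: "('k, 'c) coalgebra"
  where "C0 = \<lparr>carrier = \<iota> ` carrier FS, mult = undefined, one = undefined, zero = \<iota> \<zero>\<^bsub>FS\<^esub>,
    add = (\<lambda>x y. \<iota> (unc x \<oplus>\<^bsub>FS\<^esub> unc y)), smult = (\<lambda>a x. \<iota> (a \<odot>\<^bsub>FS\<^esub> unc x)),
    comult = undefined, counit = undefined\<rparr>"

definition bas :: "'m \<Rightarrow> 'c" where "bas m = \<iota> (free_gen K m)"

definition Delta :: "'m \<Rightarrow> ('c \<times> 'c \<Rightarrow> 'k) set"
  where "Delta m = (\<Oplus>\<^bsub>tensor_product K C0 C0\<^esub>z\<in>decomp m. pure_tensor K C0 C0 (bas (fst z)) (bas (snd z)))"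

definition C :: "('k, 'c) coalgebra"
  where "C = C0\<lparr>comult := (\<lambda>x. free_lift K (tensor_product K C0 C0) Delta (unc x)),
    counit := (\<lambda>x. unc x 0)\<rparr>"

lemma C_sel: "carrier C = \<iota> ` carrier FS" "zero C = \<iota> \<zero>\<^bsub>FS\<^esub>"
  "add C = (\<lambda>x y. \<iota> (unc x \<oplus>\<^bsub>FS\<^esub> unc y))" "smult C = (\<lambda>a x. \<iota> (a \<odot>\<^bsub>FS\<^esub> unc x))"
  "carrier C0 = carrier C" "zero C0 = zero C" "add C0 = add C" "smult C0 = smult C"
  "comult C = (\<lambda>x. free_lift K (tensor_product K C0 C0) Delta (unc x))"
  "counit C = (\<lambda>x. unc x 0)"
  by (simp_all add: C_def C0_def)

lemma tensor_C0: "tensor_product K C0 C0 = tensor_product K C C"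
  "pure_tensor K C0 C0 = pure_tensor K C C"
  by (simp_all add: tensor_product_def pure_tensor_def bilinear_submodule_def
      bilinear_relators_def C_sel(5-8) fun_eq_iff)

lemmas comult_eq = C_sel(9)[unfolded tensor_C0]
lemmas Delta_eq = Delta_def[unfolded tensor_C0]

sublocale F: module K FS by (rule K.free_module_module)

lemma unc_i: "f \<in> carrier FS \<Longrightarrow> unc (\<iota> f) = f"
  unfolding unc_def using inj by (rule inv_into_f_f)

lemma unc_mem: "x \<in> carrier C \<Longrightarrow> unc x \<in> carrier FS"
  unfolding unc_def C_sel(1) by (rule inv_into_into)

lemma i_unc: "x \<in> carrier C \<Longrightarrow> \<iota> (unc x) = x"
  using f_inv_into_f[of x \<iota> "carrier FS"] by (simp add: unc_def C_sel(1))

sublocale C: module K C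
  by (rule module_surj_image[OF F.module_axioms, of \<iota>])
    (simp_all add: C_sel(1-4) unc_i)

lemma i_hom: "\<iota> \<in> module_hom K FS C"
  by (intro module_homI) (simp_all add: C_sel(1-4) unc_i)

lemma unc_hom: "unc \<in> module_hom K C FS"
  by (intro module_homI) (simp_all add: C_sel(3,4) unc_i unc_mem)

lemma bas_mem [simp]: "m \<in> S \<Longrightarrow> bas m \<in> carrier C"
  unfolding bas_def by (rule module_homD(1)[OF i_hom K.free_gen_closed])

lemma unc_bas: "m \<in> S \<Longrightarrow> unc (bas m) = free_gen K m"
  unfolding bas_def by (rule unc_i[OF K.free_gen_closed])

lemma hom_eqI:
  assumes "module K P" "h \<in> module_hom K C P" "h' \<in> module_hom K C P"
    and "\<And>m. m \<in> S \<Longrightarrow> h (bas m) = h' (bas m)" and x: "x \<in> carrier C"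
  shows "h x = h' x"
proof -
  have "h (\<iota> (unc x)) = h' (\<iota> (unc x))"
    by (rule K.free_module_hom_eqI[OF assms(1) module_hom_comp[OF i_hom assms(2)]
          module_hom_comp[OF i_hom assms(3)] _ unc_mem[OF x]])
      (rule assms(4)[unfolded bas_def])
  thus ?thesis unfolding i_unc[OF x] .
qed

definition extend :: "('k, 'p, 'd) module_scheme \<Rightarrow> ('m \<Rightarrow> 'p) \<Rightarrow> 'c \<Rightarrow> 'p"
  where "extend P b x = free_lift K P b (unc x)"

lemma extend_hom:
  "module K P \<Longrightarrow> (\<And>m. m \<in> S \<Longrightarrow> b m \<in> carrier P) \<Longrightarrow> extend P b \<in> module_hom K C P"
  unfolding extend_def by (rule module_hom_comp[OF unc_hom K.free_lift_hom])

lemma extend_bas: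
  assumes "module K P" "\<And>m. m \<in> S \<Longrightarrow> b m \<in> carrier P" "m \<in> S"
  shows "extend P b (bas m) = b m"
  unfolding extend_def unc_bas[OF assms(3)] using assms by (intro K.free_lift_gen) auto

definition coef :: "'m \<Rightarrow> 'c \<Rightarrow> 'k" where "coef u x = unc x u"

lemma coef_hom: "coef u \<in> module_hom K C (self_module K)"
  unfolding coef_def using module_homD[OF unc_hom] K.free_module_closed[OF unc_mem]
  by (intro module_homI) (simp_all add: free_module_sel(3,4))

lemma coef_closed [simp]: "x \<in> carrier C \<Longrightarrow> coef u x \<in> carrier K"
  using module_homD(1)[OF coef_hom] by simp

lemma coef_bas: "m \<in> S \<Longrightarrow> coef u (bas m) = (if u = m then \<one> else \<zero>)"
  by (simp add: coef_def unc_bas free_gen_def)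

lemma coef_outside: "x \<in> carrier C \<Longrightarrow> u \<notin> S \<Longrightarrow> coef u x = \<zero>"
  using unc_mem[of x] by (auto simp: coef_def free_module_sel)

lemma finite_coef: "x \<in> carrier C \<Longrightarrow> finite {u. coef u x \<noteq> \<zero>}"
  using K.free_module_supp(1)[OF unc_mem] by (simp add: coef_def)

lemma coef_eqI: "x \<in> carrier C \<Longrightarrow> y \<in> carrier C \<Longrightarrow> (\<And>u. coef u x = coef u y) \<Longrightarrow> x = y"
  unfolding coef_def by (metis ext i_unc)

lemma hom_coef:
  assumes P: "module K P" and h: "h \<in> module_hom K C P" and x: "x \<in> carrier C"
  shows "h x = (\<Oplus>\<^bsub>P\<^esub>u\<in>{u. coef u x \<noteq> \<zero>}. coef u x \<odot>\<^bsub>P\<^esub> h (bas u))"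
proof -
  have c: "h (bas m) \<in> carrier P" if "m \<in> S" for m
    by (rule module_homD(1)[OF h bas_mem[OF that]])
  have "h x = extend P (\<lambda>m. h (bas m)) x"
    by (rule hom_eqI[OF P h extend_hom[OF P c] _ x]) (simp_all add: extend_bas[OF P c])
  thus ?thesis unfolding extend_def free_lift_def coef_def .
qed

sublocale CC: module_pair K C C ..

abbreviation "TC \<equiv> tensor_product K C C"

lemma Delta_mem [simp]: "Delta m \<in> carrier TC"
  unfolding Delta_eq by (rule CC.T.M.finsum_closed) (auto simp: decomp_mem)

lemma comult_extend: "comult C = extend TC Delta"
  by (simp add: fun_eq_iff comult_eq extend_def)

lemma comult_hom: "comult C \<in> module_hom K C TC"
  unfolding comult_extend by (rule extend_hom[OF CC.T.module_axioms Delta_mem])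

lemma comult_bas: "m \<in> S \<Longrightarrow> comult C (bas m) = Delta m"
  unfolding comult_extend by (rule extend_bas[OF CC.T.module_axioms Delta_mem])

lemma counit_coef: "counit C = coef 0"
  by (simp add: fun_eq_iff C_sel coef_def)

lemma self_module: "module K (self_module K)"
  by (rule self_module_module) (rule K.is_cring)

lemma hom_Delta:
  assumes P: "module K P" and h: "h \<in> module_hom K TC P"
  shows "h (Delta m) = (\<Oplus>\<^bsub>P\<^esub>z\<in>decomp m. h (pure_tensor K C C (bas (fst z)) (bas (snd z))))"
  unfolding Delta_eq
  by (rule module_hom_finsum[OF CC.T.module_axioms P h]) (auto simp: decomp_mem)

text \<open>All maps in the laws are linear, so the basis suffices. There coassociativity is
  \<open>finsum_decomp_assoc\<close>, and the counit kills every splitting except the one whose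
  relevant summand is 0.\<close>

lemma coalgebra_C: "coalgebra K C"
proof -
  have fld: "field K" by (rule K.field_axioms)
  interpret TCC: module_pair K TC C ..
  interpret CTC: module_pair K C TC ..
  interpret SC: module_pair K "self_module K" C
    using self_module by (intro module_pair.intro C.module_axioms)
  interpret CS: module_pair K C "self_module K"
    using self_module by (intro module_pair.intro C.module_axioms)
  let ?id = "\<lambda>y. y"
  note id = module_hom_id[where M=C]
  note mc = C.module_axioms and mt = CC.T.module_axioms
  note L = tensor_map_hom_pure[OF mc mc mt mc comult_hom id]
  note Rr = tensor_map_hom_pure[OF mc mc mc mt id comult_hom]
  note A = tensor_assoc_hom_pure[OF mc mc mc]
  note mtt = CTC.T.module_axioms
  have counit_hom: "counit C \<in> module_hom K C (self_module K)"
    unfolding counit_coef by (rule coef_hom)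
  have cb: "counit C (bas u) = (if u = 0 then \<one> else \<zero>)" if "u \<in> S" for u
    unfolding counit_coef using coef_bas[OF that, of 0] by auto
  note EL = tensor_map_hom_pure[OF mc mc self_module mc counit_hom id]
  note ER = tensor_map_hom_pure[OF mc mc mc self_module id counit_hom]
  let ?p = "pure_tensor K C C" and ?q = "pure_tensor K C TC" and ?r = "pure_tensor K TC C"
  let ?lhs = "\<lambda>x. tensor_assoc K C C C (tensor_map K TC C (comult C) ?id (comult C x))"
  let ?rhs = "\<lambda>x. tensor_map K C TC ?id (comult C) (comult C x)"
  have dec: "fst z \<in> S" "snd z \<in> S" if "z \<in> decomp m" for z m using decomp_mem that by auto
  have coassoc_bas: "?lhs (bas m) = ?rhs (bas m)" if m: "m \<in> S" for m
  proof -
    have lin: "(\<lambda>t. tensor_assoc K C C C (?r t (bas b))) \<in> module_hom K TC (tensor_product K C TC)"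
      if "b \<in> S" for b
      by (rule module_hom_comp[OF bilinearD(2)[OF TCC.pure_tensor_bilinear bas_mem[OF that]] A(1)])
    have lin': "?q (bas a) \<in> module_hom K TC (tensor_product K C TC)" if "a \<in> S" for a
      by (rule bilinearD(1)[OF CTC.pure_tensor_bilinear bas_mem[OF that]])
    have "?lhs (bas m) = (\<Oplus>\<^bsub>tensor_product K C TC\<^esub>z\<in>decomp m.
        tensor_assoc K C C C (tensor_map K TC C (comult C) ?id (?p (bas (fst z)) (bas (snd z)))))"
      unfolding comult_bas[OF m] by (rule hom_Delta[OF mtt module_hom_comp[OF L(1) A(1)]])
    also have "\<dots> = (\<Oplus>\<^bsub>tensor_product K C TC\<^esub>z\<in>decomp m. \<Oplus>\<^bsub>tensor_product K C TC\<^esub>y\<in>decomp (fst z).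
        ?q (bas (fst y)) (?p (bas (snd y)) (bas (snd z))))"
    proof (rule CTC.T.M.finsum_cong')
      fix z assume z: "z \<in> decomp m"
      have "tensor_assoc K C C C (tensor_map K TC C (comult C) ?id (?p (bas (fst z)) (bas (snd z)))) =
          tensor_assoc K C C C (?r (Delta (fst z)) (bas (snd z)))"
        using dec[OF z] by (simp add: L(2) comult_bas)
      also have "\<dots> = (\<Oplus>\<^bsub>tensor_product K C TC\<^esub>y\<in>decomp (fst z).
          tensor_assoc K C C C (?r (?p (bas (fst y)) (bas (snd y))) (bas (snd z))))"
        by (rule hom_Delta[OF mtt lin[OF dec(2)[OF z]]])
      also have "\<dots> = (\<Oplus>\<^bsub>tensor_product K C TC\<^esub>y\<in>decomp (fst z).
        ?q (bas (fst y)) (?p (bas (snd y)) (bas (snd z))))"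
        using dec[OF z] by (intro CTC.T.M.finsum_cong') (auto simp: A(2) dec)
      finally show "tensor_assoc K C C C (tensor_map K TC C (comult C) ?id (?p (bas (fst z)) (bas (snd z)))) = \<dots>" .
    qed (auto intro!: CTC.T.M.finsum_closed simp: dec)
    also have "\<dots> = (\<Oplus>\<^bsub>tensor_product K C TC\<^esub>z\<in>decomp m. \<Oplus>\<^bsub>tensor_product K C TC\<^esub>y\<in>decomp (snd z).
        ?q (bas (fst z)) (?p (bas (fst y)) (bas (snd y))))"
      by (rule finsum_decomp_assoc[OF CTC.T.M.abelian_monoid_axioms, where f="\<lambda>u v w. ?q (bas u) (?p (bas v) (bas w))"])
        simp
    also have "\<dots> = (\<Oplus>\<^bsub>tensor_product K C TC\<^esub>z\<in>decomp m.
        tensor_map K C TC ?id (comult C) (?p (bas (fst z)) (bas (snd z))))"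
    proof (rule CTC.T.M.finsum_cong')
      fix z assume z: "z \<in> decomp m"
      have "(\<Oplus>\<^bsub>tensor_product K C TC\<^esub>y\<in>decomp (snd z). ?q (bas (fst z)) (?p (bas (fst y)) (bas (snd y)))) =
          ?q (bas (fst z)) (Delta (snd z))"
        by (rule hom_Delta[OF mtt lin'[OF dec(1)[OF z]], symmetric])
      also have "\<dots> = tensor_map K C TC ?id (comult C) (?p (bas (fst z)) (bas (snd z)))"
        using dec[OF z] by (simp add: Rr(2) comult_bas)
      finally show "(\<Oplus>\<^bsub>tensor_product K C TC\<^esub>y\<in>decomp (snd z). ?q (bas (fst z)) (?p (bas (fst y)) (bas (snd y)))) = \<dots>" .
    qed (auto simp: dec Rr(2) comult_bas)
    also have "\<dots> = ?rhs (bas m)"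
      unfolding comult_bas[OF m] by (rule hom_Delta[OF mtt Rr(1), symmetric])
    finally show ?thesis .
  qed
  have left: "tensor_map K (self_module K) C (counit C) ?id (comult C (bas m)) =
      pure_tensor K (self_module K) C \<one> (bas m)" if m: "m \<in> S" for m
  proof -
    have pz: "pure_tensor K (self_module K) C \<zero> (bas w) = \<zero>\<^bsub>tensor_product K (self_module K) C\<^esub>"
      if "w \<in> S" for w
      using module_hom_zero[OF self_module SC.T.module_axioms
          bilinearD(2)[OF SC.pure_tensor_bilinear bas_mem[OF that]]] by simp
    have "tensor_map K (self_module K) C (counit C) ?id (comult C (bas m)) =
      (\<Oplus>\<^bsub>tensor_product K (self_module K) C\<^esub>z\<in>decomp m.
        tensor_map K (self_module K) C (counit C) ?id (?p (bas (fst z)) (bas (snd z))))"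
      unfolding comult_bas[OF m] by (rule hom_Delta[OF SC.T.module_axioms EL(1)])
    also have "\<dots> = pure_tensor K (self_module K) C \<one> (bas m)"
    proof (rule SC.T.M.finsum_delta[of _ "(0, m)"])
      fix z assume z: "z \<in> decomp m" "z \<noteq> (0, m)"
      have "fst z \<noteq> 0" using z by (cases z) (auto simp: decomp_def)
      thus "tensor_map K (self_module K) C (counit C) ?id (?p (bas (fst z)) (bas (snd z))) =
          \<zero>\<^bsub>tensor_product K (self_module K) C\<^esub>"
        using dec[OF z(1)] by (simp add: EL(2) cb pz)
    qed (use m in \<open>simp_all add: decomp_def[of m, symmetric] EL(2) cb\<close>, simp add: decomp_def)
    finally show ?thesis .
  qed
  have right: "tensor_map K C (self_module K) ?id (counit C) (comult C (bas m)) =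
      pure_tensor K C (self_module K) (bas m) \<one>" if m: "m \<in> S" for m
  proof -
    have pz: "pure_tensor K C (self_module K) (bas w) \<zero> = \<zero>\<^bsub>tensor_product K C (self_module K)\<^esub>"
      if "w \<in> S" for w
      using module_hom_zero[OF self_module CS.T.module_axioms
          bilinearD(1)[OF CS.pure_tensor_bilinear bas_mem[OF that]]] by simp
    have "tensor_map K C (self_module K) ?id (counit C) (comult C (bas m)) =
      (\<Oplus>\<^bsub>tensor_product K C (self_module K)\<^esub>z\<in>decomp m.
        tensor_map K C (self_module K) ?id (counit C) (?p (bas (fst z)) (bas (snd z))))"
      unfolding comult_bas[OF m] by (rule hom_Delta[OF CS.T.module_axioms ER(1)])
    also have "\<dots> = pure_tensor K C (self_module K) (bas m) \<one>"
    proof (rule CS.T.M.finsum_delta[of _ "(m, 0)"])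
      fix z assume z: "z \<in> decomp m" "z \<noteq> (m, 0)"
      have "snd z \<noteq> 0" using z by (cases z) (auto simp: decomp_def)
      thus "tensor_map K C (self_module K) ?id (counit C) (?p (bas (fst z)) (bas (snd z))) =
          \<zero>\<^bsub>tensor_product K C (self_module K)\<^esub>"
        using dec[OF z(1)] by (simp add: ER(2) cb pz)
    qed (use m in \<open>simp_all add: decomp_def[of m, symmetric] ER(2) cb\<close>, simp add: decomp_def)
    finally show ?thesis .
  qed
  show ?thesis
  proof (intro coalgebra.intro coalgebra_axioms.intro)
    show "field K" by (rule fld)
    show "module K C" by (rule mc)
    show "comult C \<in> module_hom K C TC" by (rule comult_hom)
    show "counit C \<in> module_hom K C (self_module K)" by (rule counit_hom)
    fix x assume x: "x \<in> carrier C"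
    show "?lhs x = ?rhs x"
      by (rule hom_eqI[OF mtt module_hom_comp[OF comult_hom module_hom_comp[OF L(1) A(1)]]
            module_hom_comp[OF comult_hom Rr(1)] coassoc_bas x])
    show "tensor_map K (self_module K) C (counit C) ?id (comult C x) =
        pure_tensor K (self_module K) C \<one> x"
      by (rule hom_eqI[OF SC.T.module_axioms module_hom_comp[OF comult_hom EL(1)]
            bilinearD(1)[OF SC.pure_tensor_bilinear] left x]) simp
    show "tensor_map K C (self_module K) ?id (counit C) (comult C x) =
        pure_tensor K C (self_module K) x \<one>"
      by (rule hom_eqI[OF CS.T.module_axioms module_hom_comp[OF comult_hom ER(1)]
            bilinearD(2)[OF CS.pure_tensor_bilinear] right x]) simp
  qed
qed


end

section \<open>Coefficients and automorphisms of the monoid coalgebra\<close>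

context monoid_coalgebra
begin

text \<open>The functional \<open>coef u\<close> tensor \<open>coef w\<close>. Coefficients in the
  tensor square are read off by such functionals, so no basis of it has to be constructed.\<close>

definition coef2 :: "'m \<Rightarrow> 'm \<Rightarrow> ('c \<times> 'c \<Rightarrow> 'k) set \<Rightarrow> 'k"
  where "coef2 u w = tensor_lift K (self_module K) (\<lambda>x y. coef u x \<otimes> coef w y)"

lemma coef2_bilinear: "bilinear K C C (self_module K) (\<lambda>x y. coef u x \<otimes> coef w y)"
proof (rule bilinearI)
  fix x assume x: "x \<in> carrier C"
  show "(\<lambda>y. coef u x \<otimes> coef w y) \<in> module_hom K C (self_module K)"
    using module_hom_smult[OF self_module coef_hom coef_closed[OF x]] by simp
next
  fix y assume y: "y \<in> carrier C"
  have "(\<lambda>x. coef w y \<otimes> coef u x) \<in> module_hom K C (self_module K)"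
    using module_hom_smult[OF self_module coef_hom coef_closed[OF y]] by simp
  moreover have "coef w y \<otimes> coef u x = coef u x \<otimes> coef w y" if "x \<in> carrier C" for x
    using that y by (simp add: K.m_comm)
  ultimately show "(\<lambda>x. coef u x \<otimes> coef w y) \<in> module_hom K C (self_module K)"
    by (auto simp: module_hom_def Pi_iff)
qed

lemma coef2_hom: "coef2 u w \<in> module_hom K TC (self_module K)"
  unfolding coef2_def by (rule CC.tensor_lift_hom[OF self_module coef2_bilinear])

lemma coef2_pure:
  "x \<in> carrier C \<Longrightarrow> y \<in> carrier C \<Longrightarrow> coef2 u w (pure_tensor K C C x y) = coef u x \<otimes> coef w y"
  unfolding coef2_def by (rule CC.tensor_lift_pure[OF self_module coef2_bilinear])

text \<open>The pair \<open>(u, w)\<close> is a splitting of \<open>u + w\<close> and of nothing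
  else, so the dual basis multiplies like the monoid: this is why the dual algebra is a ring of
  formal series over \<open>S\<close>.\<close>

lemma coef2_comult:
  assumes u: "u \<in> S" "w \<in> S" and x: "x \<in> carrier C"
  shows "coef2 u w (comult C x) = coef (u + w) x"
proof (rule hom_eqI[OF self_module module_hom_comp[OF comult_hom coef2_hom] coef_hom _ x])
  fix m assume m: "m \<in> S"
  have "coef2 u w (comult C (bas m)) =
      (\<Oplus>z\<in>decomp m. coef2 u w (pure_tensor K C C (bas (fst z)) (bas (snd z))))"
    unfolding comult_bas[OF m] hom_Delta[OF self_module coef2_hom] by simp
  also have "\<dots> = (\<Oplus>z\<in>decomp m. if u = fst z \<and> w = snd z then \<one> else \<zero>)"
    by (rule K.finsum_cong') (auto simp: decomp_mem coef2_pure coef_bas)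
  also have "\<dots> = coef (u + w) (bas m)"
  proof (cases "u + w = m")
    case True
    thus ?thesis using u m
      by (intro K.finsum_delta[of _ "(u, w)"]) (auto simp: coef_bas, simp add: decomp_def)
  next
    case False
    hence "(\<Oplus>z\<in>decomp m. if u = fst z \<and> w = snd z then \<one> else \<zero>) = (\<Oplus>z\<in>decomp m. \<zero>)"
      by (intro K.finsum_cong') (auto simp: decomp_def)
    thus ?thesis using False m by (simp add: coef_bas)
  qed
  finally show "coef2 u w (comult C (bas m)) = coef (u + w) (bas m)" .
qed

lemma coalgebra_homD:
  assumes "f \<in> coalgebra_hom K C C"
  shows "f \<in> module_hom K C C"
    and "x \<in> carrier C \<Longrightarrow> comult C (f x) = tensor_map K C C f f (comult C x)"
    and "x \<in> carrier C \<Longrightarrow> counit C (f x) = counit C x"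
  using assms by (auto simp: coalgebra_hom_def)

text \<open>Obtained by reading \<open>comult C (f (bas m))\<close> through \<open>coef2 u w\<close>
  before and after \<open>f\<close> is moved past \<open>comult\<close>. It says that the rows of
  the matrix of \<open>f\<close> multiply in the dual algebra.\<close>

lemma coef_coalgebra_hom:
  assumes f: "f \<in> coalgebra_hom K C C" and m: "m \<in> S" and u: "u \<in> S" "w \<in> S"
  shows "coef (u + w) (f (bas m)) =
    (\<Oplus>z\<in>decomp m. coef u (f (bas (fst z))) \<otimes> coef w (f (bas (snd z))))"
proof -
  note fh = coalgebra_homD(1)[OF f]
  note mc = C.module_axioms
  note T = tensor_map_hom_pure[OF mc mc mc mc fh fh]
  have fb: "f (bas m) \<in> carrier C" if "m \<in> S" for m
    by (rule module_homD(1)[OF fh bas_mem[OF that]])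
  have "coef (u + w) (f (bas m)) = coef2 u w (tensor_map K C C f f (Delta m))"
    unfolding coef2_comult[OF u fb[OF m], symmetric] coalgebra_homD(2)[OF f bas_mem[OF m]]
      comult_bas[OF m] ..
  also have "\<dots> = (\<Oplus>z\<in>decomp m. coef2 u w (tensor_map K C C f f (pure_tensor K C C (bas (fst z)) (bas (snd z)))))"
    using hom_Delta[OF self_module module_hom_comp[OF T(1) coef2_hom]] by simp
  also have "\<dots> = (\<Oplus>z\<in>decomp m. coef u (f (bas (fst z))) \<otimes> coef w (f (bas (snd z))))"
    by (rule K.finsum_cong') (auto simp: decomp_mem T(2) coef2_pure fb)
  finally show ?thesis .
qed

lemma coef_0_coalgebra_hom:
  assumes f: "f \<in> coalgebra_hom K C C" and m: "m \<in> S"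
  shows "coef 0 (f (bas m)) = (if m = 0 then \<one> else \<zero>)"
  using coalgebra_homD(3)[OF f bas_mem[OF m]] coef_bas[OF m, of 0] by (auto simp: counit_coef)

lemma coef_comp:
  assumes f: "f \<in> module_hom K C C" and x: "x \<in> carrier C"
  shows "coef u (f x) = (\<Oplus>n\<in>{n. coef n x \<noteq> \<zero>}. coef n x \<otimes> coef u (f (bas n)))"
  using hom_coef[OF self_module module_hom_comp[OF f coef_hom] x] by simp

lemma tensor_map_id:
  assumes t: "t \<in> carrier TC" and fg: "f \<in> module_hom K C C" "g \<in> module_hom K C C"
    and id: "\<And>x. x \<in> carrier C \<Longrightarrow> g (f x) = x"
  shows "tensor_map K C C g g (tensor_map K C C f f t) = t"
proof -
  note mc = C.module_axioms
  note F = tensor_map_hom_pure[OF mc mc mc mc fg(1) fg(1)]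
  note G = tensor_map_hom_pure[OF mc mc mc mc fg(2) fg(2)]
  show ?thesis
    by (rule CC.tensor_hom_eqI[OF CC.T.module_axioms module_hom_comp[OF F(1) G(1)] module_hom_id _ t])
      (simp add: F(2) G(2) id module_homD(1)[OF fg(1)])
qed

lemma coalgebra_auto_inverse:
  assumes f: "f \<in> coalgebra_auto K C"
  obtains g where "g \<in> coalgebra_hom K C C" "\<And>x. x \<in> carrier C \<Longrightarrow> g (f x) = x"
    "\<And>x. x \<in> carrier C \<Longrightarrow> f (g x) = x"
proof -
  have fh: "f \<in> coalgebra_hom K C C" and bij: "bij_betw f (carrier C) (carrier C)"
    using f by (auto simp: coalgebra_auto_def Bij_def)
  define g where "g = inv_into (carrier C) f"
  have gf: "g (f x) = x" if "x \<in> carrier C" for x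
    unfolding g_def by (rule bij_betw_inv_into_left[OF bij that])
  have fg: "f (g x) = x" if "x \<in> carrier C" for x
    unfolding g_def by (rule bij_betw_inv_into_right[OF bij that])
  have gc: "g x \<in> carrier C" if "x \<in> carrier C" for x
    using that bij bij_betw_imp_surj_on[OF bij] unfolding g_def by (metis inv_into_into)
  note fm = coalgebra_homD(1)[OF fh]
  have gm: "g \<in> module_hom K C C"
  proof (rule module_homI)
    fix x y assume x: "x \<in> carrier C" and y: "y \<in> carrier C"
    show "g x \<in> carrier C" by (rule gc[OF x])
    have "g (x \<oplus>\<^bsub>C\<^esub> y) = g (f (g x \<oplus>\<^bsub>C\<^esub> g y))"
      unfolding module_homD(2)[OF fm gc[OF x] gc[OF y]] fg[OF x] fg[OF y] ..
    thus "g (x \<oplus>\<^bsub>C\<^esub> y) = g x \<oplus>\<^bsub>C\<^esub> g y" using gf gc x y by simp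
  next
    fix a x assume a: "a \<in> carrier K" and x: "x \<in> carrier C"
    have "g (a \<odot>\<^bsub>C\<^esub> x) = g (f (a \<odot>\<^bsub>C\<^esub> g x))"
      unfolding module_homD(3)[OF fm a gc[OF x]] fg[OF x] ..
    thus "g (a \<odot>\<^bsub>C\<^esub> x) = a \<odot>\<^bsub>C\<^esub> g x" using gf gc x a by simp
  qed
  have "g \<in> coalgebra_hom K C C"
    unfolding coalgebra_hom_def
  proof (intro CollectI conjI ballI gm)
    fix x assume x: "x \<in> carrier C"
    have "comult C x = tensor_map K C C f f (comult C (g x))"
      using coalgebra_homD(2)[OF fh gc[OF x]] fg[OF x] by simp
    thus "comult C (g x) = tensor_map K C C g g (comult C x)"
      using tensor_map_id[OF module_homD(1)[OF comult_hom gc[OF x]] fm gm gf] by simp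
    show "counit C (g x) = counit C x"
      using coalgebra_homD(3)[OF fh gc[OF x]] fg[OF x] by simp
  qed
  thus thesis using that gf fg by blast
qed

text \<open>The restriction is there because the members of \<open>Bij\<close> are required to be
  extensional.\<close>

definition perm_map :: "('m \<Rightarrow> 'm) \<Rightarrow> 'c \<Rightarrow> 'c"
  where "perm_map \<pi> = restrict (extend C (\<lambda>m. bas (\<pi> m))) (carrier C)"

context
  fixes \<pi> :: "'m \<Rightarrow> 'm"
  assumes \<pi>: "\<pi> \<in> S \<rightarrow> S"
begin

lemma perm_mem: "m \<in> S \<Longrightarrow> \<pi> m \<in> S"
  using \<pi> by auto


lemma perm_map_hom: "perm_map \<pi> \<in> module_hom K C C"
  using extend_hom[OF C.module_axioms, of "\<lambda>m. bas (\<pi> m)"] perm_mem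
  by (simp add: module_hom_def perm_map_def Pi_iff)

lemma perm_map_bas: "m \<in> S \<Longrightarrow> perm_map \<pi> (bas m) = bas (\<pi> m)"
  unfolding perm_map_def using extend_bas[OF C.module_axioms, of "\<lambda>m. bas (\<pi> m)"] perm_mem by simp

end

lemma perm_map_comp:
  assumes "\<pi> \<in> S \<rightarrow> S" "\<rho> \<in> S \<rightarrow> S"
    and x: "x \<in> carrier C"
  shows "perm_map \<pi> (perm_map \<rho> x) = perm_map (\<lambda>m. \<pi> (\<rho> m)) x"
proof -
  have c: "(\<lambda>m. \<pi> (\<rho> m)) \<in> S \<rightarrow> S" using assms by auto
  note P = perm_map_hom[where \<pi>=\<pi>, OF assms(1)] perm_map_hom[where \<pi>=\<rho>, OF assms(2)]
      perm_map_hom[where \<pi>="\<lambda>m. \<pi> (\<rho> m)", OF c]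
    and B = perm_map_bas[where \<pi>=\<pi>, OF assms(1)] perm_map_bas[where \<pi>=\<rho>, OF assms(2)]
      perm_map_bas[where \<pi>="\<lambda>m. \<pi> (\<rho> m)", OF c]
  show ?thesis
    by (rule hom_eqI[OF C.module_axioms module_hom_comp[OF P(2,1)] P(3) _ x]) (use assms in \<open>simp add: B Pi_iff\<close>)
qed

lemma eq_perm_mapI:
  assumes \<pi>: "\<pi> \<in> S \<rightarrow> S"
    and f: "f \<in> coalgebra_auto K C" and fb: "\<And>m. m \<in> S \<Longrightarrow> f (bas m) = bas (\<pi> m)"
  shows "f = perm_map \<pi>"
proof (rule extensionalityI[of _ "carrier C"])
  show "f \<in> extensional (carrier C)" using f by (auto simp: coalgebra_auto_def Bij_def)
  show "perm_map \<pi> \<in> extensional (carrier C)" by (simp add: perm_map_def)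
  have fm: "f \<in> module_hom K C C" using f by (auto simp: coalgebra_auto_def coalgebra_hom_def)
  fix x assume x: "x \<in> carrier C"
  show "f x = perm_map \<pi> x"
    by (rule hom_eqI[OF C.module_axioms fm perm_map_hom[OF \<pi>] _ x]) (simp add: fb perm_map_bas[OF \<pi>])
qed

text \<open>An additive bijection of \<open>S\<close> maps \<open>decomp m\<close> bijectively onto
  \<open>decomp (\<pi> m)\<close>, so it carries the terms of one comultiplication to those of the
  other.\<close>

lemma perm_map_auto:
  assumes bij: "bij_betw \<pi> S S" and add: "\<And>u w. u \<in> S \<Longrightarrow> w \<in> S \<Longrightarrow> \<pi> (u + w) = \<pi> u + \<pi> w"
    and zero: "\<pi> 0 = 0"
  shows "perm_map \<pi> \<in> coalgebra_auto K C"
proof -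
  have \<pi>: "\<pi> m \<in> S" if "m \<in> S" for m using bij that bij_betwE by blast
  define \<rho> where "\<rho> = inv_into S \<pi>"
  have \<rho>: "\<rho> m \<in> S" "\<pi> (\<rho> m) = m" if "m \<in> S" for m
    using that bij bij_betw_inv_into_right[OF bij that] bij_betw_imp_surj_on[OF bij] inv_into_into[of m \<pi> S]
    unfolding \<rho>_def by auto
  have \<rho>\<pi>: "\<rho> (\<pi> m) = m" if "m \<in> S" for m
    using bij_betw_inv_into_left[OF bij that] unfolding \<rho>_def .
  have inj: "inj_on \<pi> S" using bij bij_betw_imp_inj_on by blast
  note mc = C.module_axioms
  have \<pi>S: "\<pi> \<in> S \<rightarrow> S" and \<rho>S: "\<rho> \<in> S \<rightarrow> S" using \<pi> \<rho> by auto
  note ph = perm_map_hom[OF \<pi>S] and pb = perm_map_bas[where \<pi>=\<pi>, OF \<pi>S]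
  note T = tensor_map_hom_pure[OF mc mc mc mc ph ph]
  have im: "decomp (\<pi> m) = map_prod \<pi> \<pi> ` decomp m" if m: "m \<in> S" for m
  proof
    show "map_prod \<pi> \<pi> ` decomp m \<subseteq> decomp (\<pi> m)" by (auto simp: decomp_def add \<pi>)
    show "decomp (\<pi> m) \<subseteq> map_prod \<pi> \<pi> ` decomp m"
    proof
      fix z assume "z \<in> decomp (\<pi> m)"
      then obtain a b where z: "z = (a, b)" "a \<in> S" "b \<in> S" "a + b = \<pi> m" by (auto simp: decomp_def)
      have "\<pi> (\<rho> a + \<rho> b) = \<pi> m" using z \<rho> by (simp add: add)
      hence "\<rho> a + \<rho> b = m" using inj m z \<rho> by (simp add: inj_on_eq_iff)
      hence "(\<rho> a, \<rho> b) \<in> decomp m" using z \<rho> by (auto simp: decomp_def)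
      moreover have "z = map_prod \<pi> \<pi> (\<rho> a, \<rho> b)" using z \<rho> by simp
      ultimately show "z \<in> map_prod \<pi> \<pi> ` decomp m" by blast
    qed
  qed
  have "perm_map \<pi> \<in> coalgebra_hom K C C"
    unfolding coalgebra_hom_def
  proof (intro CollectI conjI ballI ph)
    fix x assume x: "x \<in> carrier C"
    show "comult C (perm_map \<pi> x) = tensor_map K C C (perm_map \<pi>) (perm_map \<pi>) (comult C x)"
    proof (rule hom_eqI[OF CC.T.module_axioms module_hom_comp[OF ph comult_hom] module_hom_comp[OF comult_hom T(1)] _ x])
      fix m assume m: "m \<in> S"
      have "comult C (perm_map \<pi> (bas m)) =
          (\<Oplus>\<^bsub>TC\<^esub>z\<in>map_prod \<pi> \<pi> ` decomp m. pure_tensor K C C (bas (fst z)) (bas (snd z)))"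
        unfolding pb[OF m] comult_bas[OF \<pi>[OF m]] Delta_eq im[OF m] ..
      also have "\<dots> = (\<Oplus>\<^bsub>TC\<^esub>z\<in>decomp m. pure_tensor K C C (bas (fst (map_prod \<pi> \<pi> z))) (bas (snd (map_prod \<pi> \<pi> z))))"
        using inj by (intro CC.T.M.finsum_reindex) (auto intro!: inj_onI simp: decomp_def \<pi> dest: inj_onD)
      also have "\<dots> = (\<Oplus>\<^bsub>TC\<^esub>z\<in>decomp m. tensor_map K C C (perm_map \<pi>) (perm_map \<pi>) (pure_tensor K C C (bas (fst z)) (bas (snd z))))"
        by (rule CC.T.M.finsum_cong') (auto simp: decomp_mem T(2) pb \<pi>)
      also have "\<dots> = tensor_map K C C (perm_map \<pi>) (perm_map \<pi>) (comult C (bas m))"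
        unfolding comult_bas[OF m] by (rule hom_Delta[OF CC.T.module_axioms T(1), symmetric])
      finally show "comult C (perm_map \<pi> (bas m)) = \<dots>" .
    qed
    have "\<pi> m = 0 \<longleftrightarrow> m = 0" if "m \<in> S" for m using \<rho>\<pi>[OF that] \<rho>\<pi>[of 0] zero by auto
    thus "counit C (perm_map \<pi> x) = counit C x" unfolding counit_coef
      by (intro hom_eqI[OF self_module module_hom_comp[OF ph coef_hom] coef_hom _ x])
        (auto simp: pb coef_bas \<pi>)
  qed
  moreover have "perm_map \<pi> \<in> Bij (carrier C)"
  proof -
    have pid: "perm_map (\<lambda>m. \<rho>' (\<pi>' m)) x = x"
      if "\<And>m. m \<in> S \<Longrightarrow> \<rho>' (\<pi>' m) = m" "x \<in> carrier C" for \<rho>' \<pi>' :: "'m \<Rightarrow> 'm" and x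
      proof (rule hom_eqI[OF mc perm_map_hom module_hom_id _ that(2)])
      show "(\<lambda>m. \<rho>' (\<pi>' m)) \<in> S \<rightarrow> S" using that by auto
      fix m assume m: "m \<in> S"
      show "perm_map (\<lambda>m. \<rho>' (\<pi>' m)) (bas m) = bas m"
        using perm_map_bas[of "\<lambda>m. \<rho>' (\<pi>' m)" m] that m by auto
    qed
    have "bij_betw (perm_map \<pi>) (carrier C) (carrier C)"
      by (rule bij_betw_byWitness[where f'="perm_map \<rho>"])
        (use module_homD(1)[OF ph] module_homD(1)[OF perm_map_hom[where \<pi>=\<rho>, OF \<rho>S]] in
          \<open>auto simp: perm_map_comp[where \<pi>=\<pi> and \<rho>=\<rho>, OF \<pi>S \<rho>S] perm_map_comp[where \<pi>=\<rho> and \<rho>=\<pi>, OF \<rho>S \<pi>S] pid \<rho> \<rho>\<pi>\<close>)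
    thus ?thesis by (simp add: Bij_def perm_map_def)
  qed
  ultimately show ?thesis by (simp add: coalgebra_auto_def)
qed

end

subsection \<open>The Frobenius endomorphism\<close>

context cring
begin

lemma binomial:
  assumes a: "a \<in> carrier R" and b: "b \<in> carrier R"
  shows "(a \<oplus> b) [^] n = (\<Oplus>k\<in>{..n}. [(n choose k)] \<cdot> (a [^] k \<otimes> b [^] (n - k)))"
proof (induction n)
  case 0
  then show ?case using a b by simp
next
  case (Suc n)
  let ?t = "\<lambda>n k. [(n choose k)] \<cdot> (a [^] k \<otimes> b [^] (n - k))"
  \<comment> \<open>\<open>?A\<close> and \<open>?B\<close> are the two summands of Pascal's rule.
    The case \<open>k = 0\<close> needs its own value, since \<open>k - 1\<close> is truncated there
    and would produce the binomial coefficient 1.\<close>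
  let ?A = "\<lambda>k. if k = 0 then \<zero> else [(n choose (k - 1))] \<cdot> (a [^] k \<otimes> b [^] (Suc n - k))"
  let ?B = "\<lambda>k. [(n choose k)] \<cdot> (a [^] k \<otimes> b [^] (Suc n - k))"
  have c: "?t n k \<in> carrier R" "?A k \<in> carrier R" "?B k \<in> carrier R" for n k using a b by auto
  have 1: "(\<Oplus>k\<in>{..n}. ?t n k) \<otimes> a = (\<Oplus>k\<in>{..Suc n}. ?A k)"
  proof -
    have "(\<Oplus>k\<in>{..Suc n}. ?A k) = (\<Oplus>k\<in>{..n}. ?A (Suc k)) \<oplus> ?A 0"
      using c by (intro finsum_Suc2) auto
    also have "\<dots> = (\<Oplus>k\<in>{..n}. ?t n k \<otimes> a)"
      using a b c(1)
      by (simp, intro finsum_cong')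
        (auto simp: add_pow_ldistr add_pow_rdistr m_ac)
    finally show ?thesis using a c(1) by (subst finsum_ldistr) auto
  qed
  have 2: "(\<Oplus>k\<in>{..n}. ?t n k) \<otimes> b = (\<Oplus>k\<in>{..Suc n}. ?B k)"
  proof -
    have "(\<Oplus>k\<in>{..Suc n}. ?B k) = ?B (Suc n) \<oplus> (\<Oplus>k\<in>{..n}. ?B k)"
      using c by (intro finsum_Suc) auto
    also have "?B (Suc n) = \<zero>" by (simp add: binomial_eq_0)
    also have "\<zero> \<oplus> (\<Oplus>k\<in>{..n}. ?B k) = (\<Oplus>k\<in>{..n}. ?B k)" using c by (intro l_zero finsum_closed) auto
    also have "\<dots> = (\<Oplus>k\<in>{..n}. ?t n k \<otimes> b)"
      using a b c(1)
      by (intro finsum_cong') (auto simp: add_pow_ldistr m_assoc Suc_diff_le)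
    finally show ?thesis using b c(1) by (subst finsum_ldistr) auto
  qed
  have 3: "?A k \<oplus> ?B k = ?t (Suc n) k" for k
    using a b by (cases k) (auto simp: add.nat_pow_mult)
  have "(a \<oplus> b) [^] Suc n = (\<Oplus>k\<in>{..n}. ?t n k) \<otimes> a \<oplus> (\<Oplus>k\<in>{..n}. ?t n k) \<otimes> b"
    using Suc a b c by (simp add: r_distr)
  also have "\<dots> = (\<Oplus>k\<in>{..Suc n}. ?A k \<oplus> ?B k)"
    unfolding 1 2 using c by (intro finsum_addf[symmetric]) auto
  also have "\<dots> = (\<Oplus>k\<in>{..Suc n}. ?t (Suc n) k)" unfolding 3 ..
  finally show ?case .
qed

lemma frobenius_add:
  fixes p :: nat
  assumes p: "Factorial_Ring.prime p" and char: "\<And>x. x \<in> carrier R \<Longrightarrow> [p] \<cdot> x = \<zero>"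
    and a: "a \<in> carrier R" and b: "b \<in> carrier R"
  shows "(a \<oplus> b) [^] p = a [^] p \<oplus> b [^] p"
proof -
  let ?t = "\<lambda>k. [(p choose k)] \<cdot> (a [^] k \<otimes> b [^] (p - k))"
  have c: "?t k \<in> carrier R" for k using a b by auto
  have p1: "p > 1" using p prime_gt_1_nat by auto
  have mid: "?t k = \<zero>" if k: "0 < k" "k < p" for k
  proof -
    have "p dvd (p choose k)" using dvd_choose_prime[of k p] k p by auto
    then obtain j where j: "(p choose k) = p * j" by auto
    have "?t k = [p] \<cdot> ([j] \<cdot> (a [^] k \<otimes> b [^] (p - k)))"
      unfolding j using a b add.nat_pow_pow[of "a [^] k \<otimes> b [^] (p - k)" p j] by (simp add: mult.commute)
    thus ?thesis using char a b by simp
  qed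
  have "(a \<oplus> b) [^] p = (\<Oplus>k\<in>{..p}. ?t k)" by (rule binomial[OF a b])
  also have "\<dots> = (\<Oplus>k\<in>{0, p}. ?t k)"
    using p1 c mid by (intro add.finprod_mono_neutral_cong_right) auto
  also have "\<dots> = a [^] p \<oplus> b [^] p"
    using a b p1 by (subst finsum_insert) (auto simp: a_comm)
  finally show ?thesis .
qed

lemma frobenius_power_add:
  fixes p :: nat
  assumes p: "Factorial_Ring.prime p" and char: "\<And>x. x \<in> carrier R \<Longrightarrow> [p] \<cdot> x = \<zero>"
    and a: "a \<in> carrier R" and b: "b \<in> carrier R"
  shows "(a \<oplus> b) [^] (p ^ n) = a [^] (p ^ n) \<oplus> b [^] (p ^ n)"
proof (induction n)
  case 0
  then show ?case using a b by simp
next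
  case (Suc n)
  have e: "x [^] (p ^ Suc n) = (x [^] (p ^ n)) [^] p" if "x \<in> carrier R" for x
    using that by (simp add: nat_pow_pow mult.commute)
  show ?case
    using a b Suc frobenius_add[OF p char, of "a [^] (p ^ n)" "b [^] (p ^ n)"]
    by (simp only: e a_closed nat_pow_closed)
qed

lemma frobenius_power_finsum:
  fixes p :: nat
  assumes p: "Factorial_Ring.prime p" and char: "\<And>x. x \<in> carrier R \<Longrightarrow> [p] \<cdot> x = \<zero>"
    and A: "finite A" "\<And>i. i \<in> A \<Longrightarrow> f i \<in> carrier R"
  shows "(\<Oplus>i\<in>A. f i) [^] (p ^ n) = (\<Oplus>i\<in>A. f i [^] (p ^ n))"
  using A
proof (induction A rule: finite_induct)
  case empty
  have "p ^ n \<noteq> 0" using p by (simp add: prime_nat_iff)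
  then show ?case by (simp add: nat_pow_zero)
next
  case (insert i A)
  have c: "f i \<in> carrier R" "f \<in> A \<rightarrow> carrier R" "(\<lambda>i. f i [^] (p ^ n)) \<in> A \<rightarrow> carrier R"
    using insert by auto
  show ?case
    using insert c frobenius_power_add[OF p char c(1) finsum_closed[OF c(2)], of n] by simp
qed

end

subsection \<open>The convolution ring\<close>

context finite_decomposition
begin

lemma decomp_iff: "(u, w) \<in> decomp m \<longleftrightarrow> u \<in> S \<and> w \<in> S \<and> u + w = m"
  by (simp add: decomp_def)

lemma decomp_fst_nonzero: "z \<in> decomp m \<Longrightarrow> z \<noteq> (0, m) \<Longrightarrow> fst z \<noteq> 0"
  by (cases z) (auto simp: decomp_def)

end

definition nmult :: "nat \<Rightarrow> 'm::comm_monoid_add \<Rightarrow> 'm"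
  where "nmult n m = (\<Sum>i<n. m)"

lemma nmult_0 [simp]: "nmult 0 m = 0" and nmult_Suc: "nmult (Suc n) m = m + nmult n m"
  by (simp_all add: nmult_def add.commute)

locale convolution = K: field K + finite_decomposition S
  for K :: "'k ring" (structure) and S :: "'m::comm_monoid_add set"
begin

text \<open>The full dual of the coalgebra, as formal series over \<open>S\<close>. No finiteness is
  imposed on the support, because a row of the matrix of an automorphism may a priori have
  infinitely many nonzero entries.\<close>

definition conv_ring :: "('m \<Rightarrow> 'k) ring"
  where "conv_ring = \<lparr>carrier = {a. (\<forall>m\<in>S. a m \<in> carrier K) \<and> (\<forall>m. m \<notin> S \<longrightarrow> a m = \<zero>)},
    mult = (\<lambda>a b m. \<Oplus>z\<in>decomp m. a (fst z) \<otimes> b (snd z)),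
    one = (\<lambda>m. if m = 0 then \<one> else \<zero>), zero = (\<lambda>m. \<zero>), add = (\<lambda>a b m. a m \<oplus> b m)\<rparr>"

lemma conv_sel:
  "carrier conv_ring = {a. (\<forall>m\<in>S. a m \<in> carrier K) \<and> (\<forall>m. m \<notin> S \<longrightarrow> a m = \<zero>)}"
  "mult conv_ring = (\<lambda>a b m. \<Oplus>z\<in>decomp m. a (fst z) \<otimes> b (snd z))"
  "one conv_ring = (\<lambda>m. if m = 0 then \<one> else \<zero>)" "zero conv_ring = (\<lambda>m. \<zero>)"
  "add conv_ring = (\<lambda>a b m. a m \<oplus> b m)"
  by (simp_all add: conv_ring_def)

lemma conv_closed: "a \<in> carrier conv_ring \<Longrightarrow> a m \<in> carrier K"
  by (cases "m \<in> S") (auto simp: conv_sel)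

lemma conv_carrierI:
  "(\<And>m. a m \<in> carrier K) \<Longrightarrow> (\<And>m. m \<notin> S \<Longrightarrow> a m = \<zero>) \<Longrightarrow> a \<in> carrier conv_ring"
  by (auto simp: conv_sel)

lemma conv_outside: "a \<in> carrier conv_ring \<Longrightarrow> m \<notin> S \<Longrightarrow> a m = \<zero>"
  by (simp add: conv_sel)

lemma conv_ring_abelian: "abelian_group conv_ring"
proof (rule abelian_groupI)
  fix a assume a: "a \<in> carrier conv_ring"
  show "\<exists>y\<in>carrier conv_ring. y \<oplus>\<^bsub>conv_ring\<^esub> a = \<zero>\<^bsub>conv_ring\<^esub>"
    using conv_closed[OF a] conv_outside[OF a]
    by (intro bexI[of _ "\<lambda>m. \<ominus> a m"] conv_carrierI) (auto simp: conv_sel(4,5) K.l_neg)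
next
  fix a b c assume a: "a \<in> carrier conv_ring" and b: "b \<in> carrier conv_ring" and c: "c \<in> carrier conv_ring"
  note cl = conv_closed[OF a] conv_closed[OF b] conv_closed[OF c]
  show "a \<oplus>\<^bsub>conv_ring\<^esub> b \<oplus>\<^bsub>conv_ring\<^esub> c = a \<oplus>\<^bsub>conv_ring\<^esub> (b \<oplus>\<^bsub>conv_ring\<^esub> c)"
    by (simp add: conv_sel(5) K.a_assoc cl)
next
  fix a b assume a: "a \<in> carrier conv_ring" and b: "b \<in> carrier conv_ring"
  note cl = conv_closed[OF a] conv_closed[OF b]
  show "a \<oplus>\<^bsub>conv_ring\<^esub> b \<in> carrier conv_ring"
    by (rule conv_carrierI) (simp_all add: conv_sel(5) cl conv_outside[OF a] conv_outside[OF b])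
  show "a \<oplus>\<^bsub>conv_ring\<^esub> b = b \<oplus>\<^bsub>conv_ring\<^esub> a" unfolding conv_sel(5) using K.a_comm cl by blast
next
  show "\<zero>\<^bsub>conv_ring\<^esub> \<in> carrier conv_ring" by (rule conv_carrierI) (simp_all add: conv_sel(4))
  show "\<zero>\<^bsub>conv_ring\<^esub> \<oplus>\<^bsub>conv_ring\<^esub> a = a" if "a \<in> carrier conv_ring" for a
    by (simp add: conv_sel(4,5) conv_closed[OF that])
qed

lemma conv_cring: "cring conv_ring"
proof (rule cringI[OF conv_ring_abelian comm_monoidI])
  note ca = conv_closed
  have cl: "x \<otimes>\<^bsub>conv_ring\<^esub> y \<in> carrier conv_ring"
    if "x \<in> carrier conv_ring" "y \<in> carrier conv_ring" for x y
  proof (rule conv_carrierI)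
    have "(\<lambda>z. x (fst z) \<otimes> y (snd z)) \<in> decomp m \<rightarrow> carrier K" for m
      using ca[OF that(1)] ca[OF that(2)] by simp
    thus "(x \<otimes>\<^bsub>conv_ring\<^esub> y) m \<in> carrier K" for m
      unfolding conv_sel(2) by (rule K.finsum_closed)
    show "(x \<otimes>\<^bsub>conv_ring\<^esub> y) m = \<zero>" if "m \<notin> S" for m
      unfolding conv_sel(2) decomp_outside[OF that] by simp
  qed
  show "\<And>x y. \<lbrakk>x \<in> carrier conv_ring; y \<in> carrier conv_ring\<rbrakk> \<Longrightarrow> x \<otimes>\<^bsub>conv_ring\<^esub> y \<in> carrier conv_ring"
    by (rule cl)
  show one: "\<one>\<^bsub>conv_ring\<^esub> \<in> carrier conv_ring" by (rule conv_carrierI) (auto simp: conv_sel(3))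
  fix x y z assume x: "x \<in> carrier conv_ring" and y: "y \<in> carrier conv_ring" and z: "z \<in> carrier conv_ring"
  note [simp] = ca[OF x] ca[OF y] ca[OF z]
  show "\<one>\<^bsub>conv_ring\<^esub> \<otimes>\<^bsub>conv_ring\<^esub> x = x"
  proof
    fix m show "(\<one>\<^bsub>conv_ring\<^esub> \<otimes>\<^bsub>conv_ring\<^esub> x) m = x m"
    proof (cases "m \<in> S")
      case True
      have "(\<one>\<^bsub>conv_ring\<^esub> \<otimes>\<^bsub>conv_ring\<^esub> x) m =
          (\<Oplus>z\<in>decomp m. (if fst z = 0 then \<one> else \<zero>) \<otimes> x (snd z))" by (simp add: conv_sel(2,3))
      also have "\<dots> = x m"
        using True by (intro K.finsum_delta[of _ "(0, m)"]) (simp_all add: decomp_iff decomp_fst_nonzero)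
      finally show ?thesis .
    next
      case False
      thus ?thesis by (simp add: conv_sel(2) decomp_outside conv_outside[OF x])
    qed
  qed
  show "x \<otimes>\<^bsub>conv_ring\<^esub> y = y \<otimes>\<^bsub>conv_ring\<^esub> x"
  proof
    fix m
    have "(\<Oplus>z\<in>decomp m. x (fst z) \<otimes> y (snd z)) = (\<Oplus>z\<in>decomp m. x (snd z) \<otimes> y (fst z))"
      by (intro finsum_decomp_swap[where f="\<lambda>u w. x u \<otimes> y w"] K.abelian_monoid_axioms) auto
    also have "\<dots> = (\<Oplus>z\<in>decomp m. y (fst z) \<otimes> x (snd z))"
      by (intro K.finsum_cong') (auto simp: K.m_comm)
    finally show "(x \<otimes>\<^bsub>conv_ring\<^esub> y) m = (y \<otimes>\<^bsub>conv_ring\<^esub> x) m" by (simp add: conv_sel(2))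
  qed
  show "x \<otimes>\<^bsub>conv_ring\<^esub> y \<otimes>\<^bsub>conv_ring\<^esub> z = x \<otimes>\<^bsub>conv_ring\<^esub> (y \<otimes>\<^bsub>conv_ring\<^esub> z)"
  proof
    fix m
    have "(x \<otimes>\<^bsub>conv_ring\<^esub> y \<otimes>\<^bsub>conv_ring\<^esub> z) m =
        (\<Oplus>w\<in>decomp m. (\<Oplus>v\<in>decomp (fst w). x (fst v) \<otimes> y (snd v)) \<otimes> z (snd w))"
      by (simp add: conv_sel(2))
    also have "\<dots> = (\<Oplus>w\<in>decomp m. \<Oplus>v\<in>decomp (fst w). x (fst v) \<otimes> y (snd v) \<otimes> z (snd w))"
      by (intro K.finsum_cong') (auto intro!: K.finsum_ldistr K.finsum_closed)
    also have "\<dots> = (\<Oplus>w\<in>decomp m. \<Oplus>v\<in>decomp (snd w). x (fst w) \<otimes> y (fst v) \<otimes> z (snd v))"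
      by (intro finsum_decomp_assoc[where f="\<lambda>u v w. x u \<otimes> y v \<otimes> z w"] K.abelian_monoid_axioms) auto
    also have "\<dots> = (\<Oplus>w\<in>decomp m. \<Oplus>v\<in>decomp (snd w). x (fst w) \<otimes> (y (fst v) \<otimes> z (snd v)))"
      by (simp add: K.m_assoc)
    also have "\<dots> = (\<Oplus>w\<in>decomp m. x (fst w) \<otimes> (\<Oplus>v\<in>decomp (snd w). y (fst v) \<otimes> z (snd v)))"
      by (intro K.finsum_cong') (auto intro!: K.finsum_rdistr[symmetric] K.finsum_closed)
    also have "\<dots> = (x \<otimes>\<^bsub>conv_ring\<^esub> (y \<otimes>\<^bsub>conv_ring\<^esub> z)) m" by (simp add: conv_sel(2))
    finally show "(x \<otimes>\<^bsub>conv_ring\<^esub> y \<otimes>\<^bsub>conv_ring\<^esub> z) m = \<dots>" .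
  qed
  show "(x \<oplus>\<^bsub>conv_ring\<^esub> y) \<otimes>\<^bsub>conv_ring\<^esub> z = x \<otimes>\<^bsub>conv_ring\<^esub> z \<oplus>\<^bsub>conv_ring\<^esub> y \<otimes>\<^bsub>conv_ring\<^esub> z"
  proof
    fix m
    have "(\<Oplus>w\<in>decomp m. (x (fst w) \<oplus> y (fst w)) \<otimes> z (snd w)) =
        (\<Oplus>w\<in>decomp m. x (fst w) \<otimes> z (snd w) \<oplus> y (fst w) \<otimes> z (snd w))"
      by (simp add: K.l_distr)
    also have "\<dots> = (\<Oplus>w\<in>decomp m. x (fst w) \<otimes> z (snd w)) \<oplus> (\<Oplus>w\<in>decomp m. y (fst w) \<otimes> z (snd w))"
      by (intro K.finsum_addf) auto
    finally show "((x \<oplus>\<^bsub>conv_ring\<^esub> y) \<otimes>\<^bsub>conv_ring\<^esub> z) m =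
        (x \<otimes>\<^bsub>conv_ring\<^esub> z \<oplus>\<^bsub>conv_ring\<^esub> y \<otimes>\<^bsub>conv_ring\<^esub> z) m"
      by (simp add: conv_sel(2,5))
  qed
qed

sublocale R: cring conv_ring by (rule conv_cring)

lemma conv_mult: "(a \<otimes>\<^bsub>conv_ring\<^esub> b) m = (\<Oplus>z\<in>decomp m. a (fst z) \<otimes> b (snd z))"
  by (simp add: conv_sel)

lemma conv_finsum:
  assumes "finite A" "\<And>i. i \<in> A \<Longrightarrow> f i \<in> carrier conv_ring"
  shows "(\<Oplus>\<^bsub>conv_ring\<^esub>i\<in>A. f i) m = (\<Oplus>i\<in>A. f i m)"
  using assms
proof (induction A rule: finite_induct)
  case empty
  then show ?case by (simp add: conv_sel)
next
  case (insert i A)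
  have "f \<in> A \<rightarrow> carrier conv_ring" "f i \<in> carrier conv_ring" "(\<lambda>i. f i m) \<in> A \<rightarrow> carrier K" "f i m \<in> carrier K"
    using insert conv_closed by auto
  then show ?case using insert by (simp add: conv_sel(5))
qed

definition mono :: "'k \<Rightarrow> 'm \<Rightarrow> 'm \<Rightarrow> 'k"
  where "mono c u = (\<lambda>m. if m = u then c else \<zero>)"

lemma mono_closed [simp]: "c \<in> carrier K \<Longrightarrow> u \<in> S \<Longrightarrow> mono c u \<in> carrier conv_ring"
  by (intro conv_carrierI) (auto simp: mono_def)

lemma mono_one: "\<one>\<^bsub>conv_ring\<^esub> = mono \<one> 0"
  by (auto simp: conv_sel mono_def)

lemma mono_mult:
  assumes "c \<in> carrier K" "d \<in> carrier K" "u \<in> S" "w \<in> S"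
  shows "mono c u \<otimes>\<^bsub>conv_ring\<^esub> mono d w = mono (c \<otimes> d) (u + w)"
proof
  fix m show "(mono c u \<otimes>\<^bsub>conv_ring\<^esub> mono d w) m = mono (c \<otimes> d) (u + w) m"
  proof (cases "m = u + w")
    case True
    have 0: "mono c u (fst z) \<otimes> mono d w (snd z) = \<zero>" if "z \<noteq> (u, w)" for z
    proof -
      have "fst z \<noteq> u \<or> snd z \<noteq> w" using that by (metis prod.collapse)
      thus ?thesis using assms(1,2) by (auto simp: mono_def)
    qed
    have "(\<Oplus>z\<in>decomp m. mono c u (fst z) \<otimes> mono d w (snd z)) = c \<otimes> d"
      by (rule K.finsum_delta[where i="(u, w)"])
        (use assms True 0 in \<open>simp_all add: mono_def decomp_iff\<close>)
    thus ?thesis using True by (simp add: conv_mult mono_def)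
  next
    case False
    hence "(mono c u \<otimes>\<^bsub>conv_ring\<^esub> mono d w) m = (\<Oplus>z\<in>decomp m. \<zero>)"
      unfolding conv_mult using assms decomp_mem(3)[of _ m]
      by (intro K.finsum_cong') (auto simp: mono_def)
    thus ?thesis using False by (simp add: mono_def)
  qed
qed

lemma nmult_mem [simp]: "u \<in> S \<Longrightarrow> nmult n u \<in> S"
  by (induction n) (auto simp: nmult_Suc)

lemma mono_pow:
  assumes "c \<in> carrier K" "u \<in> S"
  shows "mono c u [^]\<^bsub>conv_ring\<^esub> n = mono (c [^] n) (nmult n u)"
proof (induction n)
  case 0
  then show ?case by (simp add: mono_one)
next
  case (Suc n)
  then show ?case using assms by (simp add: mono_mult nmult_Suc add.commute)
qed

text \<open>Only summands of \<open>m\<close> can enter a product that is evaluated at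
  \<open>m\<close>. Thus, to compute one coefficient of a power, a series with infinite support may
  be replaced by a finite piece of it.\<close>

lemma pow_cong_decomp:
  assumes a: "a \<in> carrier conv_ring" and b: "b \<in> carrier conv_ring"
    and eq: "\<And>u w. u \<in> S \<Longrightarrow> w \<in> S \<Longrightarrow> u + w = m \<Longrightarrow> a u = b u"
  shows "(a [^]\<^bsub>conv_ring\<^esub> (n::nat)) m = (b [^]\<^bsub>conv_ring\<^esub> n) m"
  using eq
proof (induction n arbitrary: m)
  case 0
  then show ?case by simp
next
  case (Suc n)
  have "(a [^]\<^bsub>conv_ring\<^esub> n) (fst z) \<otimes> a (snd z) = (b [^]\<^bsub>conv_ring\<^esub> n) (fst z) \<otimes> b (snd z)"
    if z: "z \<in> decomp m" for z
  proof -
    note d = decomp_mem[OF z]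
    have "a (snd z) = b (snd z)" using d Suc(2)[of "snd z" "fst z"] by (simp add: add.commute)
    moreover have "(a [^]\<^bsub>conv_ring\<^esub> n) (fst z) = (b [^]\<^bsub>conv_ring\<^esub> n) (fst z)"
    proof (rule Suc(1))
      fix u w assume "u \<in> S" "w \<in> S" "u + w = fst z"
      thus "a u = b u" using d Suc(2)[of u "w + snd z"] by (simp add: add.assoc[symmetric])
    qed
    ultimately show ?thesis by simp
  qed
  moreover have "(b [^]\<^bsub>conv_ring\<^esub> n) u \<otimes> b w \<in> carrier K" for u w
    using conv_closed[OF R.nat_pow_closed[OF b, of n]] conv_closed[OF b] by (rule K.m_closed)
  ultimately have "(\<Oplus>z\<in>decomp m. (a [^]\<^bsub>conv_ring\<^esub> n) (fst z) \<otimes> a (snd z)) =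
      (\<Oplus>z\<in>decomp m. (b [^]\<^bsub>conv_ring\<^esub> n) (fst z) \<otimes> b (snd z))"
    by (intro K.finsum_cong') auto
  thus ?case by (simp add: conv_mult)
qed

lemma conv_add_pow: "x \<in> carrier conv_ring \<Longrightarrow> ([(n::nat)] \<cdot>\<^bsub>conv_ring\<^esub> x) m = [n] \<cdot> x m"
proof (induction n)
  case 0
  then show ?case by (simp add: conv_sel(4))
next
  case (Suc n)
  have "[Suc n] \<cdot>\<^bsub>conv_ring\<^esub> x = [n] \<cdot>\<^bsub>conv_ring\<^esub> x \<oplus>\<^bsub>conv_ring\<^esub> x"
    by (rule R.add.nat_pow_Suc)
  thus ?case using Suc by (simp add: conv_sel(5))
qed

end

locale finite_field_convolution = convolution K S
  for K :: "'k ring" (structure) and S :: "'m::comm_monoid_add set" +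
  fixes p n :: nat
  assumes p: "Factorial_Ring.prime p" and fin: "finite (carrier K)" and ord: "order K = p ^ n"
    and nmult_inj: "\<And>k. k > 0 \<Longrightarrow> inj_on (nmult k) S"
begin

definition q :: nat where "q = p ^ n"

lemma card_K: "card (carrier K) = q" using ord by (simp add: order_def q_def)

lemma q_gt_1: "q > 1"
proof -
  have "{\<zero>, \<one>} \<subseteq> carrier K" using K.zero_closed K.one_closed by blast
  hence "card {\<zero>, \<one>} \<le> q" unfolding card_K[symmetric] using fin by (intro card_mono)
  thus ?thesis by simp
qed

lemma unit_pow: "x \<in> carrier K \<Longrightarrow> x \<noteq> \<zero> \<Longrightarrow> x [^] (q - 1) = \<one>"
proof -
  assume x: "x \<in> carrier K" "x \<noteq> \<zero>"
  interpret U: comm_group "units_of K" by (rule K.units_comm_group)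
  have U: "carrier (units_of K) = carrier K - {\<zero>}" using K.field_Units by (simp add: units_of_def)
  have "card (carrier (units_of K)) = q - 1" unfolding U card_K[symmetric] using fin by simp
  hence "x [^]\<^bsub>units_of K\<^esub> (q - 1) = \<one>\<^bsub>units_of K\<^esub>"
    using U.power_order_eq_one[of x] x U fin by simp
  thus ?thesis using x K.units_of_pow[of x "q - 1"] by (simp add: units_of_one K.field_Units)
qed

lemma pow_q: "x \<in> carrier K \<Longrightarrow> x [^] q = x"
proof (cases "x = \<zero>")
  case True
  thus ?thesis using q_gt_1 by (simp add: K.nat_pow_zero)
next
  case False
  assume x: "x \<in> carrier K"
  have "x [^] q = x [^] (q - 1) \<otimes> x" using q_gt_1 K.nat_pow_Suc[of x "q - 1"] by simp
  thus ?thesis using unit_pow[OF x False] x by simp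
qed

text \<open>The additive group has \<open>p^n\<close> elements, so \<open>p^n\<close> times the unit
  vanishes; this is the \<open>n\<close>-th power of \<open>p\<close> times the unit, and a field
  has no nonzero nilpotents.\<close>

lemma char_K: "x \<in> carrier K \<Longrightarrow> [p] \<cdot> x = \<zero>"
proof -
  assume x: "x \<in> carrier K"
  have "[(p ^ n)] \<cdot> \<one> = \<zero>"
    using comm_group.power_order_eq_one[OF K.a_comm_group, of \<one>] ord fin by (simp add: order_def add_pow_def)
  moreover have "[(p ^ n)] \<cdot> \<one> = ([p] \<cdot> \<one>) [^] n"
  proof (induction n)
    case (Suc n)
    have "[(p ^ Suc n)] \<cdot> \<one> = [p] \<cdot> ([(p ^ n)] \<cdot> \<one>)" by (simp add: K.add.nat_pow_pow mult.commute)
    thus ?case using Suc by (simp add: K.add_pow_rdistr)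
  qed simp
  moreover have "x [^] n \<noteq> \<zero>" if "x \<in> carrier K" "x \<noteq> \<zero>" for x and n :: nat
    using that by (induction n) (auto simp: K.integral_iff)
  ultimately have "[p] \<cdot> \<one> = \<zero>" by (metis K.add.nat_pow_closed K.one_closed)
  moreover have "[p] \<cdot> x = ([p] \<cdot> \<one>) \<otimes> x" using x by (simp add: K.add_pow_ldistr)
  ultimately show ?thesis using x by simp
qed

lemma char_conv: "x \<in> carrier conv_ring \<Longrightarrow> [p] \<cdot>\<^bsub>conv_ring\<^esub> x = \<zero>\<^bsub>conv_ring\<^esub>"
  by (rule ext) (simp add: conv_add_pow char_K conv_closed conv_sel(4))

text \<open>Frobenius is additive and fixes the scalars, since \<open>c^q = c\<close>, so
  \<open>q\<close>-th powers act on exponents alone. Additivity concerns finite sums only; hence the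
  series is first cut down to the summands of \<open>m\<close>.\<close>

lemma conv_pow_q:
  assumes a: "a \<in> carrier conv_ring"
  shows "u \<in> S \<Longrightarrow> (a [^]\<^bsub>conv_ring\<^esub> q) (nmult q u) = a u"
    and "m \<notin> nmult q ` S \<Longrightarrow> (a [^]\<^bsub>conv_ring\<^esub> q) m = \<zero>"
proof -
  note ac [simp] = conv_closed[OF a]
  have main: "(a [^]\<^bsub>conv_ring\<^esub> q) m = (\<Oplus>u\<in>fst ` decomp m. if m = nmult q u then a u else \<zero>)" for m
  proof -
    let ?A = "fst ` decomp m"
    have A: "finite ?A" "?A \<subseteq> S" by (auto simp: decomp_iff)
    define b where "b = (\<Oplus>\<^bsub>conv_ring\<^esub>u\<in>?A. mono (a u) u)"
    have mc: "mono (a u) u \<in> carrier conv_ring" if "u \<in> ?A" for u using that A by auto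
    have bc: "b \<in> carrier conv_ring" unfolding b_def by (rule R.finsum_closed) (use mc in auto)
    have b: "b v = a v" if "v \<in> ?A" for v
    proof -
      have "b v = (\<Oplus>u\<in>?A. mono (a u) u v)" unfolding b_def using mc A by (intro conv_finsum) auto
      also have "\<dots> = a v" using that A a by (intro K.finsum_delta) (auto simp: mono_def)
      finally show ?thesis .
    qed
    have "(a [^]\<^bsub>conv_ring\<^esub> q) m = (b [^]\<^bsub>conv_ring\<^esub> q) m"
    proof (rule pow_cong_decomp[OF a bc])
      fix u w assume "u \<in> S" "w \<in> S" "u + w = m"
      hence "u \<in> ?A" by (force simp: decomp_def)
      thus "a u = b u" using b by simp
    qed
    also have "b [^]\<^bsub>conv_ring\<^esub> q = (\<Oplus>\<^bsub>conv_ring\<^esub>u\<in>?A. mono (a u) u [^]\<^bsub>conv_ring\<^esub> q)"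
      unfolding b_def q_def by (rule R.frobenius_power_finsum[OF p char_conv]) (use A mc in auto)
    also have "\<dots> m = (\<Oplus>u\<in>?A. (mono (a u) u [^]\<^bsub>conv_ring\<^esub> q) m)"
      using mc A by (intro conv_finsum) auto
    also have "\<dots> = (\<Oplus>u\<in>?A. if m = nmult q u then a u else \<zero>)"
    proof -
      have "(mono (a u) u [^]\<^bsub>conv_ring\<^esub> q) m = (if m = nmult q u then a u else \<zero>)" if "u \<in> ?A" for u
        using that A(2) mono_pow[of "a u" u q] pow_q[of "a u"] by (auto simp: mono_def[of "a u" "nmult q u"])
      thus ?thesis by (intro K.finsum_cong') auto
    qed
    finally show ?thesis .
  qed
  show "(a [^]\<^bsub>conv_ring\<^esub> q) (nmult q u) = a u" if u: "u \<in> S"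
  proof -
    \<comment> \<open>The cut keeps just the summands of the exponent in question, and
      \<open>u\<close> is a summand of \<open>nmult q u\<close>.\<close>
    have "nmult q u = u + nmult (q - 1) u" using q_gt_1 nmult_Suc[of "q - 1" u] by simp
    hence "(u, nmult (q - 1) u) \<in> decomp (nmult q u)" using u by (simp add: decomp_iff)
    hence mem: "u \<in> fst ` decomp (nmult q u)" by (rule image_eqI[rotated]) simp
    have "nmult q v = nmult q u \<Longrightarrow> v \<in> S \<Longrightarrow> v = u" for v
      using nmult_inj[of q] q_gt_1 u by (auto dest: inj_onD)
    thus ?thesis unfolding main using mem a
      by (intro K.finsum_delta[of _ u]) (auto simp: decomp_iff)
  qed
  show "(a [^]\<^bsub>conv_ring\<^esub> q) m = \<zero>" if "m \<notin> nmult q ` S"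
    unfolding main using that by (intro K.add.finprod_one_eqI) (auto simp: decomp_iff)
qed

end

lemma nmult_fun: "nmult n (m :: 'a \<Rightarrow> rat) = (\<lambda>x. of_nat n * m x)"
  by (induction n) (auto simp: nmult_Suc fun_eq_iff algebra_simps)

lemma inj_nmult_fun: "n > 0 \<Longrightarrow> inj (nmult n :: ('a \<Rightarrow> rat) \<Rightarrow> _)"
  by (auto intro!: injI simp: nmult_fun fun_eq_iff)

subsection \<open>Labelled digraphs\<close>

locale labelled_digraph =
  fixes V :: "'t set" and E :: "('t \<times> 't) set" and lab :: "'t \<Rightarrow> nat"
  assumes E_V: "(s, t) \<in> E \<Longrightarrow> s \<in> V \<and> t \<in> V" and E_irrefl: "(s, t) \<in> E \<Longrightarrow> s \<noteq> t"
    and lab_ge_2: "t \<in> V \<Longrightarrow> lab t \<ge> 2"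
begin

definition vert :: "'t \<Rightarrow> 't \<Rightarrow> rat"
  where "vert s = (\<lambda>x. if x = s then 1 else 0)"

definition arc :: "'t \<Rightarrow> 't \<Rightarrow> 't \<Rightarrow> rat"
  where "arc s t = (\<lambda>x. if x = s then 1 / of_nat (lab t) else if x = t then 1 else 0)"

definition atoms :: "('t \<Rightarrow> rat) set"
  where "atoms = vert ` V \<union> {arc s t | s t. (s, t) \<in> E}"

inductive_set S :: "('t \<Rightarrow> rat) set" where
  zero: "0 \<in> S"
| step: "a \<in> atoms \<Longrightarrow> m \<in> S \<Longrightarrow> a + m \<in> S"

definition deg :: "('t \<Rightarrow> rat) \<Rightarrow> rat" where "deg m = Sum_any m"

lemma S_add: "u \<in> S \<Longrightarrow> w \<in> S \<Longrightarrow> u + w \<in> S"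
  by (induction u rule: S.induct) (auto simp: add.assoc intro: S.step)

lemma atoms_S: "a \<in> atoms \<Longrightarrow> a \<in> S"
  using S.step[OF _ S.zero, of a] by simp

lemma vert_S [simp]: "s \<in> V \<Longrightarrow> vert s \<in> S"
  and arc_S [simp]: "(s, t) \<in> E \<Longrightarrow> arc s t \<in> S"
  by (auto intro!: atoms_S simp: atoms_def)

lemma lab_pos: "(s, t) \<in> E \<Longrightarrow> (of_nat (lab t) :: rat) \<ge> 2"
  using lab_ge_2[of t] E_V[of s t] by simp

lemma atom_cases:
  assumes "a \<in> atoms"
  obtains (vert) s where "s \<in> V" "a = vert s" | (arc) s t where "(s, t) \<in> E" "a = arc s t"
  using assms by (auto simp: atoms_def)

lemma atom_nonneg: "a \<in> atoms \<Longrightarrow> a x \<ge> 0"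
  by (auto simp: atoms_def vert_def arc_def)

lemma atom_support: "a \<in> atoms \<Longrightarrow> finite {x. a x \<noteq> 0}"
  by (erule atom_cases) (auto simp: vert_def arc_def intro: finite_subset[of _ "{_, _}"])

lemma deg_vert [simp]: "deg (vert s) = 1"
  unfolding deg_def Sum_any.expand_set by (simp add: vert_def)

lemma deg_arc: "(s, t) \<in> E \<Longrightarrow> deg (arc s t) = 1 + 1 / of_nat (lab t)"
proof -
  assume st: "(s, t) \<in> E"
  have "{x. arc s t x \<noteq> 0} = {s, t}" using lab_pos[OF st] by (auto simp: arc_def)
  thus ?thesis using E_irrefl[OF st] by (simp add: deg_def Sum_any.expand_set arc_def)
qed

text \<open>Labels are at least 2 for the sake of the upper bound: one atom stays below 2 while two
  atoms together reach 2, so the degree separates atoms from proper sums.\<close>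

lemma deg_atom: "a \<in> atoms \<Longrightarrow> 1 \<le> deg a \<and> deg a \<le> 3 / 2"
proof (erule atom_cases)
  fix s t assume st: "(s, t) \<in> E" "a = arc s t"
  thus ?thesis using lab_pos[OF st(1)] by (simp add: deg_arc field_simps)
qed auto

lemma S_nonneg: "m \<in> S \<Longrightarrow> m x \<ge> 0"
  by (induction rule: S.induct) (auto simp: atom_nonneg)

lemma S_support: "m \<in> S \<Longrightarrow> finite {x. m x \<noteq> 0}"
proof (induction rule: S.induct)
  case (step a m)
  have "{x. (a + m) x \<noteq> 0} \<subseteq> {x. a x \<noteq> 0} \<union> {x. m x \<noteq> 0}" by auto
  thus ?case using step atom_support by (metis finite_Un finite_subset)
qed auto

lemma deg_0 [simp]: "deg 0 = 0"
  by (simp add: deg_def zero_fun_def)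

lemma deg_add: "finite {x. u x \<noteq> 0} \<Longrightarrow> finite {x. w x \<noteq> 0} \<Longrightarrow> deg (u + w) = deg u + deg w"
  by (simp add: deg_def plus_fun_def Sum_any.distrib)

lemma deg_add_S: "u \<in> S \<Longrightarrow> w \<in> S \<Longrightarrow> deg (u + w) = deg u + deg w"
  by (intro deg_add S_support)

lemma deg_nmult: "m \<in> S \<Longrightarrow> deg (nmult k m) = of_nat k * deg m"
  by (simp add: deg_def nmult_fun Sum_any_right_distrib S_support)

lemma deg_nonneg: "m \<in> S \<Longrightarrow> deg m \<ge> 0"
  unfolding deg_def Sum_any.expand_set by (intro sum_nonneg) (simp add: S_nonneg)

lemma deg_ge_1: "m \<in> S \<Longrightarrow> m \<noteq> 0 \<Longrightarrow> deg m \<ge> 1"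
proof (induction rule: S.induct)
  case (step a m)
  thus ?case using deg_atom[of a] deg_nonneg[of m] deg_add_S[OF atoms_S, of a m]
    by (simp add: plus_fun_def)
qed auto

lemma deg_lt_2: "m \<in> S \<Longrightarrow> m \<noteq> 0 \<Longrightarrow> deg m < 2 \<Longrightarrow> m \<in> atoms"
proof (induction rule: S.induct)
  case (step a m)
  show ?case
  proof (cases "m = 0")
    case False
    thus ?thesis using step deg_atom[of a] deg_ge_1[of m] deg_add_S[OF atoms_S, of a m]
      by (simp add: plus_fun_def)
  qed (use step in simp)
qed auto

lemma not_atom_split:
  assumes "m \<in> S" "m \<noteq> 0" "m \<notin> atoms"
  obtains u w where "u \<in> S" "w \<in> S" "u \<noteq> 0" "w \<noteq> 0" "m = u + w"
  using assms
proof (cases rule: S.cases)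
  case (step a m')
  have "a \<noteq> 0" using deg_atom[OF step(2)] by auto
  moreover have "m' \<noteq> 0" using step assms by auto
  ultimately show thesis using that[of a m'] step atoms_S by auto
qed auto

lemma coord_le_deg: "m \<in> S \<Longrightarrow> m x \<le> deg m"
proof (cases "m x = 0")
  case False
  assume m: "m \<in> S"
  have "m x \<le> (\<Sum>y\<in>{y. m y \<noteq> 0}. m y)"
    using False S_support[OF m] S_nonneg[OF m] by (intro member_le_sum) auto
  thus ?thesis by (simp add: deg_def Sum_any.expand_set)
qed (use deg_nonneg in auto)

text \<open>Peeling off one atom lowers the degree by at least 1, so induction on the degree bound
  works once finitely many atoms lie below \<open>m\<close>; such an atom has its one or two nodes
  in the finite support of \<open>m\<close>.\<close>

lemma finite_S_below:
  assumes m: "m \<in> S"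
  shows "finite {u \<in> S. (\<forall>x. u x \<le> m x) \<and> deg u < of_nat n}"
proof (induction n)
  case 0
  have "{u \<in> S. (\<forall>x. u x \<le> m x) \<and> deg u < of_nat 0} = {}" using deg_nonneg by force
  thus ?case by (simp only: finite.emptyI)
next
  case (Suc n)
  let ?B = "{x. m x \<noteq> 0}"
  let ?A = "{a \<in> atoms. \<forall>x. a x \<le> m x}"
  have "?A \<subseteq> vert ` ?B \<union> (\<lambda>(s, t). arc s t) ` (?B \<times> ?B)"
  proof
    fix a assume "a \<in> ?A"
    hence a: "a \<in> atoms" "\<And>x. a x \<le> m x" by auto
    have pos: "x \<in> ?B" if "a x > 0" for x using a(2)[of x] that by auto
    from a(1) show "a \<in> vert ` ?B \<union> (\<lambda>(s, t). arc s t) ` (?B \<times> ?B)"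
    proof (cases rule: atom_cases)
      case (vert s)
      thus ?thesis using pos[of s] by (auto simp: vert_def)
    next
      case (arc s t)
      hence "s \<in> ?B" "t \<in> ?B" using pos[of s] pos[of t] lab_pos[of s t] E_irrefl[of s t]
        by (auto simp: arc_def)
      thus ?thesis using arc by auto
    qed
  qed
  hence A: "finite ?A" by (rule finite_subset) (use S_support[OF m] in auto)
  have "{u \<in> S. (\<forall>x. u x \<le> m x) \<and> deg u < of_nat (Suc n)} \<subseteq>
      {0} \<union> (\<lambda>(a, u). a + u) ` (?A \<times> {u \<in> S. (\<forall>x. u x \<le> m x) \<and> deg u < of_nat n})"
  proof
    fix u assume "u \<in> {u \<in> S. (\<forall>x. u x \<le> m x) \<and> deg u < of_nat (Suc n)}"
    hence u: "u \<in> S" "\<And>x. u x \<le> m x" "deg u < of_nat (Suc n)" by auto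
    from u(1) show "u \<in> {0} \<union> (\<lambda>(a, u). a + u) ` (?A \<times> {u \<in> S. (\<forall>x. u x \<le> m x) \<and> deg u < of_nat n})"
    proof (cases rule: S.cases)
      case (step a u')
      have "a x \<le> m x" "u' x \<le> m x" for x
        using u(2)[of x] step atom_nonneg[of a x] S_nonneg[of u' x] by auto
      moreover have "deg u' < of_nat n"
        using u(3) step deg_atom[of a] deg_add_S[OF atoms_S, of a u'] by simp
      ultimately have "(a, u') \<in> ?A \<times> {u \<in> S. (\<forall>x. u x \<le> m x) \<and> deg u < of_nat n}" using step by auto
      moreover have "u = (\<lambda>(a, u). a + u) (a, u')" using step by simp
      ultimately show ?thesis by blast
    qed auto
  qed
  thus ?case by (rule finite_subset) (use A Suc in auto)
qed

lemma S_finite_decomposition: "finite {(u, w). u \<in> S \<and> w \<in> S \<and> u + w = m}"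
proof (cases "m \<in> S")
  case True
  obtain n where n: "deg m < of_nat n" using reals_Archimedean2[of "deg m"] by blast
  let ?B = "{u \<in> S. (\<forall>x. u x \<le> m x) \<and> deg u < of_nat n}"
  have "{(u, w). u \<in> S \<and> w \<in> S \<and> u + w = m} \<subseteq> ?B \<times> ?B"
  proof
    fix z assume "z \<in> {(u, w). u \<in> S \<and> w \<in> S \<and> u + w = m}"
    then obtain u w where z: "z = (u, w)" and uw: "u \<in> S" "w \<in> S" "m = u + w" by auto
    have d: "deg m = deg u + deg w" using uw deg_add_S by simp
    have le: "u x \<le> m x" "w x \<le> m x" for x
      using S_nonneg[of u x] S_nonneg[of w x] uw by simp_all
    show "z \<in> ?B \<times> ?B" unfolding z using uw(1,2) d n deg_nonneg[of u] deg_nonneg[of w] le by simp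
  qed
  thus ?thesis by (rule finite_subset) (use finite_S_below[OF True] in auto)
next
  case False
  hence "{(u, w). u \<in> S \<and> w \<in> S \<and> u + w = m} = {}" using S_add by auto
  thus ?thesis by (simp only: finite.emptyI)
qed

sublocale finite_decomposition S
  by unfold_locales (auto intro: S.zero S_add S_finite_decomposition)

lemma lab_arc: "(s, t) \<in> E \<Longrightarrow> nmult (lab t) (arc s t) = vert s + nmult (lab t) (vert t)"
  using lab_pos[of s t] E_irrefl[of s t] by (auto simp: nmult_fun arc_def vert_def fun_eq_iff)

end

subsection \<open>Multiplicative families on a labelled digraph\<close>

lemma (in abelian_monoid) finsum_nonzeroD:
  assumes "(\<Oplus>i\<in>A. f i) \<noteq> \<zero>"
  obtains i where "i \<in> A" "f i \<noteq> \<zero>"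
proof (rule ccontr)
  assume "\<not> thesis"
  hence "\<And>i. i \<in> A \<Longrightarrow> f i = \<zero>" using that by blast
  hence "(\<Oplus>i\<in>A. f i) = \<zero>" by (rule add.finprod_one_eqI)
  thus False using assms by simp
qed

lemma mult_less_cancel_ge_2: "(2::rat) \<le> c \<Longrightarrow> c * a < c * b \<Longrightarrow> a < b"
  by simp

lemma mult_le_cancel_ge_2: "(2::rat) \<le> c \<Longrightarrow> c * a \<le> c * b \<Longrightarrow> a \<le> b"
  by simp

text \<open>An arc is nonzero at two nodes, so an atom with one-point support is a vertex. Used to
  evaluate the ratio \<open>q^j / lab t'\<close> of two labels.\<close>

lemma (in labelled_digraph) atom_single:
  assumes a: "a \<in> atoms" and eq: "\<And>x. a x = (if x = v then c else 0)"
  shows "c = 1"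
  using a
proof (cases rule: atom_cases)
  case (vert s)
  hence "a s = 1" by (simp add: vert_def)
  thus ?thesis using eq[of s] by (simp split: if_splits)
next
  case (arc s t)
  have "a s \<noteq> 0" "a t \<noteq> 0" using lab_pos[OF arc(1)] arc(2) by (auto simp: arc_def)
  hence "s = v" "t = v" using eq[of s] eq[of t] by (auto split: if_splits)
  thus ?thesis using E_irrefl[OF arc(1)] by simp
qed

lemma (in labelled_digraph) vert_nonzero: "vert s \<noteq> 0"
  by (metis vert_def zero_fun_apply zero_neq_one)

locale digraph_convolution = labelled_digraph V E lab + K: field K
  for V :: "'t set" and E lab and K :: "'k ring" (structure) +
  fixes p n :: nat
  assumes p: "Factorial_Ring.prime p" and fin: "finite (carrier K)" and ord: "order K = p ^ n"
begin

sublocale finite_field_convolution K S p n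
  by unfold_locales (auto intro: p fin ord inj_on_subset[OF inj_nmult_fun])

lemma decomp_0: "decomp 0 = {(0, 0)}"
proof -
  have "u = 0 \<and> w = 0" if "u \<in> S" "w \<in> S" "u + w = 0" for u w
  proof -
    have "u x + w x = 0" for x using that(3) by (metis plus_fun_apply zero_fun_apply)
    hence "u x = 0 \<and> w x = 0" for x
      using S_nonneg[OF that(1), of x] S_nonneg[OF that(2), of x] by (metis add_nonneg_eq_0_iff)
    thus ?thesis by (auto simp: fun_eq_iff)
  qed
  thus ?thesis by (auto simp: decomp_def)
qed

lemma nmult_mult: "nmult (a * b) m = nmult a (nmult b (m :: 't \<Rightarrow> rat))"
  by (simp add: nmult_fun fun_eq_iff)

lemma decomp_atom:
  assumes "a \<in> atoms" "(u, w) \<in> decomp a"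
  shows "u = 0 \<or> w = 0"
proof (rule ccontr)
  assume "\<not> (u = 0 \<or> w = 0)"
  moreover have "u \<in> S" "w \<in> S" "a = u + w" using assms(2) by (auto simp: decomp_iff)
  ultimately have "deg a \<ge> 2" using deg_ge_1[of u] deg_ge_1[of w] deg_add_S[of u w] by auto
  thus False using deg_atom[OF assms(1)] by simp
qed

end

text \<open>\<open>row_finite\<close> reflects that the image of a single basis element has finite
  support. The series \<open>Phi u\<close> itself may have infinite support: the finiteness concerns
  the other index.\<close>

locale multiplicative_family = digraph_convolution V E lab K p n
  for V :: "'t set" and E lab and K :: "'k ring" (structure) and p n +
  fixes Phi :: "('t \<Rightarrow> rat) \<Rightarrow> ('t \<Rightarrow> rat) \<Rightarrow> 'k"
  assumes Phi_closed: "u \<in> S \<Longrightarrow> Phi u \<in> carrier conv_ring"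
    and Phi_0: "Phi 0 = \<one>\<^bsub>conv_ring\<^esub>"
    and Phi_add: "u \<in> S \<Longrightarrow> w \<in> S \<Longrightarrow> Phi (u + w) = Phi u \<otimes>\<^bsub>conv_ring\<^esub> Phi w"
    and row_finite: "finite {u \<in> S. Phi u m \<noteq> \<zero>}"
begin

lemma Phi_K: "u \<in> S \<Longrightarrow> Phi u m \<in> carrier K"
  by (rule conv_closed[OF Phi_closed])

lemma Phi_nmult: "u \<in> S \<Longrightarrow> Phi (nmult k u) = Phi u [^]\<^bsub>conv_ring\<^esub> k"
proof (induction k)
  case 0
  then show ?case by (simp only: nmult_0 Phi_0 R.nat_pow_0)
next
  case (Suc k)
  have "Phi (nmult (Suc k) u) = Phi u \<otimes>\<^bsub>conv_ring\<^esub> Phi (nmult k u)"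
    unfolding nmult_Suc by (rule Phi_add[OF Suc(2) nmult_mem[OF Suc(2)]])
  then show ?case using Suc Phi_closed by (simp add: R.m_comm)
qed

lemma Phi_mult_at:
  "u \<in> S \<Longrightarrow> w \<in> S \<Longrightarrow> Phi (u + w) m = (\<Oplus>z\<in>decomp m. Phi u (fst z) \<otimes> Phi w (snd z))"
  by (simp add: Phi_add conv_mult)

text \<open>A nonzero constant term would persist in all powers, hence in
  \<open>Phi (nmult k u)\<close> for every \<open>k\<close>; these infinitely many indices
  contradict \<open>row_finite\<close> at 0.\<close>

lemma Phi_at_0:
  assumes u: "u \<in> S" "u \<noteq> 0"
  shows "Phi u 0 = \<zero>"
proof (rule ccontr)
  assume nz: "Phi u 0 \<noteq> \<zero>"
  have "Phi (nmult k u) 0 \<noteq> \<zero>" for k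
  proof (induction k)
    case 0
    then show ?case by (simp only: nmult_0 Phi_0 conv_sel(3)) simp
  next
    case (Suc k)
    have "Phi (nmult (Suc k) u) 0 = Phi u 0 \<otimes> Phi (nmult k u) 0"
      using u Phi_K by (simp add: nmult_Suc Phi_mult_at decomp_0)
    thus ?case using Suc nz K.integral[OF _ Phi_K[OF u(1)] Phi_K[OF nmult_mem[OF u(1)]]] by metis
  qed
  hence "range (\<lambda>k. nmult k u) \<subseteq> {u \<in> S. Phi u 0 \<noteq> \<zero>}" using u by auto
  hence "finite (range (\<lambda>k. nmult k u))" using row_finite finite_subset by blast
  moreover obtain x where "u x \<noteq> 0" using u by (metis ext zero_fun_apply)
  hence "inj (\<lambda>k. nmult k u)" by (auto intro!: injI simp: nmult_fun fun_eq_iff)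
  ultimately show False using finite_imageD infinite_UNIV_nat by blast
qed

text \<open>Iterated Frobenius. The second part is the source of all information on arcs: an
  exponent that is shown to occur must be \<open>q^j\<close> times an element of \<open>S\<close>,
  not merely of the ambient space.\<close>

lemma Phi_q:
  assumes u: "u \<in> S"
  shows "m \<in> S \<Longrightarrow> Phi (nmult (q ^ j) u) (nmult (q ^ j) m) = Phi u m"
    and "Phi (nmult (q ^ j) u) m \<noteq> \<zero> \<Longrightarrow> \<exists>m'\<in>S. m = nmult (q ^ j) m' \<and> Phi u m' \<noteq> \<zero>"
proof -
  have step1: "Phi (nmult q u) (nmult q m) = Phi u m" if "u \<in> S" "m \<in> S" for u m
    using that conv_pow_q(1)[OF Phi_closed] by (simp add: Phi_nmult)
  have step2: "\<exists>m'\<in>S. m = nmult q m' \<and> Phi u m' \<noteq> \<zero>" if "u \<in> S" "Phi (nmult q u) m \<noteq> \<zero>" for u m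
  proof -
    have "m \<in> nmult q ` S" using that conv_pow_q(2)[OF Phi_closed] by (auto simp: Phi_nmult)
    thus ?thesis using that step1 by auto
  qed
  show "Phi (nmult (q ^ j) u) (nmult (q ^ j) m) = Phi u m" if "m \<in> S"
    using that u by (induction j) (simp_all add: nmult_mult step1 nmult_Suc)
  show "Phi (nmult (q ^ j) u) m \<noteq> \<zero> \<Longrightarrow> \<exists>m'\<in>S. m = nmult (q ^ j) m' \<and> Phi u m' \<noteq> \<zero>"
  proof (induction j arbitrary: m)
    case 0
    then show ?case using conv_outside[OF Phi_closed[OF u]] by (intro bexI[of _ m]) (auto simp: nmult_Suc)
  next
    case (Suc j)
    have "Phi (nmult q (nmult (q ^ j) u)) m \<noteq> \<zero>" using Suc(2) by (simp add: nmult_mult)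
    then obtain m' where "m' \<in> S" "m = nmult q m'" "Phi (nmult (q ^ j) u) m' \<noteq> \<zero>"
      using step2[OF nmult_mem[OF u]] by blast
    thus ?case using Suc(1) by (fastforce simp: nmult_mult)
  qed
qed

end

text \<open>
  \<open>Phi u m\<close> is the coefficient of the basis element \<open>u\<close> in the image of the basis element \<open>m\<close> under a
  coalgebra automorphism, and \<open>Psi\<close> is the same for the inverse. The last two assumptions are all that
  is needed of the fact that the two infinite matrices are inverse to each other.
\<close>

locale inverse_families = multiplicative_family V E lab K p n Phi + Psi: multiplicative_family V E lab K p n Psi
  for V :: "'t set" and E lab and K :: "'k ring" (structure) and p n Phi Psi +
  assumes inv1: "y \<in> S \<Longrightarrow> \<exists>m\<in>S. Psi m y \<noteq> \<zero> \<and> Phi y m \<noteq> \<zero>"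
    and inv2: "y \<in> S \<Longrightarrow> \<exists>m\<in>S. Phi m y \<noteq> \<zero> \<and> Psi y m \<noteq> \<zero>"
begin

text \<open>If the index \<open>m\<close> from \<open>inv1\<close> were a proper sum,
  \<open>Psi m\<close> would be a product of two series without constant term, and such a product
  vanishes at every atom because an atom has only trivial splittings.\<close>

lemma Phi_atom_witness:
  assumes y: "y \<in> atoms"
  obtains a where "a \<in> atoms" "Phi y a \<noteq> \<zero>" "Psi a y \<noteq> \<zero>"
proof -
  have yS: "y \<in> S" "y \<noteq> 0" using y atoms_S deg_atom[OF y] by auto
  obtain m where m: "m \<in> S" "Psi m y \<noteq> \<zero>" "Phi y m \<noteq> \<zero>" using inv1[OF yS(1)] by auto
  have "m \<noteq> 0" using m Phi_at_0[OF yS] by auto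
  moreover have "m \<in> atoms"
  proof (rule ccontr)
    assume "m \<notin> atoms"
    then obtain u w where uw: "u \<in> S" "w \<in> S" "u \<noteq> 0" "w \<noteq> 0" "m = u + w"
      using not_atom_split m(1) \<open>m \<noteq> 0\<close> by metis
    have "(\<Oplus>z\<in>decomp y. Psi u (fst z) \<otimes> Psi w (snd z)) \<noteq> \<zero>"
      using m(2) uw by (simp add: Psi.Phi_mult_at)
    then obtain z where z: "z \<in> decomp y" "Psi u (fst z) \<otimes> Psi w (snd z) \<noteq> \<zero>"
      by (rule K.finsum_nonzeroD)
    have "fst z = 0 \<or> snd z = 0" using decomp_atom[OF y, of "fst z" "snd z"] z(1) by simp
    thus False using z(2) uw Psi.Phi_at_0 Psi.Phi_K by auto
  qed
  ultimately show thesis using that m by blast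
qed

section \<open>Comparing supports along an arc of label \<open>q^j\<close>\<close>

context
  fixes s t :: 't and j :: nat
  assumes st: "(s, t) \<in> E" and lab: "lab t = q ^ j" and j: "j \<ge> 1"
begin

lemma Q_ge_2: "(2::rat) \<le> of_nat (q ^ j)"
  using lab_pos[OF st] lab by simp

lemma product_at:
  "Phi (nmult (q ^ j) (arc s t)) m = (\<Oplus>z\<in>decomp m. Phi (vert s) (fst z) \<otimes> Phi (nmult (q ^ j) (vert t)) (snd z))"
  using lab_arc[OF st] lab E_V[OF st] by (simp add: Phi_mult_at)

lemma product_term:
  assumes "Phi (nmult (q ^ j) (arc s t)) m \<noteq> \<zero>"
  obtains w u where "w \<in> S" "u \<in> S" "w + nmult (q ^ j) u = m" "Phi (vert s) w \<noteq> \<zero>"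
    "Phi (vert t) u \<noteq> \<zero>" "w \<noteq> 0" "u \<noteq> 0"
proof -
  have V: "vert s \<in> S" "vert t \<in> S" "vert s \<noteq> 0" "vert t \<noteq> 0"
    using E_V[OF st] vert_nonzero by auto
  obtain z where z: "z \<in> decomp m" "Phi (vert s) (fst z) \<otimes> Phi (nmult (q ^ j) (vert t)) (snd z) \<noteq> \<zero>"
    using assms unfolding product_at by (rule K.finsum_nonzeroD)
  have nz: "Phi (vert s) (fst z) \<noteq> \<zero>" "Phi (nmult (q ^ j) (vert t)) (snd z) \<noteq> \<zero>"
    using z(2) Phi_K V by auto
  obtain u where u: "u \<in> S" "snd z = nmult (q ^ j) u" "Phi (vert t) u \<noteq> \<zero>"
    using Phi_q(2)[OF V(2) nz(2)] by auto
  have "fst z \<noteq> 0" "u \<noteq> 0" using u nz Phi_at_0[OF V(1,3)] Phi_at_0[OF V(2,4)] by metis+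
  thus thesis
    using that[of "fst z" u] decomp_mem[OF z(1)] u nz by simp
qed

text \<open>
  An atom occurring in the image of the arc monomial must itself be an arc: comparing \<open>q\<^sup>j\<close>-th
  powers, a vertex cannot be split into two nonzero summands.
\<close>

lemma arc_witness:
  obtains v t' where "(v, t') \<in> E" "Phi (vert t) (vert t') \<noteq> \<zero>" "lab t' \<le> q ^ j"
proof -
  let ?Q = "of_nat (q ^ j) :: rat"
  have "arc s t \<in> atoms" using st by (auto simp: atoms_def)
  then obtain a where a: "a \<in> atoms" "Phi (arc s t) a \<noteq> \<zero>" using Phi_atom_witness by metis
  have "Phi (nmult (q ^ j) (arc s t)) (nmult (q ^ j) a) \<noteq> \<zero>"
    using a st by (simp add: Phi_q(1) atoms_S)
  then obtain w u where w: "w \<in> S" "u \<in> S" "w + nmult (q ^ j) u = nmult (q ^ j) a"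
      "Phi (vert s) w \<noteq> \<zero>" "Phi (vert t) u \<noteq> \<zero>" "w \<noteq> 0" "u \<noteq> 0" by (rule product_term)
  have Q: "?Q \<ge> 2" by (rule Q_ge_2)
  have co: "w x = ?Q * (a x - u x)" for x
  proof -
    have "(w + nmult (q ^ j) u) x = nmult (q ^ j) a x" using w(3) by simp
    thus ?thesis by (simp add: nmult_fun algebra_simps)
  qed
  have le: "u x \<le> a x" for x
  proof -
    have "0 \<le> ?Q * (a x - u x)" using S_nonneg[OF w(1), of x] co by simp
    thus ?thesis using Q by (simp add: zero_le_mult_iff)
  qed
  have d: "deg w = ?Q * (deg a - deg u)"
  proof -
    have "deg (w + nmult (q ^ j) u) = deg (nmult (q ^ j) a)" using w(3) by simp
    moreover have "deg (w + nmult (q ^ j) u) = deg w + ?Q * deg u"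
      using w(1,2) by (simp add: deg_add_S deg_nmult)
    moreover have "deg (nmult (q ^ j) a) = ?Q * deg a" using a atoms_S by (simp add: deg_nmult)
    ultimately show ?thesis by (simp only: right_diff_distrib)
  qed
  have "deg w \<ge> 1" "deg u \<ge> 1" using w deg_ge_1 by auto
  hence "?Q * 0 < ?Q * (deg a - deg u)" using d by linarith
  hence "deg a - deg u > 0" by (rule mult_less_cancel_ge_2[OF Q])
  hence du: "deg u < 3 / 2" using deg_atom[OF a(1)] by linarith
  hence ua: "u \<in> atoms" using w deg_lt_2[of u] by simp
  from a(1) show thesis
  proof (cases rule: atom_cases)
    case (vert v)
    thus ?thesis using \<open>deg a - deg u > 0\<close> \<open>deg u \<ge> 1\<close> by simp
  next
    case (arc v t')
    note l = lab_pos[OF arc(1)] and ne = E_irrefl[OF arc(1)]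
    have half: "1 / (of_nat (lab t') :: rat) \<le> 1 / 2" using l by (simp add: field_simps)
    \<comment> \<open>Every atom has the coordinate 1 at its vertex or at the head of the arc. As
      \<open>u\<close> lies below \<open>a\<close>, that node of \<open>u\<close> can only be
      \<open>t'\<close>.\<close>
    have a1: "a x < 1" if "x \<noteq> t'" for x using that half arc by (auto simp: arc_def)
    have "u = vert t'"
      using ua
    proof (cases rule: atom_cases)
      case (vert r)
      have "r = t'" using a1[of r] le[of r] vert by (auto simp: vert_def)
      thus ?thesis using vert by simp
    next
      case u: (arc r t'')
      have "t'' = t'" using a1[of t''] le[of t''] u E_irrefl[OF u(1)] by (auto simp: arc_def)
      hence "deg u = deg a" using u arc by (simp add: deg_arc)
      thus ?thesis using \<open>deg a - deg u > 0\<close> by simp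
    qed
    \<comment> \<open>\<open>w\<close> is nonzero of degree \<open>q^j / lab t'\<close>, while
      nonzero elements of \<open>S\<close> have degree at least 1.\<close>
    moreover have "lab t' \<le> q ^ j"
    proof -
      have "deg w = ?Q / of_nat (lab t')" using d arc \<open>u = vert t'\<close> by (simp add: deg_arc)
      hence "(of_nat (lab t') :: rat) \<le> ?Q"
        using \<open>deg w \<ge> 1\<close> l le_divide_eq_1_pos[of "of_nat (lab t')" ?Q] by linarith
      thus ?thesis by (simp only: of_nat_le_iff)
    qed
    ultimately show ?thesis using that[OF arc(1)] w by simp
  qed
qed

text \<open>At \<open>m = w + q^j e\<close>, with \<open>e = vert t'\<close>, the product of
  \<open>Phi (vert s)\<close> and the \<open>q^j\<close>-th power of \<open>Phi (vert t)\<close>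
  receives a single nonzero term. So no cancellation occurs, \<open>m\<close> is \<open>q^j\<close>
  times an element of \<open>S\<close>, and \<open>deg w < q^j\<close> makes that element an atom.
  The only rival term has an arc into \<open>t'\<close> in place of \<open>vert t'\<close>. The
  hypothesis \<open>small\<close> excludes it in two ways: the bound 2 starts the argument off, and
  the vanishing at arcs, obtained from that first round, serves \<open>w\<close> of larger
  degree.\<close>

lemma support_shape:
  assumes t': "t' \<in> V" and \<alpha>: "Phi (vert t) (vert t') \<noteq> \<zero>" and lt': "lab t' \<le> q ^ j"
    and w: "w \<in> S" "Phi (vert s) w \<noteq> \<zero>" "deg w < of_nat (q ^ j)"
    and small: "deg w < 2 \<or> (\<forall>r. (r, t') \<in> E \<longrightarrow> Phi (vert t) (arc r t') = \<zero>)"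
  obtains v where "(v, t') \<in> E" "w = (\<lambda>x. if x = v then of_nat (q ^ j) / of_nat (lab t') else 0)"
proof -
  let ?Q = "of_nat (q ^ j) :: rat"
  have Q: "?Q \<ge> 2" by (rule Q_ge_2)
  have VS: "vert s \<in> S" "vert t \<in> S" using E_V[OF st] by auto
  have w0: "w \<noteq> 0" using w(2) Phi_at_0[OF VS(1) vert_nonzero] by auto
  define m where "m = w + nmult (q ^ j) (vert t')"
  have uniq: "z = (w, nmult (q ^ j) (vert t'))"
    if z: "z \<in> decomp m" and nz: "Phi (vert s) (fst z) \<otimes> Phi (nmult (q ^ j) (vert t)) (snd z) \<noteq> \<zero>" for z
  proof -
    have nz1: "Phi (vert s) (fst z) \<noteq> \<zero>" and nz2: "Phi (nmult (q ^ j) (vert t)) (snd z) \<noteq> \<zero>"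
      using nz Phi_K VS by auto
    obtain u where u: "u \<in> S" "snd z = nmult (q ^ j) u" "Phi (vert t) u \<noteq> \<zero>"
      using Phi_q(2)[OF VS(2) nz2] by auto
    note dz = decomp_mem[OF z]
    have z0: "fst z \<noteq> 0" using nz1 Phi_at_0[OF VS(1) vert_nonzero] by auto
    have u0: "u \<noteq> 0" using u(3) Phi_at_0[OF VS(2) vert_nonzero] by auto
    have d: "deg (fst z) + ?Q * deg u = deg w + ?Q"
    proof -
      have "deg (fst z + nmult (q ^ j) u) = deg (w + nmult (q ^ j) (vert t'))"
        using dz(3) u(2) by (simp add: m_def)
      thus ?thesis using dz u t' w by (simp add: deg_add_S deg_nmult)
    qed
    have co: "?Q * u x \<le> w x + ?Q * (vert t' x)" for x
    proof -
      have "(fst z + nmult (q ^ j) u) x = (w + nmult (q ^ j) (vert t')) x"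
        using dz(3) u(2) by (simp add: m_def)
      thus ?thesis using S_nonneg[OF dz(1), of x] by (simp add: nmult_fun)
    qed
    have wlt: "w x < ?Q" for x using coord_le_deg[OF w(1), of x] w(3) by simp
    have "?Q * deg u < ?Q * 2" using d w(3) deg_ge_1[OF dz(1) z0] by linarith
    hence "deg u < 2" by (rule mult_less_cancel_ge_2[OF Q])
    hence "u \<in> atoms" using deg_lt_2 u(1) u0 by blast
    hence "u = vert t'"
    proof (cases rule: atom_cases)
      case (vert r)
      have "r = t'" using co[of r] wlt[of r] vert by (auto simp: vert_def split: if_splits)
      thus ?thesis using vert by simp
    next
      case (arc r t'')
      have "arc r t'' t'' = 1" using E_irrefl[OF arc(1)] by (simp add: arc_def)
      hence t: "t'' = t'" using co[of t''] wlt[of t''] arc by (auto simp: vert_def split: if_splits)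
      hence "\<not> (\<forall>r. (r, t') \<in> E \<longrightarrow> Phi (vert t) (arc r t') = \<zero>)" using arc u(3) by auto
      hence "deg w < 2" using small by blast
      \<comment> \<open>An arc in place of \<open>vert t'\<close> takes the degree
        \<open>q^j / lab t'\<close>, at least 1, away from the first factor; from
        \<open>deg w < 2\<close> less than 1 would remain.\<close>
      moreover have "?Q / of_nat (lab t') \<ge> 1"
      proof -
        have "(of_nat (lab t') :: rat) \<le> ?Q" using lt' by (simp only: of_nat_le_iff)
        thus ?thesis using lab_pos[OF arc(1)] t by (simp add: field_simps)
      qed
      moreover have "deg u = 1 + 1 / of_nat (lab t')" using arc t by (simp add: deg_arc)
      hence "?Q * deg u = ?Q + ?Q / of_nat (lab t')" by (simp add: algebra_simps)
      ultimately have "deg (fst z) < 1" using d by linarith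
      thus ?thesis using deg_ge_1[OF dz(1) z0] by simp
    qed
    thus ?thesis using dz(3) u(2) by (cases z) (simp add: m_def)
  qed
  have mem: "(w, nmult (q ^ j) (vert t')) \<in> decomp m"
    using w t' by (simp add: decomp_iff m_def)
  have val: "Phi (nmult (q ^ j) (vert t)) (nmult (q ^ j) (vert t')) = Phi (vert t) (vert t')"
    using VS t' by (simp add: Phi_q(1))
  have "Phi (nmult (q ^ j) (arc s t)) m = Phi (vert s) w \<otimes> Phi (vert t) (vert t')"
    unfolding product_at
  proof (rule K.finsum_delta[OF _ mem])
    show "Phi (vert s) w \<otimes> Phi (vert t) (vert t') \<in> carrier K" using VS Phi_K by simp
    show "Phi (vert s) (fst z) \<otimes> Phi (nmult (q ^ j) (vert t)) (snd z) = \<zero>"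
      if "z \<in> decomp m" "z \<noteq> (w, nmult (q ^ j) (vert t'))" for z
      using uniq that by blast
  qed (simp_all add: val)
  hence "Phi (nmult (q ^ j) (arc s t)) m \<noteq> \<zero>"
    using w \<alpha> VS Phi_K by (simp add: K.integral_iff)
  then obtain m' where m': "m' \<in> S" "m = nmult (q ^ j) m'"
    using Phi_q(2)[OF arc_S[OF st]] by blast
  have co: "?Q * m' x = w x + ?Q * vert t' x" for x
  proof -
    have "nmult (q ^ j) m' x = (w + nmult (q ^ j) (vert t')) x" using m'(2) by (simp add: m_def)
    thus ?thesis by (simp add: nmult_fun)
  qed
  have "deg (nmult (q ^ j) m') = deg (w + nmult (q ^ j) (vert t'))" using m'(2) by (simp add: m_def)
  hence d: "?Q * deg m' = deg w + ?Q" using m'(1) w t' by (simp add: deg_add_S deg_nmult)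
  \<comment> \<open>Degree strictly between 1 and 2 means an atom that is not a vertex.\<close>
  hence "?Q * deg m' < ?Q * 2" "?Q * deg m' > ?Q * 1" using w(3) deg_ge_1[OF w(1) w0] by linarith+
  hence "deg m' < 2" "deg m' > 1" using mult_less_cancel_ge_2[OF Q] by blast+
  moreover from this have "m' \<noteq> 0" by (metis deg_0 not_one_less_zero)
  ultimately have "m' \<in> atoms" using deg_lt_2[OF m'(1)] by blast
  thus thesis
  proof (cases rule: atom_cases)
    case (vert r)
    thus ?thesis using \<open>deg m' > 1\<close> by simp
  next
    case (arc v t'')
    note l = lab_pos[OF arc(1)] and ne = E_irrefl[OF arc(1)]
    have half: "1 / (of_nat (lab t'') :: rat) \<le> 1 / 2" using l by (simp add: field_simps)
    have "?Q * m' t' \<ge> ?Q * 1" using co[of t'] S_nonneg[OF w(1), of t'] by (simp add: vert_def)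
    hence "m' t' \<ge> 1" by (rule mult_le_cancel_ge_2[OF Q])
    hence t: "t'' = t'" using arc half by (auto simp: arc_def split: if_splits)
    have "w x = (if x = v then ?Q / of_nat (lab t') else 0)" for x
      using co[of x] arc t ne by (auto simp: arc_def vert_def split: if_splits)
    thus ?thesis using that[of v] arc t by (auto simp: fun_eq_iff)
  qed
qed

end

end

section \<open>Supports on vertices and preservation of arcs\<close>

locale rigid_families = inverse_families V E lab K p n Phi Psi
  for V :: "'t set" and E lab and K :: "'k ring" (structure) and p n Phi Psi +
  assumes many_arcs: "s \<in> V \<Longrightarrow> \<exists>t j. (s, t) \<in> E \<and> lab t = q ^ j \<and> j > N"
begin

text \<open>\<open>support_shape\<close> with its bound 2 yields a vertex multiplied by
  \<open>q^j / lab t'\<close>, a factor that does not depend on \<open>w\<close>. Some atom lies in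
  the support by \<open>Phi_atom_witness\<close>; it has the same form, and
  \<open>atom_single\<close> then shows the factor to be 1.\<close>

lemma low_support:
  assumes s: "s \<in> V" and w: "w \<in> S" "Phi (vert s) w \<noteq> \<zero>" "deg w < 2"
  shows "w \<in> vert ` V"
proof -
  obtain t j where t: "(s, t) \<in> E" "lab t = q ^ j" "j \<ge> 1" using many_arcs[OF s, of 0] by auto
  obtain u t' where t': "(u, t') \<in> E" "Phi (vert t) (vert t') \<noteq> \<zero>" "lab t' \<le> q ^ j"
    using arc_witness[OF t] by metis
  have Q: "(2::rat) \<le> of_nat (q ^ j)" by (rule Q_ge_2[OF t])
  have shape: "\<exists>v. (v, t') \<in> E \<and> w = (\<lambda>x. if x = v then of_nat (q ^ j) / of_nat (lab t') else 0)"
    if "w \<in> S" "Phi (vert s) w \<noteq> \<zero>" "deg w < 2" for w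
    using support_shape[OF t _ t'(2,3) that(1,2)] that Q E_V[OF t'(1)] by (metis less_le_trans)
  have "vert s \<in> atoms" using s by (auto simp: atoms_def)
  then obtain a where a: "a \<in> atoms" "Phi (vert s) a \<noteq> \<zero>" using Phi_atom_witness by metis
  have "deg a < 2" using deg_atom[OF a(1)] by simp
  then obtain v where v: "(v, t') \<in> E" "a = (\<lambda>x. if x = v then of_nat (q ^ j) / of_nat (lab t') else 0)"
    using shape[OF atoms_S[OF a(1)] a(2)] by auto
  have k: "of_nat (q ^ j) / of_nat (lab t') = (1::rat)"
    by (rule atom_single[OF a(1)]) (simp only: v(2))
  obtain v where "(v, t') \<in> E" "w = (\<lambda>x. if x = v then of_nat (q ^ j) / of_nat (lab t') else 0)"
    using shape[OF w] by auto
  hence "(v, t') \<in> E" "w = vert v" unfolding k vert_def by auto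
  thus ?thesis using E_V by blast
qed

lemma arc_not_vert:
  assumes st: "(s, t) \<in> E"
  shows "arc s t \<noteq> vert v"
proof
  assume "arc s t = vert v"
  hence "deg (arc s t) = 1" by simp
  thus False using deg_arc[OF st] lab_pos[OF st] by simp
qed

text \<open>Now \<open>j\<close> is chosen after \<open>w\<close>, so that \<open>q^j\<close>
  exceeds \<open>deg w\<close>. The second alternative of \<open>small\<close> is available, since
  \<open>low_support\<close> at \<open>t\<close> leaves no arcs in the support of
  \<open>Phi (vert t)\<close>.\<close>

lemma support_vert:
  assumes s: "s \<in> V" and w: "w \<in> S" "Phi (vert s) w \<noteq> \<zero>"
  shows "w \<in> vert ` V"
proof -
  obtain N where N: "deg w < of_nat N" using reals_Archimedean2 by blast
  obtain t j where t: "(s, t) \<in> E" "lab t = q ^ j" "j > N" using many_arcs[OF s, of N] by blast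
  have "N < q ^ j" using t(3) less_exp[of j] power_mono[of 2 q j] q_gt_1 by linarith
  hence "(of_nat N :: rat) < of_nat (q ^ j)" by (simp only: of_nat_less_iff)
  hence d: "deg w < of_nat (q ^ j)" using N by linarith
  have j: "j \<ge> 1" using t by simp
  obtain u t' where t': "(u, t') \<in> E" "Phi (vert t) (vert t') \<noteq> \<zero>" "lab t' \<le> q ^ j"
    using arc_witness[OF t(1,2) j] by metis
  have none: "\<forall>r. (r, t') \<in> E \<longrightarrow> Phi (vert t) (arc r t') = \<zero>"
  proof (intro allI impI, rule ccontr)
    fix r assume r: "(r, t') \<in> E" "Phi (vert t) (arc r t') \<noteq> \<zero>"
    have "deg (arc r t') < 2" using deg_atom[of "arc r t'"] r by (force simp: atoms_def)
    hence "arc r t' \<in> vert ` V" using low_support[OF _ arc_S[OF r(1)] r(2)] E_V[OF t(1)] by simp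
    thus False using arc_not_vert[OF r(1)] by auto
  qed
  note shape = support_shape[OF t(1,2) j _ t'(2,3)]
  obtain v where v: "(v, t') \<in> E" "w = (\<lambda>x. if x = v then of_nat (q ^ j) / of_nat (lab t') else 0)"
    using shape[OF _ w d] none E_V[OF t'(1)] by metis
  have "vert s \<in> atoms" using s by (auto simp: atoms_def)
  then obtain a where a: "a \<in> atoms" "Phi (vert s) a \<noteq> \<zero>" using Phi_atom_witness by metis
  have a2: "deg a < 2" using deg_atom[OF a(1)] by simp
  then obtain c where c: "a = vert c" using low_support[OF s atoms_S[OF a(1)] a(2)] by auto
  have "deg a < of_nat (q ^ j)" using a2 Q_ge_2[OF t(1,2) j] by linarith
  then obtain v' where v': "(v', t') \<in> E" "a = (\<lambda>x. if x = v' then of_nat (q ^ j) / of_nat (lab t') else 0)"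
    using shape[OF _ atoms_S[OF a(1)] a(2)] none E_V[OF t'(1)] by metis
  have k: "of_nat (q ^ j) / of_nat (lab t') = (1::rat)"
    by (rule atom_single[OF a(1)]) (simp only: v'(2))
  have "w = vert v" using v(2) unfolding k vert_def .
  thus ?thesis using E_V[OF v(1)] by blast
qed

text \<open>A set rather than a single node, since \<open>Phi (vert s)\<close> may still be a
  combination of several vertices. That it has one element depends on the digraph.\<close>

definition targets :: "'t \<Rightarrow> 't set"
  where "targets s = {v \<in> V. Phi (vert s) (vert v) \<noteq> \<zero>}"

lemma targets_witness:
  assumes "s \<in> V"
  obtains v where "v \<in> targets s" "Psi (vert v) (vert s) \<noteq> \<zero>"
proof -
  have "vert s \<in> atoms" using assms by (auto simp: atoms_def)
  then obtain a where a: "a \<in> atoms" "Phi (vert s) a \<noteq> \<zero>" "Psi a (vert s) \<noteq> \<zero>"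
    by (rule Phi_atom_witness)
  obtain v where v: "v \<in> V" "a = vert v" using support_vert[OF assms atoms_S[OF a(1)] a(2)] by auto
  show thesis
  proof (rule that)
    show "v \<in> targets s" using a(2) v unfolding targets_def by simp
    show "Psi (vert v) (vert s) \<noteq> \<zero>" using a(3) v by simp
  qed
qed

text \<open>With supports known to consist of vertices, the exponent \<open>e_v + q^j e_r\<close>
  arises from one pair only, so its coefficient is a product of two nonzero scalars. Divided by
  \<open>q^j\<close> it must be an element of \<open>S\<close> of degree between 1 and 2, hence an
  arc, and the coordinates identify it.\<close>

lemma targets_arc:
  assumes st: "(s, t) \<in> E" and lab: "lab t = q ^ j" and j: "j \<ge> 1"
    and v: "v \<in> targets s" and r: "r \<in> targets t"
  shows "(v, r) \<in> E" "lab r = lab t"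
proof -
  let ?Q = "of_nat (q ^ j) :: rat"
  note sV = E_V[OF st]
  have vr: "v \<in> V" "r \<in> V" "Phi (vert s) (vert v) \<noteq> \<zero>" "Phi (vert t) (vert r) \<noteq> \<zero>"
    using v r by (simp_all add: targets_def)
  have Q: "?Q \<ge> 2" by (rule Q_ge_2[OF st lab j])
  define m where "m = vert v + nmult (q ^ j) (vert r)"
  have mem: "(vert v, nmult (q ^ j) (vert r)) \<in> decomp m"
    unfolding decomp_iff m_def using vr(1,2) by (intro conjI vert_S nmult_mem refl)
  have val: "Phi (nmult (q ^ j) (vert t)) (nmult (q ^ j) (vert r)) = Phi (vert t) (vert r)"
    using sV vr(2) by (intro Phi_q(1) vert_S) auto
  have uniq: "z = (vert v, nmult (q ^ j) (vert r))"
    if z: "z \<in> decomp m" and nz: "Phi (vert s) (fst z) \<otimes> Phi (nmult (q ^ j) (vert t)) (snd z) \<noteq> \<zero>" for z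
  proof -
    have nz1: "Phi (vert s) (fst z) \<noteq> \<zero>" and nz2: "Phi (nmult (q ^ j) (vert t)) (snd z) \<noteq> \<zero>"
      using nz Phi_K sV by auto
    obtain u where u: "u \<in> S" "snd z = nmult (q ^ j) u" "Phi (vert t) u \<noteq> \<zero>"
      using Phi_q(2)[OF vert_S nz2] sV by auto
    note dz = decomp_mem[OF z]
    obtain v' where v': "fst z = vert v'" using support_vert[OF _ dz(1) nz1] sV by auto
    obtain r' where r': "u = vert r'" using support_vert[OF _ u(1) u(3)] sV by auto
    have "vert v' + nmult (q ^ j) (vert r') = vert v + nmult (q ^ j) (vert r)"
      using dz(3) u(2) v' r' by (simp add: m_def)
    hence eq: "vert v' x + ?Q * vert r' x = vert v x + ?Q * vert r x" for x
      by (simp add: nmult_fun fun_eq_iff)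
    \<comment> \<open>Away from \<open>r\<close> the coordinates of \<open>e_v + q^j e_r\<close> are
      at most 1, whereas \<open>q^j\<close> is at least 2.\<close>
    have "r' = r"
    proof (rule ccontr)
      assume "r' \<noteq> r"
      hence "vert v' r' + ?Q = vert v r'" using eq[of r'] by (simp add: vert_def)
      thus False using Q by (auto simp only: vert_def split: if_splits)
    qed
    moreover from this have "v' = v" using eq[of v'] by (auto simp: vert_def split: if_splits)
    ultimately show ?thesis using v' r' u by (cases z) simp
  qed
  have "Phi (nmult (q ^ j) (arc s t)) m = Phi (vert s) (vert v) \<otimes> Phi (vert t) (vert r)"
    unfolding product_at[OF st lab j]
  proof (rule K.finsum_delta[OF _ mem])
    show "Phi (vert s) (vert v) \<otimes> Phi (vert t) (vert r) \<in> carrier K" using sV Phi_K by simp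
    show "Phi (vert s) (fst z) \<otimes> Phi (nmult (q ^ j) (vert t)) (snd z) = \<zero>"
      if "z \<in> decomp m" "z \<noteq> (vert v, nmult (q ^ j) (vert r))" for z
      using uniq that by blast
  qed (simp_all add: val)
  hence "Phi (nmult (q ^ j) (arc s t)) m \<noteq> \<zero>"
    using vr sV Phi_K by (simp add: K.integral_iff)
  then obtain m' where m': "m' \<in> S" "m = nmult (q ^ j) m'"
    using Phi_q(2)[OF arc_S[OF st]] by blast
  have co: "?Q * m' x = vert v x + ?Q * vert r x" for x
  proof -
    have "nmult (q ^ j) m' x = (vert v + nmult (q ^ j) (vert r)) x" using m'(2) by (simp add: m_def)
    thus ?thesis by (simp add: nmult_fun)
  qed
  have "deg (nmult (q ^ j) m') = deg (vert v + nmult (q ^ j) (vert r))" using m'(2) by (simp add: m_def)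
  hence d: "?Q * deg m' = 1 + ?Q" using m'(1) vr by (simp add: deg_add_S deg_nmult)
  hence "?Q * deg m' < ?Q * 2" "?Q * deg m' > ?Q * 1" using Q by linarith+
  hence "deg m' < 2" "deg m' > 1" using mult_less_cancel_ge_2[OF Q] by blast+
  moreover from this have "m' \<noteq> 0" by (metis deg_0 not_one_less_zero)
  ultimately have "m' \<in> atoms" using deg_lt_2[OF m'(1)] by blast
  hence "(v, r) \<in> E \<and> lab r = lab t"
  proof (cases rule: atom_cases)
    case (vert c)
    thus ?thesis using \<open>deg m' > 1\<close> by simp
  next
    case (arc c d)
    note l = lab_pos[OF arc(1)] and ne = E_irrefl[OF arc(1)]
    have half: "1 / (of_nat (lab d) :: rat) \<le> 1 / 2" using l by (simp add: field_simps)
    have "?Q * m' r \<ge> ?Q * 1" using co[of r] by (simp add: vert_def)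
    hence "m' r \<ge> 1" by (rule mult_le_cancel_ge_2[OF Q])
    hence t: "d = r" using arc half by (auto simp: arc_def split: if_splits)
    have c: "?Q * (1 / of_nat (lab r)) = vert v c" using co[of c] arc t ne by (simp add: arc_def vert_def)
    have Qp: "0 < ?Q" using Q by linarith
    have lp: "0 < (of_nat (lab r) :: rat)" using l unfolding t by linarith
    have cv: "c = v"
    proof (rule ccontr)
      assume "c \<noteq> v"
      hence "vert v c = 0" by (simp add: vert_def)
      thus False using c mult_pos_pos[OF Qp divide_pos_pos[OF zero_less_one lp]] by linarith
    qed
    have "?Q * (1 / of_nat (lab r)) = 1" using c unfolding cv by (simp only: vert_def simp_thms if_True)
    hence "?Q * (1 / of_nat (lab r)) * of_nat (lab r) = 1 * of_nat (lab r)" by (simp only:)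
    moreover have "?Q * (1 / of_nat (lab r)) * of_nat (lab r) = ?Q" using lp by simp
    ultimately have "?Q = of_nat (lab r)" by linarith
    hence "lab r = q ^ j" unfolding of_nat_eq_iff by (rule sym)
    thus ?thesis using arc t lab cv by simp
  qed
  thus "(v, r) \<in> E" "lab r = lab t" by auto
qed

end

lemma dvd_power_minus_1: "(q::nat) > 1 \<Longrightarrow> q - 1 dvd q ^ k - 1"
  using power_diff_1_eq[of "int q" k] by (metis diff_is_0_eq' dvd_0_right dvd_triv_left int_dvd_int_iff
    int_ops(2) nat_less_le of_nat_diff of_nat_power one_le_power)

section \<open>Arcs of label \<open>q^d - 1\<close> and the remaining scalars\<close>

locale monomial_families = rigid_families V E lab K p n Phi Psi
  for V :: "'t set" and E lab and K :: "'k ring" (structure) and p n Phi Psi +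
  fixes \<sigma> :: "'t \<Rightarrow> 't"
  assumes targets_eq: "s \<in> V \<Longrightarrow> targets s = {\<sigma> s}"
begin

lemma sigma_V: "s \<in> V \<Longrightarrow> \<sigma> s \<in> V"
  using targets_eq[of s] by (auto simp: targets_def)

definition coeff :: "'t \<Rightarrow> 'k" where "coeff s = Phi (vert s) (vert (\<sigma> s))"

lemma coeff_closed: "s \<in> V \<Longrightarrow> coeff s \<in> carrier K"
  unfolding coeff_def by (intro Phi_K vert_S)

lemma coeff_nonzero: "s \<in> V \<Longrightarrow> coeff s \<noteq> \<zero>"
  unfolding coeff_def using targets_eq[of s] by (auto simp: targets_def)

lemma Phi_vert: "s \<in> V \<Longrightarrow> Phi (vert s) = mono (coeff s) (vert (\<sigma> s))"
proof
  fix m assume s: "s \<in> V"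
  show "Phi (vert s) m = mono (coeff s) (vert (\<sigma> s)) m"
  proof (cases "m = vert (\<sigma> s)")
    case True
    thus ?thesis by (simp add: mono_def coeff_def)
  next
    case False
    have "Phi (vert s) m = \<zero>"
    proof (rule ccontr)
      assume nz: "Phi (vert s) m \<noteq> \<zero>"
      hence mS: "m \<in> S" using conv_outside[OF Phi_closed[OF vert_S[OF s]]] by blast
      obtain v where v: "v \<in> V" "m = vert v" using support_vert[OF s mS nz] by auto
      hence "v \<in> targets s" using nz by (simp add: targets_def)
      thus False using targets_eq[OF s] v False by simp
    qed
    thus ?thesis using False by (simp add: mono_def)
  qed
qed

lemma unit_pow_dvd: "x \<in> carrier K \<Longrightarrow> x \<noteq> \<zero> \<Longrightarrow> q - 1 dvd k \<Longrightarrow> x [^] k = \<one>"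
proof -
  assume x: "x \<in> carrier K" "x \<noteq> \<zero>" "q - 1 dvd k"
  then obtain l where "k = (q - 1) * l" by auto
  thus ?thesis using x unit_pow[OF x(1,2)] K.nat_pow_pow[of x "q - 1" l] by simp
qed

lemma mono_eqD:
  assumes "mono a u = mono b w" "a \<noteq> \<zero>"
  shows "u = w" "a = b"
  using fun_cong[OF assms(1), of u] assms(2) by (auto simp: mono_def split: if_splits)

context
  fixes s t d
  assumes st: "(s, t) \<in> E" and lab_t: "lab t = q ^ d - 1" and d: "d \<ge> 2"
    and lab_st: "lab (\<sigma> t) = lab t" and ne: "\<sigma> s \<noteq> \<sigma> t"
begin

abbreviation "Q \<equiv> q ^ d"
abbreviation "m0 \<equiv> vert (\<sigma> s) + nmult (Q - 1) (vert (\<sigma> t))"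
abbreviation "Qr \<equiv> rat_of_nat Q"

text \<open>Four is exactly what the descent by 1/2 in \<open>arc_support\<close> requires, and it
  also settles the orientation of the arc in \<open>low_arc\<close>.\<close>

lemma Q_ge_4: "Q \<ge> 4"
proof -
  have "2 ^ 2 \<le> q ^ 2" using q_gt_1 by (intro power_mono) auto
  also have "\<dots> \<le> Q" using q_gt_1 d by (intro power_increasing) auto
  finally show ?thesis by simp
qed

lemma Qr_ge_4: "Qr \<ge> 4"
  using Q_ge_4 by (metis of_nat_le_iff of_nat_numeral)

text \<open>The scalar at \<open>t\<close> enters with exponent \<open>Q - 1\<close>, a multiple of
  \<open>q - 1\<close>, and disappears; the one at \<open>s\<close> enters once and stays. This
  asymmetry is the purpose of the label \<open>Q - 1\<close>.\<close>

lemma Phi_m0: "Phi (vert s + nmult (Q - 1) (vert t)) = mono (coeff s) m0"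
proof -
  note V = E_V[OF st]
  have "Phi (vert s + nmult (Q - 1) (vert t)) =
      mono (coeff s) (vert (\<sigma> s)) \<otimes>\<^bsub>conv_ring\<^esub> mono (coeff t) (vert (\<sigma> t)) [^]\<^bsub>conv_ring\<^esub> (Q - 1)"
    using V by (simp only: Phi_add vert_S nmult_mem Phi_nmult Phi_vert)
  also have "\<dots> = mono (coeff s) (vert (\<sigma> s)) \<otimes>\<^bsub>conv_ring\<^esub> mono \<one> (nmult (Q - 1) (vert (\<sigma> t)))"
    using V coeff_closed[of t] coeff_nonzero[of t] sigma_V[of t] dvd_power_minus_1[OF q_gt_1]
    by (simp only: mono_pow vert_S unit_pow_dvd not_False_eq_True)
  also have "\<dots> = mono (coeff s \<otimes> \<one>) m0"
    using V coeff_closed[of s] sigma_V by (intro mono_mult) auto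
  finally show ?thesis using V coeff_closed[of s] by simp
qed

text \<open>For \<open>a = arc s t\<close> the label \<open>Q - 1\<close> gives
  \<open>Q a = a + e_s + (Q - 1) e_t\<close>, so the \<open>Q\<close>-th power of
  \<open>Phi a\<close> is \<open>Phi a\<close> times a monomial. Hence the support of
  \<open>Phi a\<close> is stable under the contraction that sends \<open>w\<close> to
  \<open>(w + m0) / Q\<close>, whose only fixed point is
  \<open>arc (\<sigma> s) (\<sigma> t)\<close>.\<close>

lemma arc_step:
  assumes w: "w \<in> S" "Phi (arc s t) w \<noteq> \<zero>"
  obtains w' where "w' \<in> S" "nmult Q w' = w + m0" "Phi (arc s t) w' = Phi (arc s t) w \<otimes> coeff s"
proof -
  note V = E_V[OF st]
  note aS = arc_S[OF st]
  have "nmult (Suc (lab t)) (arc s t) = arc s t + (vert s + nmult (lab t) (vert t))"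
    unfolding nmult_Suc lab_arc[OF st] ..
  hence eq: "nmult Q (arc s t) = arc s t + (vert s + nmult (Q - 1) (vert t))"
  proof -
    have "Suc (lab t) = Q" "lab t = Q - 1" using Q_ge_4 lab_t by linarith+
    thus ?thesis using \<open>nmult (Suc (lab t)) (arc s t) = _\<close> by metis
  qed
  have m0S: "m0 \<in> S" using V sigma_V by simp
  have "Phi (nmult Q (arc s t)) (w + m0) =
      (\<Oplus>z\<in>decomp (w + m0). Phi (arc s t) (fst z) \<otimes> mono (coeff s) m0 (snd z))"
    unfolding eq Phi_m0[symmetric] using aS V by (intro Phi_mult_at) auto
  also have "\<dots> = Phi (arc s t) w \<otimes> coeff s"
  proof (rule K.finsum_delta[of _ "(w, m0)"])
    show "(w, m0) \<in> decomp (w + m0)" using w m0S by (simp only: decomp_iff simp_thms)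
    show "Phi (arc s t) w \<otimes> coeff s \<in> carrier K"
      using Phi_K[OF aS] coeff_closed V by simp
    fix z assume z: "z \<in> decomp (w + m0)" "z \<noteq> (w, m0)"
    have "snd z \<noteq> m0"
    proof
      assume "snd z = m0"
      hence "fst z = w" using decomp_mem(3)[OF z(1)] by (metis add_right_cancel)
      thus False using z(2) \<open>snd z = m0\<close> by (metis prod.collapse)
    qed
    thus "Phi (arc s t) (fst z) \<otimes> mono (coeff s) m0 (snd z) = \<zero>"
      using Phi_K[OF aS] by (simp only: mono_def if_False K.r_null)
  qed (simp_all only: finite_decomp' fst_conv snd_conv mono_def if_True simp_thms)
  finally have e: "Phi (nmult Q (arc s t)) (w + m0) = Phi (arc s t) w \<otimes> coeff s" .
  have "Phi (arc s t) w \<otimes> coeff s \<noteq> \<zero>"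
    using w(2) K.integral[OF _ Phi_K[OF aS] coeff_closed] coeff_nonzero V by metis
  hence "Phi (nmult Q (arc s t)) (w + m0) \<noteq> \<zero>" using e by metis
  then obtain w' where w': "w' \<in> S" "w + m0 = nmult Q w'" using Phi_q(2)[OF aS] by metis
  have "Phi (arc s t) w' = Phi (arc s t) w \<otimes> coeff s"
    using Phi_q(1)[OF aS w'(1)] e w'(2) by metis
  thus thesis using that w' by metis
qed

lemma step_coord:
  assumes "nmult Q w' = w + m0"
  shows "Qr * w' x = w x + vert (\<sigma> s) x + (Qr - 1) * vert (\<sigma> t) x"
proof -
  have "nmult Q w' x = (w + m0) x" using assms by simp
  moreover have "rat_of_nat (Q - 1) = Qr - 1" using Q_ge_4 by (simp only: of_nat_diff)
  ultimately show ?thesis by (simp only: nmult_fun plus_fun_apply add.assoc)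
qed

lemma step_deg:
  assumes "nmult Q w' = w + m0" "w' \<in> S" "w \<in> S"
  shows "Qr * deg w' = deg w + Qr"
proof -
  have V: "vert (\<sigma> s) \<in> S" "vert (\<sigma> t) \<in> S" using E_V[OF st] sigma_V by auto
  have "deg (nmult Q w') = deg (w + m0)" using assms(1) by simp
  moreover have "deg (w + m0) = deg w + (1 + of_nat (Q - 1) * 1)"
    using assms V by (simp only: deg_add_S deg_nmult add_mem nmult_mem deg_vert)
  moreover have "rat_of_nat (Q - 1) = Qr - 1" using Q_ge_4 by (simp only: of_nat_diff)
  moreover have "deg (nmult Q w') = Qr * deg w'" by (rule deg_nmult[OF assms(2)])
  ultimately show ?thesis by linarith
qed

lemma lab_Q: "rat_of_nat (lab (\<sigma> t)) = Qr - 1"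
  unfolding lab_st lab_t using Q_ge_4 by (simp only: of_nat_diff)

text \<open>One contraction step takes \<open>w\<close> to an atom that is nonzero at both
  \<open>\<sigma> s\<close> and \<open>\<sigma> t\<close>, hence to an arc between them. The
  opposite orientation would give it the coordinate 1 at \<open>\<sigma> s\<close>, that is
  \<open>w (\<sigma> s) = Q - 1\<close>, too large for degree below 2. Undoing the step determines
  \<open>w\<close>.\<close>

lemma low_arc:
  assumes w: "w \<in> S" "Phi (arc s t) w \<noteq> \<zero>" "deg w < 2"
  shows "w = arc (\<sigma> s) (\<sigma> t)"
proof -
  note Q4 = Qr_ge_4
  obtain w' where w': "w' \<in> S" "nmult Q w' = w + m0"
    using arc_step[OF w(1,2)] by metis
  note co = step_coord[OF w'(2)]
  have dd: "Qr * deg w' = deg w + Qr" by (rule step_deg[OF w'(2,1) w(1)])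
  have "Qr * deg w' < Qr * 2" using dd w(3) Q4 by linarith
  moreover have "2 \<le> Qr" using Q4 by linarith
  ultimately have "deg w' < 2" using mult_less_cancel_ge_2 by blast
  moreover have "Qr * deg w' > 0" using dd Q4 deg_nonneg[OF w(1)] by linarith
  hence "w' \<noteq> 0" by (metis deg_0 mult_zero_right less_irrefl)
  ultimately have atom: "w' \<in> atoms" using deg_lt_2[OF w'(1)] by blast
  have wle: "w x < 2" for x using coord_le_deg[OF w(1), of x] w(3) by linarith
  have wge: "0 \<le> w x" for x by (rule S_nonneg[OF w(1)])
  have vs: "Qr * w' (\<sigma> s) = w (\<sigma> s) + 1" using co[of "\<sigma> s"] ne by (simp add: vert_def)
  have vt: "Qr * w' (\<sigma> t) = w (\<sigma> t) + (Qr - 1)" using co[of "\<sigma> t"] ne by (simp add: vert_def)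
  have pos: "w' (\<sigma> s) \<noteq> 0" "w' (\<sigma> t) \<noteq> 0"
    using vs vt wge[of "\<sigma> s"] wge[of "\<sigma> t"] Q4 by auto
  from atom show ?thesis
  proof (cases rule: atom_cases)
    case (vert c)
    hence "\<sigma> s = c" "\<sigma> t = c" using pos by (auto simp: vert_def split: if_splits)
    thus ?thesis using ne by simp
  next
    case (arc c e)
    have "w' c \<noteq> 0" "w' e = 1" "w' c = 1 / of_nat (lab e)" using arc lab_pos[OF arc(1)] E_irrefl[OF arc(1)] by (auto simp: arc_def)
    have other: "w' x = 0" if "x \<noteq> c" "x \<noteq> e" for x using arc that by (simp add: arc_def)
    have "\<sigma> t = e"
    proof (rule ccontr)
      assume "\<sigma> t \<noteq> e"
      hence "\<sigma> t = c" using pos other by blast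
      hence "\<sigma> s = e" using pos ne other by blast
      hence "Qr = w (\<sigma> s) + 1" using vs \<open>w' e = 1\<close> by simp
      thus False using wle[of "\<sigma> s"] Q4 by linarith
    qed
    moreover from this have "\<sigma> s = c" using pos ne other by blast
    ultimately have c: "c = \<sigma> s" "e = \<sigma> t" by auto
    have "w (\<sigma> t) = 1" using vt \<open>w' e = 1\<close> c by simp
    moreover have "w (\<sigma> s) = 1 / of_nat (lab (\<sigma> t))"
    proof -
      have "Qr * (1 / (Qr - 1)) = w (\<sigma> s) + 1"
        using vs \<open>w' c = 1 / of_nat (lab e)\<close> c lab_Q by simp
      moreover have "Qr * (1 / (Qr - 1)) = 1 / (Qr - 1) + 1"
      proof -
        have "Qr - 1 \<noteq> 0" using Q4 by linarith
        thus ?thesis by (simp add: divide_simps)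
      qed
      ultimately show ?thesis using lab_Q by simp
    qed
    moreover have "w x = 0" if "x \<noteq> \<sigma> s" "x \<noteq> \<sigma> t" for x
      using co[of x] other[of x] that c by (simp add: vert_def)
    ultimately show ?thesis using ne by (auto simp: arc_def fun_eq_iff)
  qed
qed

text \<open>As long as the degree is at least 2, a contraction step lowers it by at least 1/2, so
  finitely many steps lead to \<open>low_arc\<close>; the counter \<open>k\<close> measures the
  degree in halves.\<close>

lemma arc_support:
  assumes w: "w \<in> S" "Phi (arc s t) w \<noteq> \<zero>"
  shows "w = arc (\<sigma> s) (\<sigma> t)"
proof -
  note Q4 = Qr_ge_4
  have "w = arc (\<sigma> s) (\<sigma> t)"
    if "w \<in> S" "Phi (arc s t) w \<noteq> \<zero>" "deg w < 2 + of_nat k / 2" for w and k :: nat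
    using that
  proof (induction k arbitrary: w)
    case 0
    thus ?case using low_arc by simp
  next
    case (Suc k)
    show ?case
    proof (cases "deg w < 2")
      case True
      thus ?thesis using low_arc Suc by simp
    next
      case False
      obtain w' where w': "w' \<in> S" "nmult Q w' = w + m0" "Phi (arc s t) w' = Phi (arc s t) w \<otimes> coeff s"
        using arc_step[OF Suc(2,3)] by metis
      have dd: "Qr * deg w' = deg w + Qr" by (rule step_deg[OF w'(2,1) Suc(2)])
      have "Qr * (deg w' - deg w + 1 / 2) = deg w + Qr - Qr * deg w + Qr / 2"
        using dd by (simp add: algebra_simps)
      \<comment> \<open>From \<open>deg w' = 1 + deg w / Q\<close>, \<open>deg w >= 2\<close> and
        \<open>Q >= 4\<close> the loss of degree is at least
        \<open>2 (1 - 1/4) - 1 = 1/2\<close>.\<close>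
      also have "\<dots> \<le> 0"
      proof -
        have "(Qr - 1) * 2 \<le> (Qr - 1) * deg w" using Q4 False by (intro mult_left_mono) auto
        hence "2 * Qr - 2 \<le> Qr * deg w - deg w" by (simp only: left_diff_distrib mult_1_left)
        thus ?thesis using Q4 by linarith
      qed
      finally have "Qr * (deg w' - deg w + 1 / 2) \<le> Qr * 0" by simp
      moreover have "2 \<le> Qr" using Q4 by linarith
      ultimately have "deg w' - deg w + 1 / 2 \<le> 0" using mult_le_cancel_ge_2 by blast
      moreover have "(of_nat (Suc k) :: rat) / 2 = of_nat k / 2 + 1 / 2" by (simp add: add_divide_distrib)
      ultimately have "deg w' < 2 + of_nat k / 2" using Suc(4) by linarith
      moreover have "Phi (arc s t) w' \<noteq> \<zero>"
        unfolding w'(3) using Suc(3) K.integral[OF _ Phi_K[OF arc_S[OF st]] coeff_closed] coeff_nonzero E_V[OF st]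
        by metis
      ultimately have e: "w' = arc (\<sigma> s) (\<sigma> t)" using Suc(1) w'(1) by blast
      \<comment> \<open>The step is injective and the arc is its fixed point, so the arc is its own
        only predecessor.\<close>
      note co = step_coord[OF w'(2)]
      have "w x = arc (\<sigma> s) (\<sigma> t) x" for x
      proof -
        have "Qr - 1 \<noteq> 0" using Q4 by linarith
        thus ?thesis using co[of x] ne lab_Q unfolding e
          by (auto simp: arc_def vert_def divide_simps split: if_splits) (simp add: algebra_simps)
      qed
      thus ?thesis by blast
    qed
  qed
  moreover obtain k :: nat where "(deg w - 2) * 2 < of_nat k" using reals_Archimedean2 by blast
  hence "deg w < 2 + of_nat k / 2" by (simp add: field_simps)
  ultimately show ?thesis using w by blast
qed

text \<open>The fixed point is the whole support, and \<open>arc_step\<close> there multiplies the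
  coefficient by \<open>coeff s\<close> without moving the exponent; a nonzero coefficient leaves
  only \<open>coeff s = \<one>\<close>.\<close>

lemma arc_image:
  "coeff s = \<one>" "Phi (arc s t) (arc (\<sigma> s) (\<sigma> t)) \<noteq> \<zero>" "arc (\<sigma> s) (\<sigma> t) \<in> S"
  "Phi (arc s t) = mono (Phi (arc s t) (arc (\<sigma> s) (\<sigma> t))) (arc (\<sigma> s) (\<sigma> t))"
proof -
  note aS = arc_S[OF st]
  have "arc s t \<in> atoms" using st by (auto simp: atoms_def)
  then obtain a where a: "a \<in> atoms" "Phi (arc s t) a \<noteq> \<zero>" using Phi_atom_witness by metis
  have e: "a = arc (\<sigma> s) (\<sigma> t)" by (rule arc_support[OF atoms_S[OF a(1)] a(2)])
  show nz: "Phi (arc s t) (arc (\<sigma> s) (\<sigma> t)) \<noteq> \<zero>" and S: "arc (\<sigma> s) (\<sigma> t) \<in> S"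
    using a atoms_S e by auto
  obtain w' where w': "w' \<in> S" "Phi (arc s t) w' = Phi (arc s t) (arc (\<sigma> s) (\<sigma> t)) \<otimes> coeff s"
    using arc_step[OF S nz] by metis
  have "Phi (arc s t) w' \<noteq> \<zero>"
    unfolding w'(2) using nz K.integral[OF _ Phi_K[OF aS] coeff_closed] coeff_nonzero E_V[OF st]
    by metis
  hence "w' = arc (\<sigma> s) (\<sigma> t)" using arc_support w'(1) by blast
  hence "Phi (arc s t) w' \<otimes> \<one> = Phi (arc s t) w' \<otimes> coeff s"
    using w'(2) Phi_K[OF aS] by simp
  thus "coeff s = \<one>"
    using K.m_lcancel[of "Phi (arc s t) w'" \<one> "coeff s"] \<open>Phi (arc s t) w' \<noteq> \<zero>\<close> Phi_K[OF aS]
      coeff_closed E_V[OF st] K.one_closed by metis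
  show "Phi (arc s t) = mono (Phi (arc s t) (arc (\<sigma> s) (\<sigma> t))) (arc (\<sigma> s) (\<sigma> t))"
  proof
    fix m
    show "Phi (arc s t) m = mono (Phi (arc s t) (arc (\<sigma> s) (\<sigma> t))) (arc (\<sigma> s) (\<sigma> t)) m"
    proof (cases "m = arc (\<sigma> s) (\<sigma> t)")
      case False
      hence "Phi (arc s t) m = \<zero>" using arc_support[of m] conv_outside[OF Phi_closed[OF aS]] by blast
      thus ?thesis using False by (simp add: mono_def)
    qed (simp add: mono_def)
  qed
qed

end

text \<open>Multiplication by \<open>q^j\<close> is injective on exponents and Frobenius keeps
  coefficients, so \<open>Phi (arc s t)\<close> can be recovered from its \<open>q^j\<close>-th
  power, a monomial computed from the two ends.\<close>

lemma Phi_arc_power: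
  assumes st: "(s, t) \<in> E" and lab: "lab t = q ^ j" and j: "j \<ge> 1"
    and one: "coeff s = \<one>" "coeff t = \<one>"
  shows "(\<sigma> s, \<sigma> t) \<in> E" "lab (\<sigma> t) = lab t" "Phi (arc s t) = mono \<one> (arc (\<sigma> s) (\<sigma> t))"
proof -
  note V = E_V[OF st]
  show E: "(\<sigma> s, \<sigma> t) \<in> E" and L: "lab (\<sigma> t) = lab t"
    using targets_arc[OF st lab j, of "\<sigma> s" "\<sigma> t"] targets_eq V by auto
  have a: "nmult (q ^ j) (arc s t) = vert s + nmult (q ^ j) (vert t)"
    using lab_arc[OF st] lab by simp
  have b: "nmult (q ^ j) (arc (\<sigma> s) (\<sigma> t)) = vert (\<sigma> s) + nmult (q ^ j) (vert (\<sigma> t))"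
    using lab_arc[OF E] L lab by simp
  have vS: "vert (\<sigma> s) \<in> S" "vert (\<sigma> t) \<in> S" using V sigma_V by auto
  have P: "Phi (nmult (q ^ j) (arc s t)) = mono \<one> (nmult (q ^ j) (arc (\<sigma> s) (\<sigma> t)))"
    unfolding a b using V one vS
    by (simp only: Phi_add vert_S nmult_mem Phi_nmult Phi_vert mono_pow mono_mult K.one_closed
        K.nat_pow_one K.r_one)
  have inj: "inj (nmult (q ^ j) :: ('t \<Rightarrow> rat) \<Rightarrow> _)" using q_gt_1 by (intro inj_nmult_fun) simp
  show "Phi (arc s t) = mono \<one> (arc (\<sigma> s) (\<sigma> t))"
  proof
    fix m
    show "Phi (arc s t) m = mono \<one> (arc (\<sigma> s) (\<sigma> t)) m"
    proof (cases "m \<in> S")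
      case True
      have "Phi (arc s t) m = Phi (nmult (q ^ j) (arc s t)) (nmult (q ^ j) m)"
        using Phi_q(1)[OF arc_S[OF st] True] by simp
      also have "\<dots> = mono \<one> (arc (\<sigma> s) (\<sigma> t)) m"
        unfolding P mono_def using inj by (simp add: inj_eq)
      finally show ?thesis .
    next
      case False
      have "m \<noteq> arc (\<sigma> s) (\<sigma> t)" using False arc_S[OF E] by auto
      thus ?thesis using False conv_outside[OF Phi_closed[OF arc_S[OF st]]] by (simp add: mono_def)
    qed
  qed
qed

text \<open>
  The coefficient of an arc of label \<open>q\<^sup>d - 1\<close> is a power, with exponent divisible by \<open>q - 1\<close>,
  of the coefficient of the arc of label \<open>q\<^bsup>d (q - 1)\<^esup> - 1\<close> with the same source.
\<close>

lemma Phi_arc_cyclotomic: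
  assumes st: "(s, t) \<in> E" "(s, t') \<in> E" and lab: "lab t = q ^ d - 1" "lab t' = q ^ (d * (q - 1)) - 1"
    and d: "d \<ge> 2" and L: "lab (\<sigma> t) = lab t" "lab (\<sigma> t') = lab t'" "\<sigma> s \<noteq> \<sigma> t" "\<sigma> s \<noteq> \<sigma> t'"
    and one: "coeff t = \<one>" "coeff t' = \<one>"
  shows "Phi (arc s t) = mono \<one> (arc (\<sigma> s) (\<sigma> t))"
proof -
  have q1: "q - 1 \<ge> 1" using q_gt_1 by simp
  have d': "d * (q - 1) \<ge> 2" using d q1 by (metis le_trans mult_le_mono mult_1_right)
  note A = arc_image[OF st(1) lab(1) d L(1,3)]
  note A' = arc_image[OF st(2) lab(2) d' L(2,4)]
  define \<mu> where "\<mu> = Phi (arc s t) (arc (\<sigma> s) (\<sigma> t))"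
  define \<mu>' where "\<mu>' = Phi (arc s t') (arc (\<sigma> s) (\<sigma> t'))"
  have \<mu>: "\<mu> \<in> carrier K" "\<mu>' \<in> carrier K" "\<mu> \<noteq> \<zero>" "\<mu>' \<noteq> \<zero>"
    unfolding \<mu>_def \<mu>'_def using A(2) A'(2) Phi_K[OF arc_S[OF st(1)]] Phi_K[OF arc_S[OF st(2)]] by auto
  \<comment> \<open>\<open>c\<close> is the quotient of \<open>q^(d (q - 1)) - 1\<close> by
    \<open>q^d - 1\<close>, a geometric sum of \<open>q - 1\<close> terms that are all 1 modulo
    \<open>q - 1\<close>. The factor \<open>q - 1\<close> in the exponent is chosen so that
    \<open>q - 1\<close> divides \<open>c\<close>.\<close>
  define c where "c = (\<Sum>i<q - 1. (q ^ d) ^ i)"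
  have Q1: "q ^ d \<ge> 1" using q_gt_1 by simp
  have labc: "lab t' = c * lab t"
  proof -
    have "int ((q ^ d) ^ (q - 1)) - 1 = (int (q ^ d) - 1) * int c"
      using power_diff_1_eq[of "int (q ^ d)" "q - 1"] by (simp add: c_def)
    hence "int (lab t') = int (lab t * c)"
      unfolding lab power_mult using Q1 by (simp add: of_nat_diff)
    thus ?thesis by (simp only: of_nat_eq_iff mult.commute)
  qed
  have cdvd: "q - 1 dvd c"
  proof -
    have "q - 1 dvd (q ^ d) ^ i - 1" for i
      unfolding power_mult[symmetric] by (rule dvd_power_minus_1[OF q_gt_1])
    moreover have "c = (\<Sum>i<q - 1. ((q ^ d) ^ i - 1) + 1)"
      unfolding c_def using Q1 by (intro sum.cong refl) (simp only: le_add_diff_inverse2 one_le_power)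
    hence "c = (\<Sum>i<q - 1. (q ^ d) ^ i - 1) + (q - 1)" by (simp only: sum.distrib) simp
    ultimately show ?thesis by (metis dvd_add dvd_refl dvd_sum)
  qed
  have V: "s \<in> V" "t \<in> V" "t' \<in> V" using E_V st by auto
  have lp: "rat_of_nat (lab t) \<noteq> 0" "rat_of_nat (lab t') \<noteq> 0" using lab_pos[OF st(1)] lab_pos[OF st(2)] by auto
  have rc: "rat_of_nat c * (1 / rat_of_nat (lab t')) = 1 / rat_of_nat (lab t)"
    using labc lp by (auto simp: field_simps)
  \<comment> \<open>Both sides are \<open>e_s / lab t + e_t + c e_t'\<close>. Comparing their images
    gives \<open>\<mu>'^c = \<mu>\<close>, where the left side is 1.\<close>
  have eq: "nmult c (arc s t') + vert t = arc s t + nmult c (vert t')"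
  proof
    fix x show "(nmult c (arc s t') + vert t) x = (arc s t + nmult c (vert t')) x"
      using E_irrefl[OF st(1)] E_irrefl[OF st(2)] rc
      by (simp add: nmult_fun arc_def vert_def)
  qed
  have vS: "vert (\<sigma> t) \<in> S" "vert (\<sigma> t') \<in> S" using V sigma_V by auto
  have "Phi (nmult c (arc s t') + vert t) =
      mono \<mu>' (arc (\<sigma> s) (\<sigma> t')) [^]\<^bsub>conv_ring\<^esub> c \<otimes>\<^bsub>conv_ring\<^esub> mono \<one> (vert (\<sigma> t))"
    using arc_S[OF st(2)] V Phi_vert[OF V(2)] A'(4) unfolding one \<mu>'_def[symmetric]
    by (simp only: Phi_add nmult_mem vert_S Phi_nmult)
  also have "\<dots> = mono (\<mu>' [^] c) (nmult c (arc (\<sigma> s) (\<sigma> t')) + vert (\<sigma> t))"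
    using \<mu> A'(3) vS by (simp only: mono_pow mono_mult K.nat_pow_closed K.one_closed nmult_mem K.r_one)
  also have "\<mu>' [^] c = \<one>" using \<mu> cdvd by (intro unit_pow_dvd)
  finally have l: "Phi (nmult c (arc s t') + vert t) = mono \<one> (nmult c (arc (\<sigma> s) (\<sigma> t')) + vert (\<sigma> t))" .
  have "Phi (arc s t + nmult c (vert t')) =
      mono \<mu> (arc (\<sigma> s) (\<sigma> t)) \<otimes>\<^bsub>conv_ring\<^esub> mono \<one> (vert (\<sigma> t')) [^]\<^bsub>conv_ring\<^esub> c"
    using arc_S[OF st(1)] V Phi_vert[OF V(3)] A(4) unfolding one \<mu>_def[symmetric]
    by (simp only: Phi_add nmult_mem vert_S Phi_nmult)
  also have "\<dots> = mono \<mu> (arc (\<sigma> s) (\<sigma> t) + nmult c (vert (\<sigma> t')))"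
    using \<mu> A(3) vS by (simp only: mono_pow mono_mult K.nat_pow_one K.one_closed nmult_mem K.r_one)
  finally have r: "Phi (arc s t + nmult c (vert t')) = mono \<mu> (arc (\<sigma> s) (\<sigma> t) + nmult c (vert (\<sigma> t')))" .
  have "\<one> = \<mu>" using mono_eqD(2)[of \<one> _ \<mu>] l r eq K.one_not_zero by metis
  thus ?thesis using A(4) \<mu>_def by simp
qed

text \<open>Both sides are multiplicative in \<open>u\<close>, so the atoms suffice. The inverse
  \<open>\<tau>\<close> appears because moving a function along \<open>\<sigma>\<close> means
  composing it with the inverse.\<close>

lemma Phi_perm:
  assumes inv: "\<And>x. \<tau> (\<sigma> x) = x" "\<And>x. \<sigma> (\<tau> x) = x"
    and vert: "\<And>s. s \<in> V \<Longrightarrow> Phi (vert s) = mono \<one> (vert (\<sigma> s))"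
    and arc: "\<And>s t. (s, t) \<in> E \<Longrightarrow> Phi (arc s t) = mono \<one> (arc (\<sigma> s) (\<sigma> t))"
    and S\<tau>: "\<And>u. u \<in> S \<Longrightarrow> (\<lambda>x. u (\<tau> x)) \<in> S"
    and lab: "\<And>t. t \<in> V \<Longrightarrow> lab (\<sigma> t) = lab t"
    and u: "u \<in> S"
  shows "Phi u = mono \<one> (\<lambda>x. u (\<tau> x))"
proof -
  have eqx: "\<tau> x = s \<longleftrightarrow> x = \<sigma> s" for x s using inv by metis
  have at: "Phi a = mono \<one> (\<lambda>x. a (\<tau> x))" if "a \<in> atoms" for a
    using that
  proof (cases rule: atom_cases)
    case (vert s)
    have "(\<lambda>x. a (\<tau> x)) = vert (\<sigma> s)" unfolding vert(2) by (simp add: vert_def eqx fun_eq_iff)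
    thus ?thesis using vert assms(3) by simp
  next
    case (arc s t)
    have "(\<lambda>x. a (\<tau> x)) = arc (\<sigma> s) (\<sigma> t)" unfolding arc(2)
      using lab E_V[OF arc(1)] by (simp add: arc_def eqx fun_eq_iff)
    thus ?thesis using arc assms(4) by simp
  qed
  show ?thesis using u
  proof (induction rule: S.induct)
    case zero
    have "(\<lambda>x. (0 :: 't \<Rightarrow> rat) (\<tau> x)) = 0" by (simp add: zero_fun_def)
    thus ?case by (simp only: Phi_0 mono_one)
  next
    case (step a m)
    have "Phi (a + m) = mono \<one> (\<lambda>x. a (\<tau> x)) \<otimes>\<^bsub>conv_ring\<^esub> mono \<one> (\<lambda>x. m (\<tau> x))"
      using step at atoms_S by (simp only: Phi_add)
    also have "\<dots> = mono (\<one> \<otimes> \<one>) ((\<lambda>x. a (\<tau> x)) + (\<lambda>x. m (\<tau> x)))"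
      using step atoms_S S\<tau> by (intro mono_mult K.one_closed) auto
    also have "(\<lambda>x. a (\<tau> x)) + (\<lambda>x. m (\<tau> x)) = (\<lambda>x. (a + m) (\<tau> x))" by (simp add: plus_fun_def)
    finally show ?case by (simp only: K.r_one K.one_closed)
  qed
qed

end

subsection \<open>A digraph with a prescribed automorphism group\<close>

text \<open>
  The nodes \<open>Pair g a\<close> carry the Cayley graph of the group, with the star around \<open>Pair g \<one>\<close> tying
  together all \<open>Pair g a\<close>. The arc to \<open>Ord a\<close> fixes the second component, since the nodes \<open>Ord a\<close> are
  rigid by a well-order. Every node has arcs to the \<open>Pow j\<close>, whose labels are unbounded powers of \<open>q\<close>,
  and to the \<open>Cyc d\<close>, whose labels \<open>q\<^bsup>d + 2\<^esup> - 1\<close> determine scalars. The \<open>Pow j\<close> with \<open>j\<close> odd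
  only serve to distinguish the \<open>Cyc d\<close> from each other.
\<close>

datatype 'g node = Pow nat | Cyc nat | Ord 'g | Pair 'g 'g

text \<open>Pairs, orders and the single \<open>Pow\<close> nodes receive different powers of
  \<open>q\<close>, so that a preserved label reveals the kind of the node. The shift in
  \<open>d + 2\<close> supplies the bound \<open>d >= 2\<close> used for labels
  \<open>q^d - 1\<close>.\<close>

fun node_lab :: "nat \<Rightarrow> 'g node \<Rightarrow> nat" where
  "node_lab q (Pow j) = q ^ (j + 4)"
| "node_lab q (Cyc d) = q ^ (d + 2) - 1"
| "node_lab q (Ord a) = q ^ 3"
| "node_lab q (Pair g a) = q ^ 2"

definition nodes :: "'g set \<Rightarrow> 'g node set"
  where "nodes X = range Pow \<union> range Cyc \<union> Ord ` X \<union> case_prod Pair ` (X \<times> X)"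

lemma nodes_simps [simp]:
  "Pow j \<in> nodes X" "Cyc d \<in> nodes X" "Ord a \<in> nodes X \<longleftrightarrow> a \<in> X"
  "Pair g a \<in> nodes X \<longleftrightarrow> g \<in> X \<and> a \<in> X"
  by (auto simp: nodes_def)

fun adj :: "('g, 'b) monoid_scheme \<Rightarrow> ('g \<Rightarrow> 'g \<Rightarrow> bool) \<Rightarrow> 'g node \<Rightarrow> 'g node \<Rightarrow> bool" where
  "adj G lt (Pow i) (Pow j) \<longleftrightarrow> even j \<and> i < j"
| "adj G lt (Cyc d) (Pow j) \<longleftrightarrow> odd j \<and> j \<noteq> 2 * d + 1"
| "adj G lt s (Pow j) \<longleftrightarrow> even j"
| "adj G lt (Cyc d') (Cyc d) \<longleftrightarrow> d' < d"
| "adj G lt s (Cyc d) \<longleftrightarrow> True"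
| "adj G lt (Ord a) (Ord b) \<longleftrightarrow> lt a b"
| "adj G lt (Pair g a) (Ord b) \<longleftrightarrow> a = b"
| "adj G lt s (Ord b) \<longleftrightarrow> False"
| "adj G lt (Ord a) (Pair h b) \<longleftrightarrow> True"
| "adj G lt (Pair g a) (Pair h b) \<longleftrightarrow>
    (a \<noteq> \<one>\<^bsub>G\<^esub> \<and> b = \<one>\<^bsub>G\<^esub> \<and> h = g) \<or> (a = \<one>\<^bsub>G\<^esub> \<and> b \<noteq> \<one>\<^bsub>G\<^esub> \<and> h = g \<otimes>\<^bsub>G\<^esub> b)"
| "adj G lt s (Pair h b) \<longleftrightarrow> False"

definition arcs :: "('g, 'b) monoid_scheme \<Rightarrow> ('g \<Rightarrow> 'g \<Rightarrow> bool) \<Rightarrow> ('g node \<times> 'g node) set"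
  where "arcs G lt = {(s, t). s \<in> nodes (carrier G) \<and> t \<in> nodes (carrier G) \<and> adj G lt s t}"

text \<open>The case distinction makes \<open>act G c\<close> a permutation of all of \<open>'g node\<close>, not only of the nodes over the carrier.\<close>

fun act :: "('g, 'b) monoid_scheme \<Rightarrow> 'g \<Rightarrow> 'g node \<Rightarrow> 'g node" where
  "act G c (Pair g a) = (if g \<in> carrier G then Pair (c \<otimes>\<^bsub>G\<^esub> g) a else Pair g a)"
| "act G c s = s"

locale group_coding = G: group G + K: field K
  for G :: "'g monoid" and K :: "'k ring" (structure) +
  fixes p n :: nat and lt :: "'g \<Rightarrow> 'g \<Rightarrow> bool"
  assumes prime: "Factorial_Ring.prime p" and finK: "finite (carrier K)" and ordK: "order K = p ^ n"
    and wf_less: "wfp lt"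
    and total: "a \<in> carrier G \<Longrightarrow> b \<in> carrier G \<Longrightarrow> a \<noteq> b \<Longrightarrow> lt a b \<or> lt b a"
begin

lemma not_less_self: "\<not> lt a a"
  using wf_less by (auto dest: wfp_imp_irreflp irreflpD)

abbreviation "VG \<equiv> nodes (carrier G)"
abbreviation "EG \<equiv> arcs G lt"
abbreviation "labG \<equiv> node_lab (p ^ n) :: 'g node \<Rightarrow> nat"

lemma pn_ge_2: "p ^ n \<ge> 2"
proof -
  have "{\<zero>, \<one>} \<subseteq> carrier K" using K.zero_closed K.one_closed by blast
  hence "card {\<zero>, \<one>} \<le> p ^ n" unfolding ordK[symmetric] order_def using finK by (intro card_mono)
  thus ?thesis by simp
qed

lemma pn_power_ge: "k \<ge> 1 \<Longrightarrow> (p ^ n) ^ k \<ge> 2"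
  using power_increasing[of 1 k "p ^ n"] pn_ge_2 by simp

sublocale digraph_convolution VG EG labG K p n
proof unfold_locales
  show "s \<in> VG \<and> t \<in> VG" if "(s, t) \<in> EG" for s t using that by (simp add: arcs_def)
  show "s \<noteq> t" if "(s, t) \<in> EG" for s t
    using that not_less_self by (cases t) (auto simp: arcs_def)
  show "labG t \<ge> 2" if "t \<in> VG" for t
  proof (cases t)
    case (Cyc d)
    have "2 ^ 2 \<le> (p ^ n) ^ 2" using pn_ge_2 by (intro power_mono) auto
    also have "\<dots> \<le> (p ^ n) ^ (d + 2)" using pn_ge_2 by (intro power_increasing) auto
    finally show ?thesis using Cyc by simp
  qed (simp_all only: node_lab.simps pn_power_ge)
qed (use prime finK ordK in auto)

lemma EG_iff: "(s, t) \<in> EG \<longleftrightarrow> s \<in> VG \<and> t \<in> VG \<and> adj G lt s t"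
  by (simp add: arcs_def)

lemma act_act: "c \<in> carrier G \<Longrightarrow> d \<in> carrier G \<Longrightarrow> act G c (act G d s) = act G (c \<otimes>\<^bsub>G\<^esub> d) s"
  by (cases s) (auto simp: G.m_assoc)

lemma act_one: "act G \<one>\<^bsub>G\<^esub> s = s"
  by (cases s) auto

lemma act_inv:
  assumes "c \<in> carrier G"
  shows "act G (inv\<^bsub>G\<^esub> c) (act G c s) = s" "act G c (act G (inv\<^bsub>G\<^esub> c) s) = s"
  using assms by (simp_all add: act_act act_one)

lemma act_VG: "c \<in> carrier G \<Longrightarrow> act G c s \<in> VG \<longleftrightarrow> s \<in> VG"
  by (cases s) auto

lemma act_lab: "labG (act G c s) = labG s"
  by (cases s) auto

lemma act_EG: "c \<in> carrier G \<Longrightarrow> (s, t) \<in> EG \<Longrightarrow> (act G c s, act G c t) \<in> EG"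
  by (cases s; cases t) (auto simp: EG_iff G.m_assoc)

lemma act_S:
  assumes c: "c \<in> carrier G" and u: "u \<in> S"
  shows "(\<lambda>x. u (act G c x)) \<in> S"
proof -
  have eqx: "act G c x = s \<longleftrightarrow> x = act G (inv\<^bsub>G\<^esub> c) s" for x s using act_inv[OF c] by metis
  have ic: "inv\<^bsub>G\<^esub> c \<in> carrier G" using c by simp
  show ?thesis using u
  proof (induction rule: S.induct)
    case zero
    have "(\<lambda>x. (0 :: 'g node \<Rightarrow> rat) (act G c x)) = 0" by (simp add: zero_fun_def)
    thus ?case using S.zero by (simp only:)
  next
    case (step a m)
    have "(\<lambda>x. a (act G c x)) \<in> atoms"
      using step(1)
    proof (cases rule: atom_cases)
      case (vert s)
      have "(\<lambda>x. a (act G c x)) = local.vert (act G (inv\<^bsub>G\<^esub> c) s)"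
        unfolding vert(2) by (simp add: vert_def eqx)
      thus ?thesis using vert act_VG[OF ic] by (auto simp: atoms_def)
    next
      case (arc s t)
      have "(\<lambda>x. a (act G c x)) = local.arc (act G (inv\<^bsub>G\<^esub> c) s) (act G (inv\<^bsub>G\<^esub> c) t)"
        unfolding arc(2) arc_def act_lab eqx ..
      thus ?thesis using act_EG[OF ic arc(1)] by (auto simp: atoms_def)
    qed
    hence "(\<lambda>x. a (act G c x)) + (\<lambda>x. m (act G c x)) \<in> S" using step(3) by (rule S.step)
    thus ?case by (simp only: plus_fun_def)
  qed
qed

end

section \<open>Targets of each kind of node\<close>

locale group_families = group_coding G K p n lt + inverse_families VG EG labG K p n Phi Psi
  for G :: "'g monoid" and K :: "'k ring" (structure) and p n lt Phi Psi
begin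

lemma q_pn: "q = p ^ n" by (rule q_def)

sublocale rigid_families VG EG labG K p n Phi Psi
proof unfold_locales
  fix s N assume s: "s \<in> VG"
  have "\<exists>j. j > N \<and> (s, Pow j) \<in> EG"
  proof (cases s)
    case (Pow i)
    thus ?thesis by (intro exI[of _ "2 * (i + N + 1)"]) (simp add: EG_iff)
  next
    case (Cyc d)
    \<comment> \<open>The index is odd, exceeds \<open>N\<close>, and lies beyond the excluded
      \<open>2 * d + 1\<close>.\<close>
    thus ?thesis by (intro exI[of _ "2 * (d + N + 1) + 1"]) (simp add: EG_iff)
  next
    case (Ord a)
    thus ?thesis using s by (intro exI[of _ "2 * (N + 1)"]) (simp add: EG_iff)
  next
    case (Pair g a)
    thus ?thesis using s by (intro exI[of _ "2 * (N + 1)"]) (simp add: EG_iff)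
  qed
  then obtain j where j: "j > N" "(s, Pow j) \<in> EG" by blast
  show "\<exists>t j. (s, t) \<in> EG \<and> labG t = q ^ j \<and> j > N"
    using j by (intro exI[of _ "Pow j"] exI[of _ "j + 4"]) (simp add: q_pn)
qed

lemma power_eq: "(p ^ n) ^ i = (p ^ n) ^ j \<longleftrightarrow> i = j"
  using pn_ge_2 by (intro power_inject_exp) simp

text \<open>Both \<open>(p ^ n) ^ j\<close> and \<open>(p ^ n) ^ (d + 2)\<close> are divisible by
  \<open>p ^ n\<close>, so they cannot differ by 1.\<close>

lemma power_ne_cyc: "j \<ge> 1 \<Longrightarrow> (p ^ n) ^ j \<noteq> (p ^ n) ^ (d + 2) - 1"
proof
  assume j: "j \<ge> 1" and e: "(p ^ n) ^ j = (p ^ n) ^ (d + 2) - 1"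
  have "p ^ n dvd (p ^ n) ^ (d + 2)" "p ^ n dvd (p ^ n) ^ j" using j by (auto intro: dvd_power)
  hence "p ^ n dvd (p ^ n) ^ (d + 2) - (p ^ n) ^ j" by (rule dvd_diff_nat)
  moreover have "(p ^ n) ^ (d + 2) - (p ^ n) ^ j = 1" using e pn_power_ge[of "d + 2"] by simp
  ultimately have "p ^ n dvd 1" by (simp only:)
  thus False using pn_ge_2 by (simp only: nat_dvd_1_iff_1)
qed

lemma targets_step:
  assumes "(s, t) \<in> EG" "labG t = q ^ j" "j \<ge> 1" "v \<in> targets s" "r \<in> targets t"
  shows "(v, r) \<in> EG" "labG r = labG t"
  using targets_arc[OF assms] by auto

lemma targets_nonempty: "s \<in> VG \<Longrightarrow> \<exists>v. v \<in> targets s"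
  using targets_witness by metis

lemma targets_VG: "v \<in> targets s \<Longrightarrow> v \<in> VG"
  by (simp add: targets_def)

lemma targets_eqI: "s \<in> VG \<Longrightarrow> (\<And>v. v \<in> targets s \<Longrightarrow> v = w) \<Longrightarrow> targets s = {w}"
  using targets_nonempty by blast

text \<open>\<open>targets_arc\<close> controls labels only at the head of an arc whose label is a
  power of \<open>q\<close>, which is why an incoming arc is exhibited for each such kind of node
  below.\<close>

lemma targets_lab:
  assumes "(s, t) \<in> EG" "labG t = q ^ j" "j \<ge> 1" "r \<in> targets t"
  shows "labG r = labG t"
proof -
  obtain v where "v \<in> targets s" using targets_nonempty E_V[OF assms(1)] by blast
  thus ?thesis using targets_step(2)[OF assms(1-3) _ assms(4)] by blast
qed

lemma lab_noncyc:
  assumes "labG r = (p ^ n) ^ i" "i \<ge> 1"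
  obtains j where "r = Pow j" "i = j + 4" | b where "r = Ord b" "i = 3" | h b where "r = Pair h b" "i = 2"
proof (cases r)
  case (Cyc d)
  hence "(p ^ n) ^ i = (p ^ n) ^ (d + 2) - 1" using assms(1) by (simp only: node_lab.simps)
  thus thesis using power_ne_cyc[OF assms(2), of d] by (simp only: not_True_eq_False)
next
  case (Pow j)
  thus thesis using assms(1) that(1) by (simp only: node_lab.simps power_eq)
next
  case (Ord b)
  thus thesis using assms(1) that(2) by (simp only: node_lab.simps power_eq)
next
  case (Pair h b)
  thus thesis using assms(1) that(3) by (simp only: node_lab.simps power_eq)
qed

lemma lab_Pow:
  assumes "labG r = labG (Pow j)"
  shows "r = Pow j"
proof -
  have "labG r = (p ^ n) ^ (j + 4)" using assms by (simp only: node_lab.simps)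
  thus ?thesis by (rule lab_noncyc) simp_all
qed

lemma lab_Ord:
  assumes "labG r = labG (Ord a)"
  shows "\<exists>b. r = Ord b"
proof -
  have "labG r = (p ^ n) ^ 3" using assms by (simp only: node_lab.simps)
  thus ?thesis by (rule lab_noncyc) simp_all
qed

lemma lab_Pair:
  assumes "labG r = labG (Pair g a)"
  shows "\<exists>h b. r = Pair h b"
proof -
  have "labG r = (p ^ n) ^ 2" using assms by (simp only: node_lab.simps)
  thus ?thesis by (rule lab_noncyc) simp_all
qed

lemma targets_Pow: "targets (Pow j) = {Pow j}"
proof (rule targets_eqI)
  fix v assume v: "v \<in> targets (Pow j)"
  have "\<exists>s. (s, Pow j) \<in> EG"
  proof (cases "even j")
    case True
    thus ?thesis by (intro exI[of _ "Ord \<one>\<^bsub>G\<^esub>"]) (simp add: EG_iff)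
  next
    case False
    \<comment> \<open>\<open>Cyc j\<close> omits only the odd index \<open>2 * j + 1\<close>, so it
      does have an arc to \<open>Pow j\<close>.\<close>
    thus ?thesis by (intro exI[of _ "Cyc j"]) (simp add: EG_iff)
  qed
  then obtain s where "(s, Pow j) \<in> EG" by blast
  hence "labG v = labG (Pow j)" by (rule targets_lab[of _ _ "j + 4"]) (simp_all add: q_pn v)
  thus "v = Pow j" by (rule lab_Pow)
qed simp

lemma targets_to_Pow: "v \<in> targets s \<Longrightarrow> (s, Pow j) \<in> EG \<Longrightarrow> (v, Pow j) \<in> EG"
  using targets_step(1)[of s "Pow j" "j + 4" v "Pow j"] by (simp add: q_pn targets_Pow)

text \<open>The label of \<open>Cyc d\<close> is not a power of \<open>q\<close>, so
  \<open>targets_arc\<close> says nothing about arcs into it and the arcs out of it must do. Arcs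
  are preserved while their absence need not be, so \<open>Cyc d\<close> is named by the one odd
  index it misses: a different target \<open>Cyc d'\<close> would need an arc to
  \<open>Pow (2 * d' + 1)\<close>.\<close>

lemma targets_Cyc: "targets (Cyc d) = {Cyc d}"
proof (rule targets_eqI)
  fix v assume v: "v \<in> targets (Cyc d)"
  have adj: "adj G lt v (Pow j)" if "odd j" "j \<noteq> 2 * d + 1" for j
    using targets_to_Pow[OF v, of j] that by (simp add: EG_iff)
  \<comment> \<open>Only a \<open>Cyc\<close> node has an arc to a \<open>Pow\<close> of odd index;
    \<open>2 * d + 3\<close> is an odd index other than \<open>2 * d + 1\<close>.\<close>
  have "adj G lt v (Pow (2 * d + 3))" using adj[of "2 * d + 3"] by simp
  then obtain d' where d': "v = Cyc d'" by (cases v) auto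
  thus "v = Cyc d" using adj[of "2 * d' + 1"] by auto
qed simp

lemma targets_Ord_form:
  assumes a: "a \<in> carrier G" and v: "v \<in> targets (Ord a)"
  obtains b where "b \<in> carrier G" "v = Ord b"
proof -
  have "(Pair \<one>\<^bsub>G\<^esub> a, Ord a) \<in> EG" using a by (simp add: EG_iff)
  hence "labG v = labG (Ord a)" by (rule targets_lab[of _ _ 3]) (simp_all add: q_pn v)
  then obtain b where "v = Ord b" using lab_Ord by blast
  thus thesis using that targets_VG[OF v] by simp
qed

lemma targets_Ord_less:
  assumes "a \<in> carrier G" "b \<in> carrier G" "lt a b" "Ord u \<in> targets (Ord a)" "Ord w \<in> targets (Ord b)"
  shows "lt u w"
proof -
  have "(Ord a, Ord b) \<in> EG" using assms by (simp add: EG_iff)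
  hence "(Ord u, Ord w) \<in> EG" by (rule targets_step(1)[of _ _ 3]) (use assms in \<open>simp_all add: q_pn\<close>)
  thus ?thesis by (simp add: EG_iff)
qed

text \<open>The argument that an order preserving map of a well-order moves nothing down, in a form
  for several targets: if a target \<open>v\<close> of \<open>a\<close> were below \<open>a\<close>,
  then every target of \<open>v\<close> would be below \<open>v\<close>.\<close>

lemma targets_Ord_not_less:
  "a \<in> carrier G \<Longrightarrow> Ord v \<in> targets (Ord a) \<Longrightarrow> \<not> lt v a"
  using wf_less
proof (induction a arbitrary: v rule: wfp_induct_rule)
  case (less a)
  show ?case
  proof
    assume va: "lt v a"
    have v: "v \<in> carrier G" using targets_VG[OF less(3)] by simp
    obtain x where x: "x \<in> targets (Ord v)" using targets_nonempty[of "Ord v"] v by auto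
    then obtain u where u: "x = Ord u" using targets_Ord_form[OF v] by blast
    have "lt u v" using targets_Ord_less[OF v less(2) va _ less(3)] x u by simp
    thus False using less(1)[OF va v] x u by simp
  qed
qed

lemma swapped: "group_families G K p n lt Psi Phi"
  by (unfold_locales) (use inv1 inv2 in auto)

text \<open>Neither \<open>Phi\<close> nor, with the roles exchanged, \<open>Psi\<close> moves an
  element down. A target \<open>v\<close> of \<open>a\<close> from which \<open>Psi\<close> leads
  back to \<open>a\<close> is therefore \<open>a\<close>, so each element is a target of itself. A
  further target \<open>v\<close> above \<open>a\<close> would give \<open>lt v v\<close>, as
  \<open>v\<close> is a target of \<open>v\<close>.\<close>

lemma targets_Ord: 
  assumes a: "a \<in> carrier G"
  shows "targets (Ord a) = {Ord a}"
proof -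
  interpret W: group_families G K p n lt Psi Phi by (rule swapped)
  have self: "Ord a \<in> targets (Ord a)" if a: "a \<in> carrier G" for a
  proof -
    obtain x where x: "x \<in> targets (Ord a)" "Psi (vert x) (vert (Ord a)) \<noteq> \<zero>"
      using targets_witness[of "Ord a"] a by auto
    obtain v where v: "v \<in> carrier G" "x = Ord v" by (rule targets_Ord_form[OF a x(1)])
    have "Ord a \<in> W.targets (Ord v)" using x v a by (simp add: W.targets_def)
    hence "\<not> lt a v" using W.targets_Ord_not_less[OF v(1)] by simp
    moreover have "\<not> lt v a" using targets_Ord_not_less[OF a] x v by simp
    ultimately show ?thesis using total[OF a v(1)] x v by auto
  qed
  show ?thesis
  proof (rule targets_eqI)
    fix x assume x: "x \<in> targets (Ord a)"
    obtain v where v: "v \<in> carrier G" "x = Ord v" by (rule targets_Ord_form[OF a x])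
    show "x = Ord a"
    proof (rule ccontr)
      assume "x \<noteq> Ord a"
      hence "lt a v" using total[OF a v(1)] targets_Ord_not_less[OF a] x v by auto
      hence "lt v v" using targets_Ord_less[OF a v(1) _ _ self[OF v(1)]] x v by simp
      thus False using not_less_self by simp
    qed
  qed (use a in simp)
qed

lemma targets_Pair_form:
  assumes g: "g \<in> carrier G" "a \<in> carrier G" and v: "v \<in> targets (Pair g a)"
  obtains h where "h \<in> carrier G" "v = Pair h a"
proof -
  have "(Ord \<one>\<^bsub>G\<^esub>, Pair g a) \<in> EG" using g by (simp add: EG_iff)
  hence "labG v = labG (Pair g a)" by (rule targets_lab[of _ _ 2]) (simp_all add: q_pn v)
  then obtain h b where hb: "v = Pair h b" using lab_Pair by blast
  have "(Pair g a, Ord a) \<in> EG" using g by (simp add: EG_iff)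
  hence "(v, Ord a) \<in> EG"
    by (rule targets_step(1)[of _ _ 3]) (use v targets_Ord g in \<open>simp_all add: q_pn\<close>)
  hence "b = a" "h \<in> carrier G" by (simp_all add: EG_iff hb)
  thus thesis using that[of h] hb by simp
qed

lemma targets_Pair_arc:
  assumes "(Pair g a, Pair h b) \<in> EG" "u \<in> targets (Pair g a)" "w \<in> targets (Pair h b)"
  shows "(u, w) \<in> EG"
  by (rule targets_step(1)[OF assms(1), of 2]) (use assms in \<open>simp_all add: q_pn\<close>)

lemma targets_Pair_same:
  assumes g: "g \<in> carrier G" and a: "a \<in> carrier G" "a \<noteq> \<one>\<^bsub>G\<^esub>"
    and u: "Pair u a \<in> targets (Pair g a)" and w: "Pair w \<one>\<^bsub>G\<^esub> \<in> targets (Pair g \<one>\<^bsub>G\<^esub>)"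
  shows "u = w"
  using targets_Pair_arc[OF _ u w] g a by (simp add: EG_iff)

text \<open>The arcs from \<open>Pair g \<one>\<close> to \<open>Pair (g b) b\<close> make the
  induced map \<open>\<sigma>\<close> on first components commute with right multiplications; such a
  map is left multiplication by its value at the unit.\<close>

lemma targets_Pair:
  obtains c where "c \<in> carrier G"
    "\<And>g a. g \<in> carrier G \<Longrightarrow> a \<in> carrier G \<Longrightarrow> targets (Pair g a) = {Pair (c \<otimes>\<^bsub>G\<^esub> g) a}"
proof -
  let ?o = "\<one>\<^bsub>G\<^esub>"
  have ex: "\<exists>u. u \<in> carrier G \<and> Pair u a \<in> targets (Pair g a)" if ga: "g \<in> carrier G" "a \<in> carrier G" for g a
  proof -
    have "Pair g a \<in> VG" using ga by simp
    then obtain v where v: "v \<in> targets (Pair g a)" using targets_nonempty by metis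
    obtain h where "h \<in> carrier G" "v = Pair h a" by (rule targets_Pair_form[OF ga v])
    thus ?thesis using v by metis
  qed
  define \<sigma> where "\<sigma> g = (SOME u. u \<in> carrier G \<and> Pair u ?o \<in> targets (Pair g ?o))" for g
  have \<sigma>: "\<sigma> g \<in> carrier G" "Pair (\<sigma> g) ?o \<in> targets (Pair g ?o)" if "g \<in> carrier G" for g
    using someI_ex[OF ex[OF that G.one_closed]] unfolding \<sigma>_def by auto
  have tr: "x = y" if "carrier G = {?o}" "x \<in> carrier G" "y \<in> carrier G" for x y using that by simp
  \<comment> \<open>Two targets of \<open>Pair g \<one>\<close> are compared through a target of
    some \<open>Pair g a\<close> with \<open>a\<close> not the unit; the trivial group has no such
    \<open>a\<close> and is treated separately.\<close>
  have one: "u = \<sigma> g" if g: "g \<in> carrier G" and u: "Pair u ?o \<in> targets (Pair g ?o)" for g u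
  proof (cases "carrier G = {?o}")
    case True
    thus ?thesis using tr \<sigma>(1)[OF g] targets_VG[OF u] by simp
  next
    case False
    then obtain a where a: "a \<in> carrier G" "a \<noteq> ?o" using G.one_closed by blast
    obtain w where w: "Pair w a \<in> targets (Pair g a)" using ex[OF g a(1)] by blast
    show ?thesis using targets_Pair_same[OF g a w u] targets_Pair_same[OF g a w \<sigma>(2)[OF g]] by simp
  qed
  have all: "u = \<sigma> g" if g: "g \<in> carrier G" and a: "a \<in> carrier G" and u: "Pair u a \<in> targets (Pair g a)" for g a u
  proof (cases "a = ?o")
    case True
    thus ?thesis using one g u by simp
  next
    case False
    show ?thesis by (rule targets_Pair_same[OF g a False u \<sigma>(2)[OF g]])
  qed
  have mem: "Pair (\<sigma> g) a \<in> targets (Pair g a)" if g: "g \<in> carrier G" and a: "a \<in> carrier G" for g a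
    using ex[OF g a] all[OF g a] by auto
  have mult: "\<sigma> (g \<otimes>\<^bsub>G\<^esub> a) = \<sigma> g \<otimes>\<^bsub>G\<^esub> a" if g: "g \<in> carrier G" and a: "a \<in> carrier G" for g a
  proof (cases "a = ?o")
    case True
    thus ?thesis using g \<sigma>(1) by simp
  next
    case False
    have "(Pair g ?o, Pair (g \<otimes>\<^bsub>G\<^esub> a) a) \<in> EG" using g a False by (simp add: EG_iff)
    hence "(Pair (\<sigma> g) ?o, Pair (\<sigma> (g \<otimes>\<^bsub>G\<^esub> a)) a) \<in> EG"
      by (rule targets_Pair_arc[OF _ \<sigma>(2)[OF g] mem]) (use g a in auto)
    thus ?thesis using False by (simp add: EG_iff)
  qed
  show thesis
  proof (rule that[of "\<sigma> ?o"])
    show "\<sigma> ?o \<in> carrier G" using \<sigma> by simp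
    fix g a assume g: "g \<in> carrier G" and a: "a \<in> carrier G"
    have "\<sigma> g = \<sigma> ?o \<otimes>\<^bsub>G\<^esub> g" using mult[OF G.one_closed g] g by simp
    moreover have "targets (Pair g a) = {Pair (\<sigma> g) a}"
    proof (rule targets_eqI)
      fix v assume v: "v \<in> targets (Pair g a)"
      obtain h where h: "v = Pair h a" using targets_Pair_form[OF g a v] by metis
      thus "v = Pair (\<sigma> g) a" using all[OF g a] v by simp
    qed (use g a in simp)
    ultimately show "targets (Pair g a) = {Pair (\<sigma> ?o \<otimes>\<^bsub>G\<^esub> g) a}" by simp
  qed
qed

lemma families_act:
  obtains c where "c \<in> carrier G"
    "\<And>u. u \<in> S \<Longrightarrow> Phi u = mono \<one> (\<lambda>x. u (act G (inv\<^bsub>G\<^esub> c) x))"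
proof -
  obtain c where c: "c \<in> carrier G"
    "\<And>g a. g \<in> carrier G \<Longrightarrow> a \<in> carrier G \<Longrightarrow> targets (Pair g a) = {Pair (c \<otimes>\<^bsub>G\<^esub> g) a}"
    using targets_Pair by blast
  have targets: "targets s = {act G c s}" if "s \<in> VG" for s
    using that by (cases s) (simp_all add: targets_Pow targets_Cyc targets_Ord c)
  interpret M: monomial_families VG EG labG K p n Phi Psi "act G c"
    by unfold_locales (rule targets)
  have cyc_arc: "act G c s \<noteq> act G c (Cyc d)" if "(s, Cyc d) \<in> EG" for s d
    using E_irrefl[OF act_EG[OF c(1) that]] .
  have lab_act: "labG (act G c t) = labG t" for t by (rule act_lab)
  have to_cyc: "\<exists>e\<ge>d. (s, Cyc e) \<in> EG" if "s \<in> VG" for s d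
  proof (cases s)
    case (Cyc k)
    thus ?thesis by (intro exI[of _ "d + k + 1"]) (simp add: EG_iff)
  qed (use that in \<open>auto simp: EG_iff\<close>)
  \<comment> \<open>Every node is the source of an arc to some \<open>Cyc e\<close>, and such an arc
    forces the scalar of its source to be 1.\<close>
  have one: "M.coeff s = \<one>" if s: "s \<in> VG" for s
  proof -
    obtain e where e: "(s, Cyc e) \<in> EG" using to_cyc[OF s] by blast
    show ?thesis
      by (rule M.arc_image(1)[OF e, of "e + 2"]) (simp_all only: node_lab.simps q_pn lab_act cyc_arc[OF e] le_add2 not_False_eq_True)
  qed
  have vert_img: "Phi (vert s) = mono \<one> (vert (act G c s))" if "s \<in> VG" for s
    using M.Phi_vert[OF that] one[OF that] by simp
  have arc_img: "Phi (arc s t) = mono \<one> (arc (act G c s) (act G c t))" if st: "(s, t) \<in> EG" for s t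
  proof -
    note V = E_V[OF st]
    have pow: ?thesis if "labG t = q ^ j" "j \<ge> 1" for j
      by (rule M.Phi_arc_power(3)[OF st that]) (use V one in auto)
    show ?thesis
    proof (cases t)
      case (Pow j)
      thus ?thesis using pow[of "j + 4"] by (simp add: q_pn)
    next
      case (Ord a)
      thus ?thesis using pow[of 3] by (simp add: q_pn)
    next
      case (Pair g a)
      thus ?thesis using pow[of 2] by (simp add: q_pn)
    next
      case (Cyc d)
      \<comment> \<open>The partner arc must have label \<open>q^((d + 2) (q - 1)) - 1\<close>, and
        \<open>Cyc d'\<close> has label \<open>q^(d' + 2) - 1\<close>; hence the subtraction of 2 in
        \<open>d'\<close>. By \<open>d' >= d\<close> the node \<open>s\<close> has an arc to
        \<open>Cyc d'\<close> as well.\<close>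
      define D where "D = (d + 2) * (q - 1)"
      have "q - 1 \<ge> 1" using q_gt_1 by simp
      hence "D \<ge> d + 2" using mult_le_mono2[of 1 "q - 1" "d + 2"] by (simp only: D_def mult_1_right)
      define d' where "d' = D - 2"
      have d': "d' + 2 = D" "d' \<ge> d" using \<open>D \<ge> d + 2\<close> by (auto simp: d'_def)
      have "(s, Cyc d) \<in> EG" using st Cyc by simp
      hence st': "(s, Cyc d') \<in> EG" using d'(2) by (cases s) (auto simp: EG_iff)
      have l': "labG (Cyc d') = q ^ ((d + 2) * (q - 1)) - 1"
        unfolding node_lab.simps d'(1) D_def q_pn ..
      have l: "labG t = q ^ (d + 2) - 1" using Cyc by (simp add: q_pn)
      show ?thesis
        by (rule M.Phi_arc_cyclotomic[OF st st' l l'])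
          (use V one lab_act cyc_arc st st' Cyc in auto)
    qed
  qed
  have "Phi u = mono \<one> (\<lambda>x. u (act G (inv\<^bsub>G\<^esub> c) x))" if "u \<in> S" for u
    by (rule M.Phi_perm[OF act_inv[OF c(1)] vert_img arc_img act_S lab_act that]) (use c in auto)
  thus thesis using that c by blast
qed

end

subsection \<open>Coalgebras with a prescribed automorphism group\<close>

locale group_coalgebra = group_coding G K p n lt
  for G :: "'g monoid" and K :: "'k ring" (structure) and p n lt +
  fixes \<iota> :: "(('g node \<Rightarrow> rat) \<Rightarrow> 'k) \<Rightarrow> 'c"
  assumes inj_\<iota>: "inj_on \<iota> (carrier (free_module K S))"
begin

sublocale monoid_coalgebra K S \<iota>
  by unfold_locales (rule inj_\<iota>)

text \<open>Columns outside \<open>S\<close> are set to zero so that each row is an element of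
  \<open>conv_ring\<close>; the row index comes first, since it is the index in which the family is
  multiplicative.\<close>

definition matrix :: "('c \<Rightarrow> 'c) \<Rightarrow> ('g node \<Rightarrow> rat) \<Rightarrow> ('g node \<Rightarrow> rat) \<Rightarrow> 'k"
  where "matrix f u m = (if m \<in> S then coef u (f (bas m)) else \<zero>)"

lemma hom_closed: "f \<in> coalgebra_hom K C C \<Longrightarrow> m \<in> S \<Longrightarrow> f (bas m) \<in> carrier C"
  by (rule module_homD(1)[OF coalgebra_homD(1) bas_mem])

lemma matrix_closed: "f \<in> coalgebra_hom K C C \<Longrightarrow> matrix f u m \<in> carrier K"
  by (simp add: matrix_def coef_closed hom_closed)

lemma matrix_family:
  assumes f: "f \<in> coalgebra_hom K C C"
  shows "multiplicative_family VG EG labG K p n (matrix f)"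
proof unfold_locales
  show "matrix f u \<in> carrier conv_ring" for u
    by (rule conv_carrierI[OF matrix_closed[OF f]]) (simp add: matrix_def)
  show "matrix f 0 = \<one>\<^bsub>conv_ring\<^esub>"
  proof
    show "matrix f 0 m = \<one>\<^bsub>conv_ring\<^esub> m" for m
      unfolding conv_sel matrix_def using coef_0_coalgebra_hom[OF f, of m] zero_mem
      by (cases "m \<in> S"; cases "m = 0") (simp_all only: if_True if_False)
  qed
  fix u w assume uw: "u \<in> S" "w \<in> S"
  show "matrix f (u + w) = matrix f u \<otimes>\<^bsub>conv_ring\<^esub> matrix f w"
  proof
    fix m
    show "matrix f (u + w) m = (matrix f u \<otimes>\<^bsub>conv_ring\<^esub> matrix f w) m"
    proof (cases "m \<in> S")
      case True
      have "matrix f (u + w) m = (\<Oplus>z\<in>decomp m. coef u (f (bas (fst z))) \<otimes> coef w (f (bas (snd z))))"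
        unfolding matrix_def using coef_coalgebra_hom[OF f True uw] True by (simp only: if_True)
      also have "\<dots> = (\<Oplus>z\<in>decomp m. matrix f u (fst z) \<otimes> matrix f w (snd z))"
        by (rule K.finsum_cong') (auto simp: matrix_def decomp_mem coef_closed hom_closed[OF f])
      finally show ?thesis by (simp only: conv_sel)
    next
      case False
      thus ?thesis by (simp add: matrix_def conv_sel decomp_outside)
    qed
  qed
next
  fix m
  show "finite {u \<in> S. matrix f u m \<noteq> \<zero>}"
  proof (cases "m \<in> S")
    case True
    have "finite {u. coef u (f (bas m)) \<noteq> \<zero>}" by (rule finite_coef[OF hom_closed[OF f True]])
    thus ?thesis by (rule rev_finite_subset) (auto simp: matrix_def True)
  qed (simp add: matrix_def)
qed

text \<open>The coefficient of \<open>bas y\<close> in \<open>f (g (bas y))\<close> is 1, and it is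
  a sum of products of entries over the intermediate \<open>m\<close>, so one of these products is
  nonzero.\<close>

lemma matrix_inverse:
  assumes f: "f \<in> coalgebra_hom K C C" and g: "g \<in> coalgebra_hom K C C"
    and fg: "\<And>x. x \<in> carrier C \<Longrightarrow> f (g x) = x" and y: "y \<in> S"
  shows "\<exists>m\<in>S. matrix g m y \<noteq> \<zero> \<and> matrix f y m \<noteq> \<zero>"
proof -
  note gb = hom_closed[OF g y]
  have "coef y (f (g (bas y))) = \<one>" using fg[OF bas_mem[OF y]] coef_bas[OF y, of y] by simp
  hence "(\<Oplus>m\<in>{m. coef m (g (bas y)) \<noteq> \<zero>}. coef m (g (bas y)) \<otimes> coef y (f (bas m))) \<noteq> \<zero>"
    unfolding coef_comp[OF coalgebra_homD(1)[OF f] gb] by simp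
  then obtain m where m: "coef m (g (bas y)) \<noteq> \<zero>" "coef m (g (bas y)) \<otimes> coef y (f (bas m)) \<noteq> \<zero>"
    by (rule K.finsum_nonzeroD) simp
  have mS: "m \<in> S" using m(1) coef_outside[OF gb, of m] by metis
  have "coef y (f (bas m)) \<noteq> \<zero>" using m(2) coef_closed[OF gb, of m] by auto
  thus ?thesis using m(1) mS y by (intro bexI[of _ m]) (simp_all add: matrix_def)
qed

text \<open>Composition with the inverse makes \<open>c\<close> act from the left, so that
  \<open>trans\<close> is multiplicative in \<open>c\<close>.\<close>

definition trans :: "'g \<Rightarrow> ('g node \<Rightarrow> rat) \<Rightarrow> 'g node \<Rightarrow> rat"
  where "trans c m = (\<lambda>x. m (act G (inv\<^bsub>G\<^esub> c) x))"

lemma trans_mem: "c \<in> carrier G \<Longrightarrow> trans c \<in> S \<rightarrow> S"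
  unfolding trans_def by (intro Pi_I act_S G.inv_closed)

lemma trans_trans:
  "c \<in> carrier G \<Longrightarrow> d \<in> carrier G \<Longrightarrow> trans c (trans d m) = trans (c \<otimes>\<^bsub>G\<^esub> d) m"
  by (simp add: trans_def act_act G.inv_mult_group)

lemma trans_inv:
  assumes "c \<in> carrier G"
  shows "trans c (trans (inv\<^bsub>G\<^esub> c) m) = m" "trans (inv\<^bsub>G\<^esub> c) (trans c m) = m"
  using assms by (simp_all add: trans_trans) (simp_all add: trans_def act_one)

lemma trans_auto:
  assumes c: "c \<in> carrier G"
  shows "perm_map (trans c) \<in> coalgebra_auto K C"
proof (rule perm_map_auto)
  have "trans c \<in> S \<rightarrow> S" "trans (inv\<^bsub>G\<^esub> c) \<in> S \<rightarrow> S" using c by (auto intro!: trans_mem[THEN funcset_mem])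
  thus "bij_betw (trans c) S S"
    by (intro bij_betw_byWitness[where f'="trans (inv\<^bsub>G\<^esub> c)"]) (use trans_inv[OF c] in auto)
  show "trans c (u + w) = trans c u + trans c w" for u w
    by (simp only: trans_def plus_fun_def)
  show "trans c 0 = 0" by (simp only: trans_def zero_fun_def)
qed

text \<open>\<open>families_act\<close> describes rows: row \<open>u\<close> has its only entry at
  \<open>m = trans c u\<close>. Read by columns, \<open>bas m\<close> goes to the basis element
  obtained from \<open>m\<close> by the inverse translation, which is where the inverse of
  \<open>c\<close> comes from.\<close>

lemma auto_trans:
  assumes f: "f \<in> coalgebra_auto K C"
  obtains c where "c \<in> carrier G" "f = perm_map (trans c)"
proof -
  have fh: "f \<in> coalgebra_hom K C C" using f by (simp add: coalgebra_auto_def)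
  obtain g where g: "g \<in> coalgebra_hom K C C" "\<And>x. x \<in> carrier C \<Longrightarrow> g (f x) = x"
    "\<And>x. x \<in> carrier C \<Longrightarrow> f (g x) = x"
    using coalgebra_auto_inverse[OF f] by metis
  interpret F: multiplicative_family VG EG labG K p n "matrix f" by (rule matrix_family[OF fh])
  interpret Psi: multiplicative_family VG EG labG K p n "matrix g" by (rule matrix_family[OF g(1)])
  interpret R: group_families G K p n lt "matrix f" "matrix g"
    by unfold_locales (use matrix_inverse[OF fh g(1,3)] matrix_inverse[OF g(1) fh g(2)] in auto)
  obtain c where c: "c \<in> carrier G" "\<And>u. u \<in> S \<Longrightarrow> matrix f u = mono \<one> (trans c u)"
    using R.families_act unfolding trans_def by metis
  note ic = G.inv_closed[OF c(1)]
  have "f (bas m) = bas (trans (inv\<^bsub>G\<^esub> c) m)" if m: "m \<in> S" for m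
  proof (rule coef_eqI[OF hom_closed[OF fh m]])
    have tm: "trans (inv\<^bsub>G\<^esub> c) m \<in> S" using trans_mem[OF ic] m by auto
    show "bas (trans (inv\<^bsub>G\<^esub> c) m) \<in> carrier C" by (rule bas_mem[OF tm])
    fix u
    show "coef u (f (bas m)) = coef u (bas (trans (inv\<^bsub>G\<^esub> c) m))"
    proof (cases "u \<in> S")
      case True
      have "coef u (f (bas m)) = mono \<one> (trans c u) m"
        using fun_cong[OF c(2)[OF True], of m] m by (simp only: matrix_def if_True)
      moreover have "m = trans c u \<longleftrightarrow> u = trans (inv\<^bsub>G\<^esub> c) m" using trans_inv[OF c(1)] by metis
      ultimately show ?thesis by (simp add: mono_def coef_bas[OF tm])
    next
      case False
      thus ?thesis using coef_outside[OF hom_closed[OF fh m] False] coef_outside[OF bas_mem[OF tm] False] by simp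
    qed
  qed
  hence "f = perm_map (trans (inv\<^bsub>G\<^esub> c))" by (rule eq_perm_mapI[OF trans_mem[OF ic] f])
  thus thesis using that ic by blast
qed

lemma trans_iso: "(\<lambda>c. perm_map (trans c)) \<in> iso G (coalgebra_AutoGroup K C)"
  unfolding iso_def
proof (intro CollectI conjI homI)
  fix c assume c: "c \<in> carrier G"
  show "perm_map (trans c) \<in> carrier (coalgebra_AutoGroup K C)"
    using trans_auto[OF c] by (simp add: coalgebra_AutoGroup_def)
  fix d assume d: "d \<in> carrier G"
  have bij: "perm_map (trans e) \<in> Bij (carrier C)" if "e \<in> carrier G" for e
    using trans_auto[OF that] by (simp add: coalgebra_auto_def)
  have "perm_map (trans (c \<otimes>\<^bsub>G\<^esub> d)) = compose (carrier C) (perm_map (trans c)) (perm_map (trans d))"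
  proof (rule extensionalityI[of _ "carrier C"])
    show "perm_map (trans (c \<otimes>\<^bsub>G\<^esub> d)) \<in> extensional (carrier C)" by (simp add: perm_map_def)
    show "compose (carrier C) (perm_map (trans c)) (perm_map (trans d)) \<in> extensional (carrier C)" by simp
    fix x assume x: "x \<in> carrier C"
    show "perm_map (trans (c \<otimes>\<^bsub>G\<^esub> d)) x = compose (carrier C) (perm_map (trans c)) (perm_map (trans d)) x"
      using perm_map_comp[OF trans_mem[OF c] trans_mem[OF d] x] x by (simp add: compose_def trans_trans[OF c d])
  qed
  thus "perm_map (trans (c \<otimes>\<^bsub>G\<^esub> d)) = perm_map (trans c) \<otimes>\<^bsub>coalgebra_AutoGroup K C\<^esub> perm_map (trans d)"
    using bij c d by (simp add: coalgebra_AutoGroup_def BijGroup_def)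
next
  show "bij_betw (\<lambda>c. perm_map (trans c)) (carrier G) (carrier (coalgebra_AutoGroup K C))"
    unfolding bij_betw_def
  proof
    \<comment> \<open>Translation by \<open>c\<close> moves this vertex to the one at
      \<open>Pair c \<one>\<close>, so its image recovers \<open>c\<close>.\<close>
    let ?v = "local.vert (Pair \<one>\<^bsub>G\<^esub> \<one>\<^bsub>G\<^esub>) :: 'g node \<Rightarrow> rat"
    show "inj_on (\<lambda>c. perm_map (trans c)) (carrier G)"
    proof (rule inj_onI)
      fix c d assume c: "c \<in> carrier G" and d: "d \<in> carrier G" and eq: "perm_map (trans c) = perm_map (trans d)"
      have v: "?v \<in> S" by (rule vert_S) simp
      have "bas (trans c ?v) = bas (trans d ?v)"
        using perm_map_bas[OF trans_mem[OF c] v] perm_map_bas[OF trans_mem[OF d] v] eq by simp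
      moreover have "trans c ?v \<in> S" "trans d ?v \<in> S" using funcset_mem[OF trans_mem v] c d by simp_all
      ultimately have "trans c ?v = trans d ?v"
        using coef_bas[of "trans c ?v" "trans c ?v"] coef_bas[of "trans d ?v" "trans c ?v"] by (metis K.one_not_zero)
      hence "trans c ?v (Pair c \<one>\<^bsub>G\<^esub>) = trans d ?v (Pair c \<one>\<^bsub>G\<^esub>)" by simp
      hence "inv\<^bsub>G\<^esub> d \<otimes>\<^bsub>G\<^esub> c = \<one>\<^bsub>G\<^esub>" using c d by (simp add: trans_def vert_def split: if_splits)
      thus "c = d" using c d by (metis G.inv_equality G.inv_inv G.inv_closed)
    qed
    show "(\<lambda>c. perm_map (trans c)) ` carrier G = carrier (coalgebra_AutoGroup K C)"
    proof
      show "(\<lambda>c. perm_map (trans c)) ` carrier G \<subseteq> carrier (coalgebra_AutoGroup K C)"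
        using trans_auto by (auto simp: coalgebra_AutoGroup_def)
      show "carrier (coalgebra_AutoGroup K C) \<subseteq> (\<lambda>c. perm_map (trans c)) ` carrier G"
      proof
        fix f assume "f \<in> carrier (coalgebra_AutoGroup K C)"
        hence "f \<in> coalgebra_auto K C" by (simp add: coalgebra_AutoGroup_def)
        then obtain c where "c \<in> carrier G" "f = perm_map (trans c)" by (rule auto_trans)
        thus "f \<in> (\<lambda>c. perm_map (trans c)) ` carrier G" by (intro image_eqI)
      qed
    qed
  qed
qed

end

section \<open>Embedding the coalgebra into an infinite type\<close>

lemma infinite_inj_list:
  assumes "infinite (UNIV :: 'c set)"
  obtains h :: "'c list \<Rightarrow> 'c" and t :: "nat \<Rightarrow> 'c" where "inj h" "inj t"
proof -
  obtain t :: "nat \<Rightarrow> 'c" where t: "inj t" using infinite_countable_subset[OF assms] by auto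
  obtain f :: "'c \<times> 'c \<Rightarrow> 'c" where "bij_betw f (UNIV \<times> UNIV) UNIV"
    using card_of_Times_same_infinite[OF assms] card_of_ordIso by blast
  hence f: "f (a, b) = f (c, d) \<longleftrightarrow> a = c \<and> b = d" for a b c d
    using inj_on_eq_iff[OF bij_betw_imp_inj_on, of f "UNIV \<times> UNIV" UNIV "(a, b)" "(c, d)"] by simp
  \<comment> \<open>Iterated pairing alone does not mark where a list ends, so the length is stored
    along with it; \<open>t 0\<close> is an arbitrary start value.\<close>
  define g where "g xs = rec_list (t 0) (\<lambda>x _ y. f (x, y)) xs" for xs
  have g: "xs = ys" if "length xs = length ys" "g xs = g ys" for xs ys
    using that by (induction xs ys rule: list_induct2) (auto simp: g_def f)
  have "inj (\<lambda>xs. f (t (length xs), g xs))"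
    using g t by (auto intro!: injI simp: f inj_eq)
  thus thesis using that t by blast
qed

text \<open>A function is encoded by a list of its argument-value pairs over the support. The
  enumeration \<open>L f\<close> is an arbitrary choice; injectivity uses only the set of entries,
  which is the graph of the function on its support.\<close>

lemma finite_support_inj:
  fixes i :: "'a \<Rightarrow> 'c" and j :: "'b \<Rightarrow> 'c"
  assumes inf: "infinite (UNIV :: 'c set)" and i: "inj_on i A" and j: "inj_on j B"
  obtains h :: "('a \<Rightarrow> 'b) \<Rightarrow> 'c"
  where "inj_on h {f. finite {x. f x \<noteq> z} \<and> {x. f x \<noteq> z} \<subseteq> A \<and> f ` A \<subseteq> B}"
proof -
  obtain l :: "'c list \<Rightarrow> 'c" and t :: "nat \<Rightarrow> 'c" where l: "inj l" using inf by (rule infinite_inj_list)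
  define L where "L f = (SOME xs. set xs = {x. f x \<noteq> z})" for f :: "'a \<Rightarrow> 'b"
  have L: "set (L f) = {x. f x \<noteq> z}" if "finite {x. f x \<noteq> z}" for f
    unfolding L_def using finite_list[OF that] by (rule someI_ex)
  define h where "h f = l (map (\<lambda>x. l [i x, j (f x)]) (L f))" for f
  have le: "l xs = l ys \<longleftrightarrow> xs = ys" for xs ys using l by (simp add: inj_eq)
  have "inj_on h {f. finite {x. f x \<noteq> z} \<and> {x. f x \<noteq> z} \<subseteq> A \<and> f ` A \<subseteq> B}"
  proof (rule inj_onI, clarify)
    fix f g assume f: "finite {x. f x \<noteq> z}" "{x. f x \<noteq> z} \<subseteq> A" "f ` A \<subseteq> B"
      and g: "finite {x. g x \<noteq> z}" "{x. g x \<noteq> z} \<subseteq> A" "g ` A \<subseteq> B" and eq: "h f = h g"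
    have "map (\<lambda>x. l [i x, j (f x)]) (L f) = map (\<lambda>x. l [i x, j (g x)]) (L g)"
      using eq by (simp only: h_def le)
    hence "set (map (\<lambda>x. l [i x, j (f x)]) (L f)) = set (map (\<lambda>x. l [i x, j (g x)]) (L g))" by (rule arg_cong)
    hence im: "(\<lambda>x. l [i x, j (f x)]) ` {x. f x \<noteq> z} = (\<lambda>x. l [i x, j (g x)]) ` {x. g x \<noteq> z}"
      by (simp only: set_map L[OF f(1)] L[OF g(1)])
    have key: "v x = u x" if u: "{x. u x \<noteq> z} \<subseteq> A" "u ` A \<subseteq> B" and v: "{x. v x \<noteq> z} \<subseteq> A" "v ` A \<subseteq> B"
      and sub: "(\<lambda>x. l [i x, j (u x)]) ` {x. u x \<noteq> z} \<subseteq> (\<lambda>x. l [i x, j (v x)]) ` {x. v x \<noteq> z}"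
      and x: "u x \<noteq> z" for u v x
    proof -
      have "l [i x, j (u x)] \<in> (\<lambda>x. l [i x, j (v x)]) ` {x. v x \<noteq> z}"
        by (rule subsetD[OF sub]) (use x in blast)
      then obtain y where y: "v y \<noteq> z" "l [i x, j (u x)] = l [i y, j (v y)]" by blast
      have "i x = i y" "j (u x) = j (v y)" using y(2) by (simp_all only: le list.inject)
      moreover have "x \<in> A" "y \<in> A" using u v x y by auto
      moreover from this have "u x \<in> B" "v y \<in> B" using u v by auto
      ultimately have "x = y" "u x = v y" using i j by (auto dest: inj_onD)
      thus ?thesis by simp
    qed
    show "f = g"
    proof
      fix x
      show "f x = g x"
      proof (cases "f x = z \<and> g x = z")
        case False
        then consider "f x \<noteq> z" | "g x \<noteq> z" by blast
        thus ?thesis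
        proof cases
          case 1
          show ?thesis by (rule key[OF f(2,3) g(2,3) equalityD1[OF im] 1, symmetric])
        next
          case 2
          show ?thesis by (rule key[OF g(2,3) f(2,3) equalityD2[OF im] 2])
        qed
      qed simp
    qed
  qed
  thus thesis by (rule that)
qed

lemma node_inj:
  fixes e :: "'g \<Rightarrow> 'c"
  assumes inf: "infinite (UNIV :: 'c set)" and e: "inj e"
  obtains i :: "'g node \<Rightarrow> 'c" where "inj i"
proof -
  obtain l :: "'c list \<Rightarrow> 'c" and t :: "nat \<Rightarrow> 'c" where l: "inj l" and t: "inj t"
    using inf by (rule infinite_inj_list)
  \<comment> \<open>The lengths 2, 1 and 3 keep the kinds apart, with a tag for the two kinds of
    length 2; the repeated \<open>e a\<close> only fills up to length 3.\<close>
  define k :: "'g node \<Rightarrow> 'c list" where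
    "k s = (case s of Pow j \<Rightarrow> [t 0, t j] | Cyc d \<Rightarrow> [t 1, t d] | Ord a \<Rightarrow> [e a] | Pair g a \<Rightarrow> [e g, e a, e a])" for s
  have "inj k" using e t by (intro injI) (auto simp: k_def inj_eq split: node.splits)
  hence "inj (\<lambda>s. l (k s))" using l by (auto simp: inj_def)
  thus thesis by (rule that)
qed

theorem rigid_coalgebra_exists:
  fixes G :: "'g monoid" and K :: "'k ring" and e :: "'g \<Rightarrow> 'c"
  assumes G: "group G" and K: "field K" "finite (carrier K)" "order K = p ^ n" "Factorial_Ring.prime p"
    and inf: "infinite (UNIV :: 'c set)" and e: "inj e"
  obtains C :: "('k, 'c) coalgebra" where "coalgebra K C" "G \<cong> coalgebra_AutoGroup K C"
proof -
  obtain r where r: "well_order_on (carrier G) r" using well_order_on by blast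
  define lt where "lt a b \<longleftrightarrow> (a, b) \<in> r - Id" for a b
  interpret group G by (rule G)
  interpret K: field K by (rule K)
  interpret group_coding G K p n lt
  proof unfold_locales
    show "wfp lt" unfolding lt_def wfp_wf_eq using r by (simp only: well_order_on_def)
    show "lt a b \<or> lt b a" if "a \<in> carrier G" "b \<in> carrier G" "a \<noteq> b" for a b
      using r that by (auto simp: lt_def well_order_on_def linear_order_on_def total_on_def)
  qed (use K in auto)
  obtain i :: "'g node \<Rightarrow> 'c" where i: "inj i" using node_inj[OF inf e] by metis
  obtain t :: "nat \<Rightarrow> 'c" where t: "inj t" using infinite_countable_subset[OF inf] by auto
  have tr: "inj_on (\<lambda>x. t (to_nat (x :: rat))) UNIV" using t inj_to_nat[where ?'a=rat] by (auto intro!: inj_onI dest!: injD)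
  \<comment> \<open>The encoding is applied twice: here to the monoid elements, as rational
    functions on the nodes, and then to the free module over the monoid.\<close>
  obtain h :: "('g node \<Rightarrow> rat) \<Rightarrow> 'c"
    where h: "inj_on h {f. finite {x. f x \<noteq> 0} \<and> {x. f x \<noteq> 0} \<subseteq> UNIV \<and> f ` UNIV \<subseteq> UNIV}"
    by (rule finite_support_inj[OF inf i tr])
  have hS: "inj_on h S" by (rule inj_on_subset[OF h]) (use S_support in auto)
  \<comment> \<open>The type \<open>'k\<close> may fail to embed into \<open>'c\<close>, but the
    finite carrier embeds into the naturals and through them into \<open>'c\<close>.\<close>
  obtain k :: "'k \<Rightarrow> nat" where "inj_on k (carrier K)" using finite_imp_inj_to_nat_seg[OF K(2)] by metis
  hence tk: "inj_on (\<lambda>x. t (k x)) (carrier K)" using t by (auto simp: inj_on_def)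
  obtain \<iota> :: "(('g node \<Rightarrow> rat) \<Rightarrow> 'k) \<Rightarrow> 'c"
    where \<iota>: "inj_on \<iota> {f. finite {x. f x \<noteq> \<zero>\<^bsub>K\<^esub>} \<and> {x. f x \<noteq> \<zero>\<^bsub>K\<^esub>} \<subseteq> S \<and> f ` S \<subseteq> carrier K}"
    by (rule finite_support_inj[OF inf hS tk])
  interpret group_coalgebra G K p n lt \<iota>
    by unfold_locales (rule inj_on_subset[OF \<iota>], auto simp: free_module_def)
  show thesis by (rule that[OF coalgebra_C]) (use trans_iso in \<open>auto simp: is_iso_def\<close>)
qed

section \<open>Mutual embeddings of co-Hopfian groups and the equivalence\<close>

lemma mon_comp:
  assumes f: "f \<in> mon G H" and g: "g \<in> mon H I"
  shows "g \<circ> f \<in> mon G I"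
proof -
  have h: "f \<in> hom G H" "g \<in> hom H I" and i: "inj_on f (carrier G)" "inj_on g (carrier H)"
    using f g by (simp_all add: mon_def)
  have "inj_on (g \<circ> f) (carrier G)" by (rule comp_inj_on[OF i(1) inj_on_subset[OF i(2) hom_carrier[OF h(1)]]])
  thus ?thesis using Group.hom_compose[OF h] by (simp add: mon_def)
qed

text \<open>\<open>co_Hopfian\<close> speaks of subgroups: the image of an injective endomorphism is
  a subgroup isomorphic to the group, hence all of it.\<close>

lemma co_Hopfian_surj:
  assumes G: "group G" "co_Hopfian G" and f: "f \<in> mon G G"
  shows "f ` carrier G = carrier G"
proof -
  interpret group_hom G G f using G f by (simp add: group_hom_def group_hom_axioms_def mon_def)
  have sub: "subgroup (f ` carrier G) G" by (rule img_is_subgroup)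
  have "f \<in> iso G (G\<lparr>carrier := f ` carrier G\<rparr>)"
    using f by (auto simp: iso_def mon_def hom_def bij_betw_def)
  hence "G\<lparr>carrier := f ` carrier G\<rparr> \<cong> G" using group.iso_sym[OF G(1)] by (auto simp: is_iso_def)
  with sub show ?thesis by (intro G(2)[unfolded co_Hopfian_def, rule_format] conjI)
qed

text \<open>The composite of \<open>f\<close> with \<open>g\<close> is an injective endomorphism of
  \<open>G\<close> and thus onto by \<open>co_Hopfian_surj\<close>, so \<open>g\<close> is already
  onto.\<close>

lemma co_Hopfian_iso:
  assumes G: "group G" "co_Hopfian G" and H: "group H" and f: "f \<in> mon G H" and g: "g \<in> mon H G"
  shows "G \<cong> H"
proof -
  have fg: "(g \<circ> f) ` carrier G = carrier G" by (rule co_Hopfian_surj[OF G mon_comp[OF f g]])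
  have "f ` carrier G \<subseteq> carrier H" using f by (auto simp: mon_def dest: hom_carrier)
  hence "(g \<circ> f) ` carrier G \<subseteq> g ` carrier H" by auto
  hence "carrier G \<subseteq> g ` carrier H" unfolding fg .
  moreover have "g ` carrier H \<subseteq> carrier G" using g by (auto simp: mon_def hom_def)
  ultimately have "g ` carrier H = carrier G" by (rule subset_antisym[rotated])
  hence "g \<in> iso H G" using g by (simp add: iso_def mon_def bij_betw_def)
  thus ?thesis using group.iso_sym[OF H] by (auto simp: is_iso_def)
qed

lemma acts_faithfully_mon:
  assumes f: "f \<in> mon G H" and H: "acts_faithfully K H C"
  shows "acts_faithfully K G C"
  using H mon_comp[OF f] unfolding acts_faithfully_def by blast

lemma iso_mon:
  assumes "group G" "G \<cong> H"
  obtains f g where "f \<in> mon G H" "g \<in> mon H G"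
proof -
  have "H \<cong> G" using group.iso_sym[OF assms] .
  with assms show thesis using that by (auto simp: is_iso_def iso_def mon_def bij_betw_def)
qed

lemma faithful_embedding:
  fixes G :: "'g monoid" and H :: "'h monoid" and K :: "'k ring" and e :: "'g \<Rightarrow> 'c"
  assumes G: "group G" and K: "field K" "finite (carrier K)" "order K = p ^ n" "Factorial_Ring.prime p"
    and inf: "infinite (UNIV :: 'c set)" and e: "inj e"
    and acts: "\<And>C :: ('k, 'c) coalgebra. coalgebra K C \<Longrightarrow> acts_faithfully K G C \<Longrightarrow> acts_faithfully K H C"
  obtains f where "f \<in> mon H G"
proof -
  obtain C :: "('k, 'c) coalgebra" where C: "coalgebra K C" "G \<cong> coalgebra_AutoGroup K C"
    by (rule rigid_coalgebra_exists[OF G K inf e])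
  obtain a b where a: "a \<in> mon G (coalgebra_AutoGroup K C)" and b: "b \<in> mon (coalgebra_AutoGroup K C) G"
    by (rule iso_mon[OF G C(2)])
  have "acts_faithfully K H C" using acts[OF C(1)] a by (auto simp: acts_faithfully_def)
  then obtain f where "f \<in> mon H (coalgebra_AutoGroup K C)" by (auto simp: acts_faithfully_def)
  thus thesis by (rule that[OF mon_comp[OF _ b]])
qed

theorem theorem1p5:
  fixes K :: "'k ring" and p n :: nat
    and G :: "'g monoid" and H :: "'h monoid"
  assumes "Factorial_Ring.prime p" and "n \<ge> 1"
    and "field K" and "finite (carrier K)" and "order K = p ^ n"
    and "group_class p n G" and "group_class p n H"
  shows "G \<cong> H \<longleftrightarrow>
    (\<forall>C :: ('k, ('g, 'h, 'u) universe) coalgebra. coalgebra K C \<longrightarrow>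
       (acts_faithfully K G C \<longleftrightarrow> acts_faithfully K H C))"
proof (rule iffI)
  have G: "group G" "co_Hopfian G"
    using assms(6) unfolding group_class_def by iprover+
  have H: "group H" using assms(7) unfolding group_class_def by iprover
  show "\<forall>C :: ('k, ('g, 'h, 'u) universe) coalgebra. coalgebra K C \<longrightarrow>
      (acts_faithfully K G C \<longleftrightarrow> acts_faithfully K H C)" if iso: "G \<cong> H"
  proof -
    obtain f g where f: "f \<in> mon G H" and g: "g \<in> mon H G" by (rule iso_mon[OF G(1) iso])
    show ?thesis
      by (intro allI impI iffI) (erule acts_faithfully_mon[OF g], erule acts_faithfully_mon[OF f])
  qed
  assume acts: "\<forall>C :: ('k, ('g, 'h, 'u) universe) coalgebra. coalgebra K C \<longrightarrow>
       (acts_faithfully K G C \<longleftrightarrow> acts_faithfully K H C)"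
  have inf: "infinite (UNIV :: ('g, 'h, 'u) universe set)"
    by (rule infinite_iff_countable_subset[THEN iffD2])
      (rule exI[of _ "\<lambda>k :: nat. Inr (Inr (Inl k))"], simp add: inj_def)
  \<comment> \<open>One coalgebra realises \<open>G\<close> and another realises \<open>H\<close>;
    the universe contains the element types of both groups, so each of the two constructions finds
    room in it.\<close>
  have eG: "inj (Inl :: 'g \<Rightarrow> ('g, 'h, 'u) universe)" by (simp add: inj_def)
  have eH: "inj (\<lambda>h. Inr (Inl h) :: ('g, 'h, 'u) universe)" by (simp add: inj_def)
  obtain f where f: "f \<in> mon H G"
    by (rule faithful_embedding[OF G(1) assms(3,4,5,1) inf eG]) (use acts in iprover)+
  obtain g where g: "g \<in> mon G H"
    by (rule faithful_embedding[OF H assms(3,4,5,1) inf eH]) (use acts in iprover)+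
  show "G \<cong> H" by (rule co_Hopfian_iso[OF G H g f])
qed

end
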